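(* Let $\mathbf{k}$ be a unitary commutative ring, $(A,Q)$ a commutative Rota-Baxter algebra of weight $\lambda$ over $\mathbf{k}$, $H$ a coalgebra over $\mathbf{k}$, and $M$ a right $H$-comodule with structure map $\delta(m)=\sum_{(m)}m_{(0)}\otimes h_{(1)}$. If $M$ is a free $\mathbf{k}$-module with basis $X$, then there is a matrix representation, i.e. a homomorphism of Rota-Baxter algebras $$f:\mathrm{Hom}_{\mathbf{k}}(H,A)\to M^c_{|X|\times|X|}(A),$$ induced from the algebra homomorphism $\phi:\mathrm{Hom}_{\mathbf{k}}(H,A)\to\mathrm{End}_A(M\otimes A)$, $\phi(g)(m\otimes a)=\sum_{(m)}m_{(0)}\otimes g(h_{(1)})a$, through the identification $\mathrm{End}_A(M\otimes A)=M^c_{|X|\times|X|}(A)$ given by the $A$-basis $\{x\otimes 1\}_{x\in X}$.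
   Context: $\otimes=\otimes_{\mathbf{k}}$; algebras are unitary associative over $\mathbf{k}$; a coalgebra $H$ has comultiplication $\Delta:H\to H\otimes H$ and counit $\epsilon:H\to\mathbf{k}$. A right comodule of $H$ is a $\mathbf{k}$-module $M$ together with a linear map $\delta:M\to M\otimes H$ such that $(\delta\otimes 1)\circ\delta=(1\otimes\Delta)\circ\delta$. A Rota-Baxter algebra of weight $\lambda\in\mathbf{k}$ is a pair $(R,P)$ with $R$ a $\mathbf{k}$-algebra and $P:R\to R$ $\mathbf{k}$-linear with $P(x)P(y)=P(xP(y))+P(P(x)y)+\lambda P(xy)$ for all $x,y\in R$; homomorphisms are homomorphisms of $\mathbf{k}$-algebras commuting with the operators. $\mathrm{Hom}_{\mathbf{k}}(H,A)$ is the convolution algebra, $(f_1\ast f_2)(h)=\sum_{(h)}f_1(h_{(1)})f_2(h_{(2)})$ with $\Delta(h)=\sum_{(h)}h_{(1)}\otimes h_{(2)}$, with Rota-Baxter operator $P(g)=Q\circ g$. $M\otimes A$ is a right $A$-module via the second factor, and $\mathrm{End}_A(M\otimes A)$ is its algebra of right $A$-module endomorphisms. $M^c_{|X|\times|X|}(A)$ is the algebra of $X\times X$ matrices over $A$ with finitely many nonzero entries in each column (for a fixed linear order on $X$), with Rota-Baxter operator given by applying $Q$ to each entry.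
   Formalization: Since comodules need not be counital (δ=0 gives φ=f=0), φ and f are shown to be k-linear and multiplicative, f also commuting with the operators, for every comodule; preservation of the unit is asserted only when M is counital. *)

theory Defs
  imports "HOL-Algebra.Module" "HOL-Algebra.Free_Abelian_Groups"
begin

section \<open>Linear maps, bases, associative algebras\<close>

text \<open>
  A module over a commutative ring \<open>K\<close> is a record of type \<open>('k, 'm) module\<close> satisfying the
  locale \<open>module K\<close>. The record has fields \<open>mult\<close> and \<open>one\<close>, which that locale ignores when the
  record is only a module; in the constructions below that are mere modules they are \<open>undefined\<close>.
\<close>

definition linear_map ::
  "('k, 'e) ring_scheme \<Rightarrow> ('k, 'm) module \<Rightarrow> ('k, 'n) module \<Rightarrow> ('m \<Rightarrow> 'n) \<Rightarrow> bool"
  where "linear_map K M N f \<longleftrightarrow>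
     f \<in> carrier M \<rightarrow> carrier N \<and>
     (\<forall>x\<in>carrier M. \<forall>y\<in>carrier M. f (x \<oplus>\<^bsub>M\<^esub> y) = f x \<oplus>\<^bsub>N\<^esub> f y) \<and>
     (\<forall>r\<in>carrier K. \<forall>x\<in>carrier M. f (r \<odot>\<^bsub>M\<^esub> x) = r \<odot>\<^bsub>N\<^esub> f x)"

text \<open>
  The set of linear maps. HOL functions are total, so that equality of elements means equality on
  \<open>carrier M\<close> only after their values outside \<open>carrier M\<close> have been fixed.
\<close>

definition linear_maps ::
  "('k, 'e) ring_scheme \<Rightarrow> ('k, 'm) module \<Rightarrow> ('k, 'n) module \<Rightarrow> ('m \<Rightarrow> 'n) set"
  where "linear_maps K M N = {f \<in> extensional (carrier M). linear_map K M N f}"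

definition self_module :: "'k ring \<Rightarrow> ('k, 'k) module"
  where "self_module K =
    \<lparr>carrier = carrier K, monoid.mult = (\<otimes>\<^bsub>K\<^esub>), one = \<one>\<^bsub>K\<^esub>,
     ring.zero = \<zero>\<^bsub>K\<^esub>, ring.add = (\<oplus>\<^bsub>K\<^esub>), smult = (\<otimes>\<^bsub>K\<^esub>)\<rparr>"

text \<open>
  Bases are families, not sets: over the zero ring distinct indices of a basis may carry the same
  vector. Coefficient families vanish outside the index set.
\<close>

definition coeff_families :: "('k, 'e) ring_scheme \<Rightarrow> 'i set \<Rightarrow> ('i \<Rightarrow> 'k) set"
  where "coeff_families K I =
    {c. (\<forall>i. c i \<in> carrier K) \<and> (\<forall>i. i \<notin> I \<longrightarrow> c i = \<zero>\<^bsub>K\<^esub>) \<and> finite {i. c i \<noteq> \<zero>\<^bsub>K\<^esub>}}"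

definition lincomb ::
  "('k, 'e) ring_scheme \<Rightarrow> ('k, 'm) module \<Rightarrow> 'i set \<Rightarrow> ('i \<Rightarrow> 'm) \<Rightarrow> ('i \<Rightarrow> 'k) \<Rightarrow> 'm"
  where "lincomb K M I b c = (\<Oplus>\<^bsub>M\<^esub>i\<in>{i \<in> I. c i \<noteq> \<zero>\<^bsub>K\<^esub>}. c i \<odot>\<^bsub>M\<^esub> b i)"

definition module_basis ::
  "('k, 'e) ring_scheme \<Rightarrow> ('k, 'm) module \<Rightarrow> 'i set \<Rightarrow> ('i \<Rightarrow> 'm) \<Rightarrow> bool"
  where "module_basis K M I b \<longleftrightarrow>
     module K M \<and> b \<in> I \<rightarrow> carrier M \<and>
     (\<forall>c\<in>coeff_families K I. lincomb K M I b c = \<zero>\<^bsub>M\<^esub> \<longrightarrow> (\<forall>i\<in>I. c i = \<zero>\<^bsub>K\<^esub>)) \<and>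
     (\<forall>m\<in>carrier M. \<exists>c\<in>coeff_families K I. m = lincomb K M I b c)"

definition coords ::
  "('k, 'e) ring_scheme \<Rightarrow> ('k, 'm) module \<Rightarrow> 'i set \<Rightarrow> ('i \<Rightarrow> 'm) \<Rightarrow> 'm \<Rightarrow> 'i \<Rightarrow> 'k"
  where "coords K M I b m = (THE c. c \<in> coeff_families K I \<and> m = lincomb K M I b c)"

text \<open>
  The library locale \<open>algebra\<close> covers commutative algebras only; this one does not require
  commutativity.
\<close>

locale assoc_algebra = module + ring M +
  assumes smult_mult_left:
      "\<lbrakk>r \<in> carrier R; x \<in> carrier M; y \<in> carrier M\<rbrakk> \<Longrightarrow>
        (r \<odot>\<^bsub>M\<^esub> x) \<otimes>\<^bsub>M\<^esub> y = r \<odot>\<^bsub>M\<^esub> (x \<otimes>\<^bsub>M\<^esub> y)"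
    and smult_mult_right:
      "\<lbrakk>r \<in> carrier R; x \<in> carrier M; y \<in> carrier M\<rbrakk> \<Longrightarrow>
        x \<otimes>\<^bsub>M\<^esub> (r \<odot>\<^bsub>M\<^esub> y) = r \<odot>\<^bsub>M\<^esub> (x \<otimes>\<^bsub>M\<^esub> y)"

text \<open>
  Homomorphisms come in two versions, without and with preservation of the unit; see the remark on
  comodules below.
\<close>

definition nonunital_algebra_hom ::
  "'k ring \<Rightarrow> ('k, 'a) module \<Rightarrow> ('k, 'b) module \<Rightarrow> ('a \<Rightarrow> 'b) \<Rightarrow> bool"
  where "nonunital_algebra_hom K R S f \<longleftrightarrow>
     assoc_algebra K R \<and> assoc_algebra K S \<and> linear_map K R S f \<and>
     (\<forall>x\<in>carrier R. \<forall>y\<in>carrier R. f (x \<otimes>\<^bsub>R\<^esub> y) = f x \<otimes>\<^bsub>S\<^esub> f y)"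

definition algebra_hom ::
  "'k ring \<Rightarrow> ('k, 'a) module \<Rightarrow> ('k, 'b) module \<Rightarrow> ('a \<Rightarrow> 'b) \<Rightarrow> bool"
  where "algebra_hom K R S f \<longleftrightarrow> nonunital_algebra_hom K R S f \<and> f \<one>\<^bsub>R\<^esub> = \<one>\<^bsub>S\<^esub>"

definition algebra_iso ::
  "'k ring \<Rightarrow> ('k, 'a) module \<Rightarrow> ('k, 'b) module \<Rightarrow> ('a \<Rightarrow> 'b) \<Rightarrow> bool"
  where "algebra_iso K R S f \<longleftrightarrow> algebra_hom K R S f \<and> bij_betw f (carrier R) (carrier S)"


section \<open>Rota-Baxter algebras\<close>

definition rota_baxter_algebra :: "'k ring \<Rightarrow> 'k \<Rightarrow> ('k, 'a) module \<Rightarrow> ('a \<Rightarrow> 'a) \<Rightarrow> bool"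
  where "rota_baxter_algebra K w R P \<longleftrightarrow>
     assoc_algebra K R \<and> w \<in> carrier K \<and> linear_map K R R P \<and>
     (\<forall>x\<in>carrier R. \<forall>y\<in>carrier R.
        P x \<otimes>\<^bsub>R\<^esub> P y =
          P (x \<otimes>\<^bsub>R\<^esub> P y) \<oplus>\<^bsub>R\<^esub> P (P x \<otimes>\<^bsub>R\<^esub> y) \<oplus>\<^bsub>R\<^esub> w \<odot>\<^bsub>R\<^esub> P (x \<otimes>\<^bsub>R\<^esub> y))"

definition nonunital_rota_baxter_hom ::
  "'k ring \<Rightarrow> 'k \<Rightarrow> ('k, 'a) module \<Rightarrow> ('a \<Rightarrow> 'a) \<Rightarrow> ('k, 'b) module \<Rightarrow> ('b \<Rightarrow> 'b)
    \<Rightarrow> ('a \<Rightarrow> 'b) \<Rightarrow> bool"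
  where "nonunital_rota_baxter_hom K w R P S Q f \<longleftrightarrow>
     rota_baxter_algebra K w R P \<and> rota_baxter_algebra K w S Q \<and>
     nonunital_algebra_hom K R S f \<and> (\<forall>x\<in>carrier R. f (P x) = Q (f x))"

definition rota_baxter_hom ::
  "'k ring \<Rightarrow> 'k \<Rightarrow> ('k, 'a) module \<Rightarrow> ('a \<Rightarrow> 'a) \<Rightarrow> ('k, 'b) module \<Rightarrow> ('b \<Rightarrow> 'b)
    \<Rightarrow> ('a \<Rightarrow> 'b) \<Rightarrow> bool"
  where "rota_baxter_hom K w R P S Q f \<longleftrightarrow>
     rota_baxter_algebra K w R P \<and> rota_baxter_algebra K w S Q \<and>
     algebra_hom K R S f \<and> (\<forall>x\<in>carrier R. f (P x) = Q (f x))"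


section \<open>Tensor products over a commutative ring\<close>

text \<open>
  The tensor product of \<open>M\<close> and \<open>N\<close> is the quotient of the free abelian group on
  \<open>carrier M \<times> carrier N\<close> by the subgroup generated by the biadditivity and balancing relations.
\<close>

abbreviation pair_group ::
  "('k, 'm) module \<Rightarrow> ('k, 'n) module \<Rightarrow> ('m \<times> 'n \<Rightarrow>\<^sub>0 int) monoid"
  where "pair_group M N \<equiv> free_Abelian_group (carrier M \<times> carrier N)"

definition tensor_relators ::
  "'k ring \<Rightarrow> ('k, 'm) module \<Rightarrow> ('k, 'n) module \<Rightarrow> ('m \<times> 'n \<Rightarrow>\<^sub>0 int) set"
  where "tensor_relators K M N =
    {frag_of (m \<oplus>\<^bsub>M\<^esub> m', n) - frag_of (m, n) - frag_of (m', n) | m m' n.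
       m \<in> carrier M \<and> m' \<in> carrier M \<and> n \<in> carrier N} \<union>
    {frag_of (m, n \<oplus>\<^bsub>N\<^esub> n') - frag_of (m, n) - frag_of (m, n') | m n n'.
       m \<in> carrier M \<and> n \<in> carrier N \<and> n' \<in> carrier N} \<union>
    {frag_of (r \<odot>\<^bsub>M\<^esub> m, n) - frag_of (m, r \<odot>\<^bsub>N\<^esub> n) | r m n.
       r \<in> carrier K \<and> m \<in> carrier M \<and> n \<in> carrier N}"

definition tensor_null ::
  "'k ring \<Rightarrow> ('k, 'm) module \<Rightarrow> ('k, 'n) module \<Rightarrow> ('m \<times> 'n \<Rightarrow>\<^sub>0 int) set"
  where "tensor_null K M N = generate (pair_group M N) (tensor_relators K M N)"

definition pure_tensor ::
  "'k ring \<Rightarrow> ('k, 'm) module \<Rightarrow> ('k, 'n) module \<Rightarrow> 'm \<Rightarrow> 'n \<Rightarrow> ('m \<times> 'n \<Rightarrow>\<^sub>0 int) set"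
  where "pure_tensor K M N m n = tensor_null K M N #>\<^bsub>pair_group M N\<^esub> frag_of (m, n)"

text \<open>
  The scalar \<open>r\<close> acts by \<open>(m, n) \<mapsto> (r m, n)\<close> on generators; the union in \<open>smult\<close> ranges over equal
  cosets, one for each representative of the class \<open>C\<close>.
\<close>

definition tensor ::
  "'k ring \<Rightarrow> ('k, 'm) module \<Rightarrow> ('k, 'n) module \<Rightarrow> ('k, ('m \<times> 'n \<Rightarrow>\<^sub>0 int) set) module"
  where "tensor K M N =
    \<lparr>carrier = carrier (pair_group M N Mod tensor_null K M N),
     monoid.mult = undefined, one = undefined,
     ring.zero = one (pair_group M N Mod tensor_null K M N),
     ring.add = monoid.mult (pair_group M N Mod tensor_null K M N),
     smult = (\<lambda>r C. \<Union>x\<in>C. tensor_null K M N #>\<^bsub>pair_group M N\<^esub>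
                frag_extend (\<lambda>(m, n). frag_of (r \<odot>\<^bsub>M\<^esub> m, n)) x)\<rparr>"

text \<open>
  The linear map with \<open>m \<otimes> n \<mapsto> \<beta> m n\<close>, for a bilinear map \<open>\<beta>\<close>. In Sweedler notation,
  \<open>tensor_lift K M N P \<beta> t\<close> is \<open>\<Sum> \<beta> t\<^sub>1 t\<^sub>2\<close> for \<open>t = \<Sum> t\<^sub>1 \<otimes> t\<^sub>2\<close>.
\<close>

definition tensor_lift ::
  "'k ring \<Rightarrow> ('k, 'm) module \<Rightarrow> ('k, 'n) module \<Rightarrow> ('k, 'p) module \<Rightarrow> ('m \<Rightarrow> 'n \<Rightarrow> 'p)
    \<Rightarrow> ('m \<times> 'n \<Rightarrow>\<^sub>0 int) set \<Rightarrow> 'p"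
  where "tensor_lift K M N P \<beta> =
    (THE u. u \<in> linear_maps K (tensor K M N) P \<and>
            (\<forall>m\<in>carrier M. \<forall>n\<in>carrier N. u (pure_tensor K M N m n) = \<beta> m n))"

definition tensor_map ::
  "'k ring \<Rightarrow> ('k, 'm) module \<Rightarrow> ('k, 'n) module \<Rightarrow> ('k, 'p) module \<Rightarrow> ('k, 'q) module
    \<Rightarrow> ('m \<Rightarrow> 'p) \<Rightarrow> ('n \<Rightarrow> 'q) \<Rightarrow> ('m \<times> 'n \<Rightarrow>\<^sub>0 int) set \<Rightarrow> ('p \<times> 'q \<Rightarrow>\<^sub>0 int) set"
  where "tensor_map K M N P Q f g =
    tensor_lift K M N (tensor K P Q) (\<lambda>m n. pure_tensor K P Q (f m) (g n))"

text \<open>The canonical isomorphism from \<open>(L \<otimes> M) \<otimes> N\<close> to \<open>L \<otimes> (M \<otimes> N)\<close>.\<close>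

definition tensor_assoc ::
  "'k ring \<Rightarrow> ('k, 'l) module \<Rightarrow> ('k, 'm) module \<Rightarrow> ('k, 'n) module
    \<Rightarrow> (('l \<times> 'm \<Rightarrow>\<^sub>0 int) set \<times> 'n \<Rightarrow>\<^sub>0 int) set
    \<Rightarrow> ('l \<times> ('m \<times> 'n \<Rightarrow>\<^sub>0 int) set \<Rightarrow>\<^sub>0 int) set"
  where "tensor_assoc K L M N =
    tensor_lift K (tensor K L M) N (tensor K L (tensor K M N))
      (\<lambda>t n. tensor_lift K L M (tensor K L (tensor K M N))
               (\<lambda>l m. pure_tensor K L (tensor K M N) l (pure_tensor K M N m n)) t)"


section \<open>Coalgebras, comodules and the convolution algebra\<close>

definition coalgebra ::
  "'k ring \<Rightarrow> ('k, 'h) module \<Rightarrow> ('h \<Rightarrow> ('h \<times> 'h \<Rightarrow>\<^sub>0 int) set) \<Rightarrow> ('h \<Rightarrow> 'k) \<Rightarrow> bool"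
  where "coalgebra K H \<Delta> \<epsilon> \<longleftrightarrow>
     module K H \<and> linear_map K H (tensor K H H) \<Delta> \<and> linear_map K H (self_module K) \<epsilon> \<and>
     (\<forall>h\<in>carrier H.
        tensor_assoc K H H H (tensor_map K H H (tensor K H H) H \<Delta> (\<lambda>h. h) (\<Delta> h)) =
        tensor_map K H H H (tensor K H H) (\<lambda>h. h) \<Delta> (\<Delta> h)) \<and>
     (\<forall>h\<in>carrier H. tensor_lift K H H H (\<lambda>h\<^sub>1 h\<^sub>2. \<epsilon> h\<^sub>1 \<odot>\<^bsub>H\<^esub> h\<^sub>2) (\<Delta> h) = h) \<and>
     (\<forall>h\<in>carrier H. tensor_lift K H H H (\<lambda>h\<^sub>1 h\<^sub>2. \<epsilon> h\<^sub>2 \<odot>\<^bsub>H\<^esub> h\<^sub>1) (\<Delta> h) = h)"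

text \<open>
  Comodules are only required to be coassociative. The zero map is then an admissible structure map
  and it induces the zero homomorphism, so preservation of units needs the comodule to be counital.
\<close>

definition right_comodule ::
  "'k ring \<Rightarrow> ('k, 'h) module \<Rightarrow> ('h \<Rightarrow> ('h \<times> 'h \<Rightarrow>\<^sub>0 int) set)
    \<Rightarrow> ('k, 'm) module \<Rightarrow> ('m \<Rightarrow> ('m \<times> 'h \<Rightarrow>\<^sub>0 int) set) \<Rightarrow> bool"
  where "right_comodule K H \<Delta> M \<delta> \<longleftrightarrow>
     module K M \<and> linear_map K M (tensor K M H) \<delta> \<and>
     (\<forall>m\<in>carrier M.
        tensor_assoc K M H H (tensor_map K M H (tensor K M H) H \<delta> (\<lambda>h. h) (\<delta> m)) =
        tensor_map K M H M (tensor K H H) (\<lambda>m. m) \<Delta> (\<delta> m))"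

definition counital ::
  "'k ring \<Rightarrow> ('k, 'h) module \<Rightarrow> ('h \<Rightarrow> 'k)
    \<Rightarrow> ('k, 'm) module \<Rightarrow> ('m \<Rightarrow> ('m \<times> 'h \<Rightarrow>\<^sub>0 int) set) \<Rightarrow> bool"
  where "counital K H \<epsilon> M \<delta> \<longleftrightarrow>
     (\<forall>m\<in>carrier M. tensor_lift K M H M (\<lambda>m' h. \<epsilon> h \<odot>\<^bsub>M\<^esub> m') (\<delta> m) = m)"

definition convolution_algebra ::
  "'k ring \<Rightarrow> ('k, 'h) module \<Rightarrow> ('h \<Rightarrow> ('h \<times> 'h \<Rightarrow>\<^sub>0 int) set) \<Rightarrow> ('h \<Rightarrow> 'k)
    \<Rightarrow> ('k, 'a) module \<Rightarrow> ('k, 'h \<Rightarrow> 'a) module"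
  where "convolution_algebra K H \<Delta> \<epsilon> A =
    \<lparr>carrier = linear_maps K H A,
     monoid.mult = (\<lambda>f g. \<lambda>h\<in>carrier H. tensor_lift K H H A (\<lambda>h\<^sub>1 h\<^sub>2. f h\<^sub>1 \<otimes>\<^bsub>A\<^esub> g h\<^sub>2) (\<Delta> h)),
     one = (\<lambda>h\<in>carrier H. \<epsilon> h \<odot>\<^bsub>A\<^esub> \<one>\<^bsub>A\<^esub>),
     ring.zero = (\<lambda>h\<in>carrier H. \<zero>\<^bsub>A\<^esub>),
     ring.add = (\<lambda>f g. \<lambda>h\<in>carrier H. f h \<oplus>\<^bsub>A\<^esub> g h),
     smult = (\<lambda>r f. \<lambda>h\<in>carrier H. r \<odot>\<^bsub>A\<^esub> f h)\<rparr>"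

definition convolution_operator ::
  "('k, 'h) module \<Rightarrow> ('a \<Rightarrow> 'a) \<Rightarrow> ('h \<Rightarrow> 'a) \<Rightarrow> 'h \<Rightarrow> 'a"
  where "convolution_operator H Q g = (\<lambda>h\<in>carrier H. Q (g h))"


section \<open>Endomorphisms of $M \otimes A$ and column-finite matrices\<close>

text \<open>
  \<open>M \<otimes> A\<close> as a module over the commutative ring \<open>A\<close>, with \<open>b \<in> A\<close> acting by
  \<open>m \<otimes> a \<mapsto> m \<otimes> a b\<close>. As \<open>A\<close> is commutative, right \<open>A\<close>-modules are written as library modules.
\<close>

definition base_change ::
  "'k ring \<Rightarrow> ('k, 'm) module \<Rightarrow> ('k, 'a) module \<Rightarrow> ('a, ('m \<times> 'a \<Rightarrow>\<^sub>0 int) set) module"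
  where "base_change K M A =
    \<lparr>carrier = carrier (tensor K M A), monoid.mult = undefined, one = undefined,
     ring.zero = ring.zero (tensor K M A), ring.add = ring.add (tensor K M A),
     smult = (\<lambda>b. tensor_map K M A M A (\<lambda>m. m) (\<lambda>a. a \<otimes>\<^bsub>A\<^esub> b))\<rparr>"

text \<open>
  \<open>End\<^sub>A (M \<otimes> A)\<close>, as an algebra over \<open>K\<close>.
\<close>

definition endo_algebra ::
  "'k ring \<Rightarrow> ('k, 'm) module \<Rightarrow> ('k, 'a) module
    \<Rightarrow> ('k, ('m \<times> 'a \<Rightarrow>\<^sub>0 int) set \<Rightarrow> ('m \<times> 'a \<Rightarrow>\<^sub>0 int) set) module"
  where "endo_algebra K M A =
    \<lparr>carrier = linear_maps A (base_change K M A) (base_change K M A),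
     monoid.mult = (\<lambda>S T. compose (carrier (tensor K M A)) S T),
     one = (\<lambda>t\<in>carrier (tensor K M A). t),
     ring.zero = (\<lambda>t\<in>carrier (tensor K M A). \<zero>\<^bsub>tensor K M A\<^esub>),
     ring.add = (\<lambda>S T. \<lambda>t\<in>carrier (tensor K M A). S t \<oplus>\<^bsub>tensor K M A\<^esub> T t),
     smult = (\<lambda>r T. \<lambda>t\<in>carrier (tensor K M A). r \<odot>\<^bsub>tensor K M A\<^esub> T t)\<rparr>"

text \<open>Matrices indexed by \<open>I \<times> I\<close> are functions that vanish outside of \<open>I \<times> I\<close>.\<close>

definition column_finite_matrices :: "('k, 'a) module \<Rightarrow> 'x set \<Rightarrow> ('x \<Rightarrow> 'x \<Rightarrow> 'a) set"
  where "column_finite_matrices A I =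
    {B. (\<forall>x y. B x y \<in> carrier A) \<and>
        (\<forall>x y. x \<notin> I \<or> y \<notin> I \<longrightarrow> B x y = \<zero>\<^bsub>A\<^esub>) \<and>
        (\<forall>y. finite {x. B x y \<noteq> \<zero>\<^bsub>A\<^esub>})}"

definition matrix_algebra :: "('k, 'a) module \<Rightarrow> 'x set \<Rightarrow> ('k, 'x \<Rightarrow> 'x \<Rightarrow> 'a) module"
  where "matrix_algebra A I =
    \<lparr>carrier = column_finite_matrices A I,
     monoid.mult = (\<lambda>B C x y. \<Oplus>\<^bsub>A\<^esub>z\<in>{z \<in> I. C z y \<noteq> \<zero>\<^bsub>A\<^esub>}. B x z \<otimes>\<^bsub>A\<^esub> C z y),
     one = (\<lambda>x y. if x = y \<and> x \<in> I then \<one>\<^bsub>A\<^esub> else \<zero>\<^bsub>A\<^esub>),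
     ring.zero = (\<lambda>x y. \<zero>\<^bsub>A\<^esub>),
     ring.add = (\<lambda>B C x y. B x y \<oplus>\<^bsub>A\<^esub> C x y),
     smult = (\<lambda>r B x y. r \<odot>\<^bsub>A\<^esub> B x y)\<rparr>"

text \<open>Applying \<open>Q\<close> to each entry keeps the entries outside of \<open>I \<times> I\<close> zero, as \<open>Q\<close> is linear.\<close>

definition matrix_operator :: "('a \<Rightarrow> 'a) \<Rightarrow> ('x \<Rightarrow> 'x \<Rightarrow> 'a) \<Rightarrow> 'x \<Rightarrow> 'x \<Rightarrow> 'a"
  where "matrix_operator Q B = (\<lambda>x y. Q (B x y))"

text \<open>
  The matrix of \<open>T\<close> with respect to the family \<open>x \<otimes> 1\<close>: column \<open>y\<close> consists of the coordinates of
  \<open>T (y \<otimes> 1)\<close>.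
\<close>

definition endo_matrix ::
  "'k ring \<Rightarrow> ('k, 'm) module \<Rightarrow> ('k, 'a) module \<Rightarrow> 'm set
    \<Rightarrow> (('m \<times> 'a \<Rightarrow>\<^sub>0 int) set \<Rightarrow> ('m \<times> 'a \<Rightarrow>\<^sub>0 int) set) \<Rightarrow> 'm \<Rightarrow> 'm \<Rightarrow> 'a"
  where "endo_matrix K M A I T = (\<lambda>x y.
    if y \<in> I
    then coords A (base_change K M A) I (\<lambda>x. pure_tensor K M A x \<one>\<^bsub>A\<^esub>)
           (T (pure_tensor K M A y \<one>\<^bsub>A\<^esub>)) x
    else \<zero>\<^bsub>A\<^esub>)"

end

theory Submission
  imports Defs
begin

text \<open>
  A family \<open>x\<close> that is a \<open>K\<close>-basis of \<open>M\<close> yields the \<open>A\<close>-basis \<open>x \<otimes> 1\<close> of \<open>M \<otimes> A\<close>; the coordinate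
  of \<open>m \<otimes> a\<close> at \<open>x\<close> is the coordinate of \<open>m\<close> at \<open>x\<close> times \<open>a\<close>. Taking matrices is therefore an
  isomorphism from \<open>End\<^sub>A (M \<otimes> A)\<close> to the column-finite matrices, and the algebra axioms of the latter
  are transported along it. Multiplicativity of \<open>\<phi>\<close> is coassociativity of \<open>\<delta>\<close> applied to the
  trilinear map \<open>(m, h, h') \<mapsto> m \<otimes> f(h) g(h') a\<close>, and associativity of convolution is the same
  statement for \<open>H\<close> as a comodule over itself. The entries of the matrix of \<open>\<phi>(g)\<close> are sums
  \<open>\<Sum> c\<^sub>x(y\<^sub>0) g(h\<^sub>1)\<close> with coefficients \<open>c\<^sub>x(y\<^sub>0)\<close> in \<open>K\<close>, so they commute with the linear map \<open>Q\<close>.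
\<close>

section \<open>Linear maps\<close>

text \<open>Tensors exist here only as cosets in a free abelian group, so a Sweedler sum has to be a
  value of \<open>tensor_lift\<close>, and a nested sum is a lift of a map that is itself built from
  lifts. The recurring burden is therefore that an inner lift depends linearly on the outer
  variables; once this is available, identities are tested on pure tensors. No direct sum
  decomposition of M \<otimes> A enters. The coordinate at x is a functional on M \<otimes> A
  obtained from the coordinate functional of M by the universal property, and evaluating it on a
  linear combination gives both independence of the vectors x \<otimes> 1 and the coordinate
  formula. The special form of this basis is what makes the operators match: its coordinates come
  from functionals M \<rightarrow> K, whereas coordinates with respect to another A-basis would
  bring in coefficients from A, over which \<open>Q\<close> is in general not linear.
  Coassociativity alone yields multiplicative maps, so units are treated apart, under the counit
  condition on the comodule.\<close>

lemma linear_mapI: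
  assumes "\<And>x. x \<in> carrier M \<Longrightarrow> f x \<in> carrier N"
    and "\<And>x y. \<lbrakk>x \<in> carrier M; y \<in> carrier M\<rbrakk> \<Longrightarrow> f (x \<oplus>\<^bsub>M\<^esub> y) = f x \<oplus>\<^bsub>N\<^esub> f y"
    and "\<And>r x. \<lbrakk>r \<in> carrier K; x \<in> carrier M\<rbrakk> \<Longrightarrow> f (r \<odot>\<^bsub>M\<^esub> x) = r \<odot>\<^bsub>N\<^esub> f x"
  shows "linear_map K M N f"
  using assms by (auto simp: linear_map_def)

lemma linear_map_closed:
  "\<lbrakk>linear_map K M N f; x \<in> carrier M\<rbrakk> \<Longrightarrow> f x \<in> carrier N"
  by (auto simp: linear_map_def)

lemma linear_map_add:
  "\<lbrakk>linear_map K M N f; x \<in> carrier M; y \<in> carrier M\<rbrakk> \<Longrightarrow> f (x \<oplus>\<^bsub>M\<^esub> y) = f x \<oplus>\<^bsub>N\<^esub> f y"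
  by (auto simp: linear_map_def)

lemma linear_map_smult:
  "\<lbrakk>linear_map K M N f; r \<in> carrier K; x \<in> carrier M\<rbrakk> \<Longrightarrow> f (r \<odot>\<^bsub>M\<^esub> x) = r \<odot>\<^bsub>N\<^esub> f x"
  by (auto simp: linear_map_def)

lemma linear_map_zero:
  assumes "module K M" "module K N" "linear_map K M N f"
  shows "f \<zero>\<^bsub>M\<^esub> = \<zero>\<^bsub>N\<^esub>"
proof -
  interpret M: module K M by fact
  interpret N: module K N by fact
  have "f \<zero>\<^bsub>M\<^esub> = f (\<zero>\<^bsub>K\<^esub> \<odot>\<^bsub>M\<^esub> \<zero>\<^bsub>M\<^esub>)" by simp
  also have "\<dots> = \<zero>\<^bsub>K\<^esub> \<odot>\<^bsub>N\<^esub> f \<zero>\<^bsub>M\<^esub>"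
    using assms(3) by (simp add: linear_map_smult del: M.smult_l_null M.smult_r_null)
  finally show ?thesis using assms(3) by (simp add: linear_map_closed)
qed

lemma linear_map_finsum:
  assumes "module K M" "module K N" "linear_map K M N f" "g \<in> S \<rightarrow> carrier M"
  shows "f (\<Oplus>\<^bsub>M\<^esub>i\<in>S. g i) = (\<Oplus>\<^bsub>N\<^esub>i\<in>S. f (g i))"
proof -
  interpret M: module K M by fact
  interpret N: module K N by fact
  show ?thesis using assms(4)
  proof (induction S rule: infinite_finite_induct)
    case (insert i S)
    then have "(\<lambda>j. f (g j)) \<in> S \<rightarrow> carrier N" "f (g i) \<in> carrier N"
      using assms(3) by (auto intro: linear_map_closed)
    then show ?case
      using insert assms(3)
      by (simp add: M.M.finsum_insert N.M.finsum_insert linear_map_add Pi_iff M.M.finsum_closed)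
  \<comment> \<open>Over an infinite index set both sums have the default value zero, so this case
    too says only that \<open>f\<close> preserves zero.\<close>
  qed (simp_all add: linear_map_zero[OF assms(1-3)] M.M.finsum_infinite N.M.finsum_infinite)
qed

lemma linear_map_cong:
  assumes "module K M" "linear_map K M N f" "\<And>x. x \<in> carrier M \<Longrightarrow> f x = g x"
  shows "linear_map K M N g"
proof -
  interpret M: module K M by fact
  show ?thesis
    using assms(2) by (auto intro!: linear_mapI simp: assms(3)[symmetric]
        linear_map_closed linear_map_add linear_map_smult)
qed

lemma linear_map_compose:
  assumes "linear_map K M N f" "linear_map K N P g"
  shows "linear_map K M P (\<lambda>x. g (f x))"
  using assms by (auto simp: linear_map_def Pi_iff)

lemma linear_map_id: "linear_map K M M (\<lambda>x. x)"
  by (auto simp: linear_map_def)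

lemma linear_map_plus:
  assumes "module K N" "linear_map K M N f" "linear_map K M N g"
  shows "linear_map K M N (\<lambda>x. f x \<oplus>\<^bsub>N\<^esub> g x)"
proof -
  interpret N: module K N by fact
  show ?thesis
    using assms(2,3) by (intro linear_mapI)
      (simp_all add: linear_map_closed linear_map_add linear_map_smult
        N.M.a_ac N.smult_r_distr)
qed

lemma linear_map_scale:
  assumes "module K N" "linear_map K M N f" "r \<in> carrier K"
  shows "linear_map K M N (\<lambda>x. r \<odot>\<^bsub>N\<^esub> f x)"
proof -
  interpret N: module K N by fact
  show ?thesis
    using assms(2,3) by (intro linear_mapI)
      (simp_all add: linear_map_closed linear_map_add linear_map_smult N.smult_r_distr
        N.smult_assoc1[symmetric] N.R.m_comm)
qed

lemma linear_map_const_zero: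
  assumes "module K N"
  shows "linear_map K M N (\<lambda>x. \<zero>\<^bsub>N\<^esub>)"
proof -
  interpret N: module K N by fact
  show ?thesis by (intro linear_mapI) simp_all
qed

lemma linear_map_smult_left:
  assumes "module K M" "m \<in> carrier M"
  shows "linear_map K (self_module K) M (\<lambda>r. r \<odot>\<^bsub>M\<^esub> m)"
proof -
  interpret M: module K M by fact
  show ?thesis using assms(2)
    by (intro linear_mapI) (simp_all add: self_module_def M.smult_l_distr M.smult_assoc1)
qed

lemma linear_maps_iff:
  "f \<in> linear_maps K M N \<longleftrightarrow> f \<in> extensional (carrier M) \<and> linear_map K M N f"
  by (simp add: linear_maps_def)

lemma restrict_linear_maps:
  assumes "module K M" "linear_map K M N f"
  shows "restrict f (carrier M) \<in> linear_maps K M N"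
  using assms by (auto simp: linear_maps_iff intro: linear_map_cong)

lemma linear_maps_eqI:
  assumes "f \<in> linear_maps K M N" "g \<in> linear_maps K M N"
    and "\<And>x. x \<in> carrier M \<Longrightarrow> f x = g x"
  shows "f = g"
  using assms by (auto simp: linear_maps_iff intro: extensionalityI)

section \<open>Constructing modules and algebras\<close>

text \<open>The evaluations are jointly injective and carry the operations of \<open>V\<close> to
  those of \<open>N\<close>, so every module axiom can be verified after evaluation, where it is an
  axiom of \<open>N\<close>. This serves algebras of functions, evaluated at points, and transported
  structures, evaluated by the inverse bijection.\<close>

lemma module_by_evaluation:
  fixes ev :: "'v \<Rightarrow> 's \<Rightarrow> 'n"
  assumes "module K N"
    and ev_closed: "\<And>x s. \<lbrakk>x \<in> carrier V; s \<in> S\<rbrakk> \<Longrightarrow> ev x s \<in> carrier N"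
    and ev_inj: "\<And>x y. \<lbrakk>x \<in> carrier V; y \<in> carrier V; \<And>s. s \<in> S \<Longrightarrow> ev x s = ev y s\<rbrakk> \<Longrightarrow> x = y"
    and zero: "\<zero>\<^bsub>V\<^esub> \<in> carrier V"
    and add: "\<And>x y. \<lbrakk>x \<in> carrier V; y \<in> carrier V\<rbrakk> \<Longrightarrow> x \<oplus>\<^bsub>V\<^esub> y \<in> carrier V"
    and smult: "\<And>r x. \<lbrakk>r \<in> carrier K; x \<in> carrier V\<rbrakk> \<Longrightarrow> r \<odot>\<^bsub>V\<^esub> x \<in> carrier V"
    and ev_zero: "\<And>s. s \<in> S \<Longrightarrow> ev \<zero>\<^bsub>V\<^esub> s = \<zero>\<^bsub>N\<^esub>"
    and ev_add: "\<And>x y s. \<lbrakk>x \<in> carrier V; y \<in> carrier V; s \<in> S\<rbrakk> \<Longrightarrow>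
      ev (x \<oplus>\<^bsub>V\<^esub> y) s = ev x s \<oplus>\<^bsub>N\<^esub> ev y s"
    and ev_smult: "\<And>r x s. \<lbrakk>r \<in> carrier K; x \<in> carrier V; s \<in> S\<rbrakk> \<Longrightarrow>
      ev (r \<odot>\<^bsub>V\<^esub> x) s = r \<odot>\<^bsub>N\<^esub> ev x s"
  shows "module K V"
proof -
  interpret N: module K N by fact
  note rules = zero add smult ev_closed ev_zero ev_add ev_smult
  have "abelian_group V"
  proof (rule abelian_groupI)
    fix x assume x: "x \<in> carrier V"
    \<comment> \<open>The multiple by minus one supplies the additive inverse, which is not among
      the given operations.\<close>
    have "ev ((\<ominus>\<^bsub>K\<^esub> \<one>\<^bsub>K\<^esub>) \<odot>\<^bsub>V\<^esub> x \<oplus>\<^bsub>V\<^esub> x) s = ev \<zero>\<^bsub>V\<^esub> s" if "s \<in> S" for s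
      using x that by (simp add: rules N.smult_l_minus N.M.l_neg)
    then have "(\<ominus>\<^bsub>K\<^esub> \<one>\<^bsub>K\<^esub>) \<odot>\<^bsub>V\<^esub> x \<oplus>\<^bsub>V\<^esub> x = \<zero>\<^bsub>V\<^esub>"
      using x by (intro ev_inj) (simp_all add: rules)
    then show "\<exists>y\<in>carrier V. y \<oplus>\<^bsub>V\<^esub> x = \<zero>\<^bsub>V\<^esub>"
      using x by (intro bexI[of _ "(\<ominus>\<^bsub>K\<^esub> \<one>\<^bsub>K\<^esub>) \<odot>\<^bsub>V\<^esub> x"]) (simp_all add: rules)
  qed (auto intro!: ev_inj simp: rules N.M.a_ac)
  then show ?thesis
    by (intro moduleI N.R.is_cring)
      (auto intro!: ev_inj simp: rules N.smult_l_distr N.smult_r_distr N.smult_assoc1)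
qed

lemma assoc_algebraI:
  assumes "module K R"
    and "\<And>x y. \<lbrakk>x \<in> carrier R; y \<in> carrier R\<rbrakk> \<Longrightarrow> x \<otimes>\<^bsub>R\<^esub> y \<in> carrier R"
    and "\<one>\<^bsub>R\<^esub> \<in> carrier R"
    and "\<And>x y z. \<lbrakk>x \<in> carrier R; y \<in> carrier R; z \<in> carrier R\<rbrakk> \<Longrightarrow>
      (x \<otimes>\<^bsub>R\<^esub> y) \<otimes>\<^bsub>R\<^esub> z = x \<otimes>\<^bsub>R\<^esub> (y \<otimes>\<^bsub>R\<^esub> z)"
    and "\<And>x. x \<in> carrier R \<Longrightarrow> \<one>\<^bsub>R\<^esub> \<otimes>\<^bsub>R\<^esub> x = x"
    and "\<And>x. x \<in> carrier R \<Longrightarrow> x \<otimes>\<^bsub>R\<^esub> \<one>\<^bsub>R\<^esub> = x"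
    and "\<And>x y z. \<lbrakk>x \<in> carrier R; y \<in> carrier R; z \<in> carrier R\<rbrakk> \<Longrightarrow>
      (x \<oplus>\<^bsub>R\<^esub> y) \<otimes>\<^bsub>R\<^esub> z = x \<otimes>\<^bsub>R\<^esub> z \<oplus>\<^bsub>R\<^esub> y \<otimes>\<^bsub>R\<^esub> z"
    and "\<And>x y z. \<lbrakk>x \<in> carrier R; y \<in> carrier R; z \<in> carrier R\<rbrakk> \<Longrightarrow>
      z \<otimes>\<^bsub>R\<^esub> (x \<oplus>\<^bsub>R\<^esub> y) = z \<otimes>\<^bsub>R\<^esub> x \<oplus>\<^bsub>R\<^esub> z \<otimes>\<^bsub>R\<^esub> y"
    and "\<And>r x y. \<lbrakk>r \<in> carrier K; x \<in> carrier R; y \<in> carrier R\<rbrakk> \<Longrightarrow>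
      (r \<odot>\<^bsub>R\<^esub> x) \<otimes>\<^bsub>R\<^esub> y = r \<odot>\<^bsub>R\<^esub> (x \<otimes>\<^bsub>R\<^esub> y)"
    and "\<And>r x y. \<lbrakk>r \<in> carrier K; x \<in> carrier R; y \<in> carrier R\<rbrakk> \<Longrightarrow>
      x \<otimes>\<^bsub>R\<^esub> (r \<odot>\<^bsub>R\<^esub> y) = r \<odot>\<^bsub>R\<^esub> (x \<otimes>\<^bsub>R\<^esub> y)"
  shows "assoc_algebra K R"
proof -
  interpret R: module K R by fact
  have "ring R"
    by (intro ringI R.M.abelian_group_axioms monoidI assms)
  then show ?thesis
    using assms by (intro assoc_algebra.intro assoc_algebra_axioms.intro)
qed

lemma assoc_algebra_transport:
  assumes "assoc_algebra K R" and f: "bij_betw f (carrier R) (carrier S)"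
    and zero: "\<zero>\<^bsub>S\<^esub> = f \<zero>\<^bsub>R\<^esub>" and one: "\<one>\<^bsub>S\<^esub> = f \<one>\<^bsub>R\<^esub>"
    and add: "\<And>x y. \<lbrakk>x \<in> carrier R; y \<in> carrier R\<rbrakk> \<Longrightarrow> f x \<oplus>\<^bsub>S\<^esub> f y = f (x \<oplus>\<^bsub>R\<^esub> y)"
    and mult: "\<And>x y. \<lbrakk>x \<in> carrier R; y \<in> carrier R\<rbrakk> \<Longrightarrow> f x \<otimes>\<^bsub>S\<^esub> f y = f (x \<otimes>\<^bsub>R\<^esub> y)"
    and smult: "\<And>r x. \<lbrakk>r \<in> carrier K; x \<in> carrier R\<rbrakk> \<Longrightarrow> r \<odot>\<^bsub>S\<^esub> f x = f (r \<odot>\<^bsub>R\<^esub> x)"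
  shows "assoc_algebra K S"
proof -
  interpret R: assoc_algebra K R by fact
  have S: "carrier S = f ` carrier R" using f by (simp add: bij_betw_def)
  \<comment> \<open>A single evaluation, the inverse of \<open>f\<close>, is injective by itself;
    the index type \<open>unit\<close> only fits it to the form of
    \<open>module_by_evaluation\<close>.\<close>
  define ev where "ev s (u::unit) = inv_into (carrier R) f s" for s u
  have ev: "ev (f x) u = x" if "x \<in> carrier R" for x u
    using f that by (simp add: ev_def bij_betw_def)
  have "module K S"
    by (rule module_by_evaluation[of K R S UNIV ev])
      (auto simp: S zero add smult ev R.module_axioms)
  then show ?thesis
    by (rule assoc_algebraI)
      (auto simp: S one add mult smult R.m_assoc R.l_distr R.r_distr
        R.smult_mult_left R.smult_mult_right)
qed

section \<open>Tensor products\<close>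

definition bilinear_map ::
  "'k ring \<Rightarrow> ('k, 'm) module \<Rightarrow> ('k, 'n) module \<Rightarrow> ('k, 'p) module \<Rightarrow> ('m \<Rightarrow> 'n \<Rightarrow> 'p) \<Rightarrow> bool"
  where "bilinear_map K M N P \<beta> \<longleftrightarrow>
    (\<forall>n\<in>carrier N. linear_map K M P (\<lambda>m. \<beta> m n)) \<and> (\<forall>m\<in>carrier M. linear_map K N P (\<beta> m))"

lemma bilinear_mapI:
  assumes "\<And>n. n \<in> carrier N \<Longrightarrow> linear_map K M P (\<lambda>m. \<beta> m n)"
    and "\<And>m. m \<in> carrier M \<Longrightarrow> linear_map K N P (\<beta> m)"
  shows "bilinear_map K M N P \<beta>"
  using assms by (simp add: bilinear_map_def)

lemma bilinear_map_left: "\<lbrakk>bilinear_map K M N P \<beta>; n \<in> carrier N\<rbrakk> \<Longrightarrow> linear_map K M P (\<lambda>m. \<beta> m n)"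
  by (simp add: bilinear_map_def)

lemma bilinear_map_right: "\<lbrakk>bilinear_map K M N P \<beta>; m \<in> carrier M\<rbrakk> \<Longrightarrow> linear_map K N P (\<beta> m)"
  by (simp add: bilinear_map_def)

lemma bilinear_map_closed:
  "\<lbrakk>bilinear_map K M N P \<beta>; m \<in> carrier M; n \<in> carrier N\<rbrakk> \<Longrightarrow> \<beta> m n \<in> carrier P"
  by (auto simp: bilinear_map_def intro: linear_map_closed)

lemma frag_diff_closed:
  "\<lbrakk>Poly_Mapping.keys a \<subseteq> S; Poly_Mapping.keys b \<subseteq> S\<rbrakk> \<Longrightarrow> Poly_Mapping.keys (a - b) \<subseteq> S"
  using keys_diff[of a b] by blast

section \<open>The tensor product as a quotient group and its module structure\<close>

context
  fixes K :: "'k ring" and M :: "('k, 'm) module" and N :: "('k, 'n) module"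
  assumes M: "module K M" and N: "module K N"
begin

private abbreviation (input) "G \<equiv> pair_group M N"
private abbreviation (input) "Z \<equiv> tensor_null K M N"
private abbreviation (input) "MN \<equiv> tensor K M N"
private abbreviation (input) "cls x \<equiv> Z #>\<^bsub>G\<^esub> x"
private abbreviation (input) "scale r \<equiv> frag_extend (\<lambda>(m, n). frag_of (r \<odot>\<^bsub>M\<^esub> m, n))"

interpretation M: module K M by (rule M)
interpretation N: module K N by (rule N)
interpretation G: comm_group "pair_group M N" by (rule abelian_free_Abelian_group)

private lemma relator_left:
  assumes "m \<in> carrier M" "m' \<in> carrier M" "n \<in> carrier N"
  shows "frag_of (m \<oplus>\<^bsub>M\<^esub> m', n) - frag_of (m, n) - frag_of (m', n) \<in> tensor_relators K M N"
  unfolding tensor_relators_def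
  by (rule UnI1, rule UnI1, intro CollectI exI conjI) (rule refl assms)+

private lemma relator_right:
  assumes "m \<in> carrier M" "n \<in> carrier N" "n' \<in> carrier N"
  shows "frag_of (m, n \<oplus>\<^bsub>N\<^esub> n') - frag_of (m, n) - frag_of (m, n') \<in> tensor_relators K M N"
  unfolding tensor_relators_def
  by (rule UnI1, rule UnI2, intro CollectI exI conjI) (rule refl assms)+

private lemma relator_balance:
  assumes "r \<in> carrier K" "m \<in> carrier M" "n \<in> carrier N"
  shows "frag_of (r \<odot>\<^bsub>M\<^esub> m, n) - frag_of (m, r \<odot>\<^bsub>N\<^esub> n) \<in> tensor_relators K M N"
  unfolding tensor_relators_def
  by (rule UnI2, intro CollectI exI conjI) (rule refl assms)+

private lemma relator_cases:
  assumes "x \<in> tensor_relators K M N"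
  obtains (left) m m' n where "m \<in> carrier M" "m' \<in> carrier M" "n \<in> carrier N"
      "x = frag_of (m \<oplus>\<^bsub>M\<^esub> m', n) - frag_of (m, n) - frag_of (m', n)"
    | (right) m n n' where "m \<in> carrier M" "n \<in> carrier N" "n' \<in> carrier N"
      "x = frag_of (m, n \<oplus>\<^bsub>N\<^esub> n') - frag_of (m, n) - frag_of (m, n')"
    | (balance) r m n where "r \<in> carrier K" "m \<in> carrier M" "n \<in> carrier N"
      "x = frag_of (r \<odot>\<^bsub>M\<^esub> m, n) - frag_of (m, r \<odot>\<^bsub>N\<^esub> n)"
  using assms unfolding tensor_relators_def by (elim UnE CollectE exE conjE) metis+

private lemma relators_closed: "tensor_relators K M N \<subseteq> carrier G"
  by (rule subsetI, erule relator_cases) (simp_all add: frag_diff_closed)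

private lemma null_subgroup: "subgroup Z G"
  unfolding tensor_null_def by (rule G.generate_is_subgroup[OF relators_closed])

interpretation Z: subgroup Z "pair_group M N" by (rule null_subgroup)

private lemma null_normal: "Z \<lhd> G"
  by (simp add: G.normal_iff_subgroup null_subgroup)

private lemma null_keys: "x \<in> Z \<Longrightarrow> Poly_Mapping.keys x \<subseteq> carrier M \<times> carrier N"
  using Z.mem_carrier[of x] by simp

private lemma null_diff: "\<lbrakk>x \<in> Z; y \<in> Z\<rbrakk> \<Longrightarrow> x - y \<in> Z"
  using Z.m_closed[OF _ Z.m_inv_closed, of x y] by (simp add: null_keys)

private lemma relators_null: "x \<in> tensor_relators K M N \<Longrightarrow> x \<in> Z"
  unfolding tensor_null_def by (rule generate.incl)

private lemma cls_eqI:
  assumes "x \<in> carrier G" "y \<in> carrier G" "x - y \<in> Z"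
  shows "cls x = cls y"
proof -
  have "x = (x - y) \<otimes>\<^bsub>G\<^esub> y" by simp
  then have "x \<in> cls y" using assms(3) unfolding r_coset_def by blast
  then show ?thesis using assms G.repr_independence null_subgroup by metis
qed

private lemma mem_cls:
  assumes "x \<in> carrier G" "y \<in> cls x"
  shows "y \<in> carrier G" "y - x \<in> Z"
proof -
  from assms obtain z where z: "z \<in> Z" "y = z + x" by (auto simp: r_coset_def)
  then show "y \<in> carrier G" using assms(1) G.m_closed[OF Z.mem_carrier, of z x] by simp
  from z show "y - x \<in> Z" by simp
qed

private lemma cls_self: "x \<in> carrier G \<Longrightarrow> x \<in> cls x"
  by (rule G.rcos_self[OF _ null_subgroup])

private lemma tensor_ops:
  "carrier MN = carrier (G Mod Z)" "\<zero>\<^bsub>MN\<^esub> = \<one>\<^bsub>G Mod Z\<^esub>"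
  "x \<oplus>\<^bsub>MN\<^esub> y = x \<otimes>\<^bsub>G Mod Z\<^esub> y"
  by (simp_all add: tensor_def)

private lemma tensor_carrier: "carrier MN = (\<lambda>x. cls x) ` carrier G"
  by (simp add: tensor_def carrier_FactGroup)

private lemma tensor_add: "\<lbrakk>x \<in> carrier G; y \<in> carrier G\<rbrakk> \<Longrightarrow> cls x \<oplus>\<^bsub>MN\<^esub> cls y = cls (x + y)"
  using normal.rcos_sum[OF null_normal, of x y] by (simp add: tensor_def)

private lemma tensor_zero: "\<zero>\<^bsub>MN\<^esub> = Z"
  by (simp add: tensor_def)

private lemma scale_closed:
  assumes "r \<in> carrier K" "x \<in> carrier G"
  shows "scale r x \<in> carrier G"
  using assms keys_frag_extend[of "\<lambda>(m, n). frag_of (r \<odot>\<^bsub>M\<^esub> m, n)" x] by fastforce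

text \<open>This makes the scalar action on the quotient well defined. The map
  \<open>scale r\<close> is additive and sends each relator to a relator of the same kind, hence it
  preserves the subgroup that the relators generate.\<close>

private lemma scale_null:
  assumes r: "r \<in> carrier K" and "x \<in> Z"
  shows "scale r x \<in> Z"
proof -
  have rel: "scale r h \<in> Z" if "h \<in> tensor_relators K M N" for h
  proof -
    from that have "scale r h \<in> tensor_relators K M N"
    proof (cases rule: relator_cases)
      case (left m m' n)
      then show ?thesis
        using relator_left[of "r \<odot>\<^bsub>M\<^esub> m" "r \<odot>\<^bsub>M\<^esub> m'" n] r
        by (simp add: frag_extend_diff M.smult_r_distr)
    next
      case (right m n n')
      then show ?thesis
        using relator_right[of "r \<odot>\<^bsub>M\<^esub> m" n n'] r by (simp add: frag_extend_diff)
    next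
      case (balance s m n)
      \<comment> \<open>Commutativity of \<open>K\<close> turns the image of the balancing relator
        of \<open>s\<close> at \<open>m\<close> into the balancing relator of \<open>s\<close> at
        the vector \<open>r\<close> times \<open>m\<close>.\<close>
      have "r \<odot>\<^bsub>M\<^esub> (s \<odot>\<^bsub>M\<^esub> m) = s \<odot>\<^bsub>M\<^esub> (r \<odot>\<^bsub>M\<^esub> m)"
        using r balance by (simp add: M.smult_assoc1[symmetric] M.R.m_comm)
      then show ?thesis
        using relator_balance[of s "r \<odot>\<^bsub>M\<^esub> m" n] balance r by (simp add: frag_extend_diff)
    qed
    then show ?thesis by (rule relators_null)
  qed
  from \<open>x \<in> Z\<close> have "x \<in> generate G (tensor_relators K M N)" by (simp add: tensor_null_def)
  then show ?thesis
  proof (induction rule: generate.induct)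
    case one
    then show ?case using Z.one_closed by simp
  next
    case (incl h)
    then show ?case by (rule rel)
  next
    case (inv h)
    then have "h \<in> carrier G" using relators_closed by blast
    then have "scale r (inv\<^bsub>G\<^esub> h) = 0 - scale r h" by (simp add: frag_extend_minus)
    also have "\<dots> \<in> Z" using null_diff[OF Z.one_closed rel[OF inv]] by simp
    finally show ?case .
  next
    case (eng h1 h2)
    then show ?case using Z.m_closed[of "scale r h1" "scale r h2"] by (simp add: frag_extend_add)
  qed
qed

text \<open>The union in the definition of the action has equal members: two representatives of a
  class differ by an element of \<open>Z\<close>, and \<open>scale r\<close> keeps that difference
  in \<open>Z\<close>.\<close>

private lemma tensor_smult:
  assumes "r \<in> carrier K" "x \<in> carrier G"
  shows "r \<odot>\<^bsub>MN\<^esub> cls x = cls (scale r x)"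
proof -
  have "cls (scale r y) = cls (scale r x)" if "y \<in> cls x" for y
  proof (rule cls_eqI)
    note y = mem_cls[OF assms(2) that]
    show "scale r y \<in> carrier G" "scale r x \<in> carrier G"
      by (rule scale_closed[OF assms(1)], rule y assms(2))+
    show "scale r y - scale r x \<in> Z"
      using scale_null[OF assms(1) y(2)] by (simp add: frag_extend_diff)
  qed
  then have "(\<Union>y\<in>cls x. cls (scale r y)) = cls (scale r x)"
    using cls_self[OF assms(2)] by blast
  then show ?thesis by (simp add: tensor_def)
qed

text \<open>The additive group is the factor group. Of the scalar laws, distributivity over a sum of
  scalars is the one that holds only modulo the relators, by left additivity on generators; the
  others hold already for representatives in the free group.\<close>

lemma module_tensor: "module K (tensor K M N)"
proof -
  interpret Q: comm_group "G Mod Z" by (rule G.abelian_FactGroup[OF null_subgroup])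
  have ab: "abelian_group MN"
    by (rule abelian_groupI; unfold tensor_ops)
      (rule Q.m_closed Q.one_closed Q.m_assoc Q.m_comm Q.l_one Q.l_inv_ex; assumption)+
  show ?thesis
  proof (rule moduleI)
    show "abelian_group MN" by (rule ab)
    show "cring K" by (rule M.R.is_cring)
    fix a x assume a: "a \<in> carrier K" and "x \<in> carrier MN"
    then show "a \<odot>\<^bsub>MN\<^esub> x \<in> carrier MN"
      by (auto simp: tensor_carrier tensor_smult simp del: carrier_free_Abelian_group_iff
          intro: scale_closed)
  next
    fix a b x assume ab: "a \<in> carrier K" "b \<in> carrier K" and "x \<in> carrier MN"
    then obtain c where c: "c \<in> carrier G" "x = cls c" by (auto simp: tensor_carrier)
    have "scale (a \<oplus>\<^bsub>K\<^esub> b) c - (scale a c + scale b c) \<in> Z"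
      using c(1)[unfolded carrier_free_Abelian_group_iff]
    proof (induction c rule: frag_induction)
      case zero show ?case using Z.one_closed by simp
    next
      case (one p)
      then obtain m n where p: "p = (m, n)" "m \<in> carrier M" "n \<in> carrier N" by auto
      have "frag_of (a \<odot>\<^bsub>M\<^esub> m \<oplus>\<^bsub>M\<^esub> b \<odot>\<^bsub>M\<^esub> m, n) - frag_of (a \<odot>\<^bsub>M\<^esub> m, n) - frag_of (b \<odot>\<^bsub>M\<^esub> m, n) \<in> Z"
        using p ab by (intro relators_null relator_left) simp_all
      then show ?case using p ab by (simp add: M.smult_l_distr diff_diff_eq)
    next
      case (diff x y)
      then show ?case using null_diff[OF diff] by (simp add: frag_extend_diff algebra_simps)
    qed
    then have "cls (scale (a \<oplus>\<^bsub>K\<^esub> b) c) = cls (scale a c + scale b c)"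
      using c(1) ab scale_closed G.m_closed[of "scale a c" "scale b c"] by (intro cls_eqI) simp_all
    then show "(a \<oplus>\<^bsub>K\<^esub> b) \<odot>\<^bsub>MN\<^esub> x = (a \<odot>\<^bsub>MN\<^esub> x) \<oplus>\<^bsub>MN\<^esub> (b \<odot>\<^bsub>MN\<^esub> x)"
      using c ab by (simp add: tensor_smult tensor_add scale_closed del: carrier_free_Abelian_group_iff)
  next
    fix a x y assume a: "a \<in> carrier K" and "x \<in> carrier MN" "y \<in> carrier MN"
    then obtain c d where "c \<in> carrier G" "x = cls c" "d \<in> carrier G" "y = cls d"
      by (auto simp: tensor_carrier)
    with a G.m_closed[of c d] show "a \<odot>\<^bsub>MN\<^esub> (x \<oplus>\<^bsub>MN\<^esub> y) = (a \<odot>\<^bsub>MN\<^esub> x) \<oplus>\<^bsub>MN\<^esub> (a \<odot>\<^bsub>MN\<^esub> y)"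
      by (simp add: tensor_smult tensor_add scale_closed frag_extend_add del: carrier_free_Abelian_group_iff)
  next
    fix a b x assume ab: "a \<in> carrier K" "b \<in> carrier K" and "x \<in> carrier MN"
    then obtain c where c: "c \<in> carrier G" "x = cls c" by (auto simp: tensor_carrier)
    have "scale (a \<otimes>\<^bsub>K\<^esub> b) c = scale a (scale b c)"
      using c(1)[unfolded carrier_free_Abelian_group_iff]
      by (induction c rule: frag_induction) (use ab in \<open>auto simp: frag_extend_diff M.smult_assoc1\<close>)
    then show "(a \<otimes>\<^bsub>K\<^esub> b) \<odot>\<^bsub>MN\<^esub> x = a \<odot>\<^bsub>MN\<^esub> (b \<odot>\<^bsub>MN\<^esub> x)"
      using c ab by (simp add: tensor_smult scale_closed del: carrier_free_Abelian_group_iff)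
  next
    fix x assume "x \<in> carrier MN"
    then obtain c where c: "c \<in> carrier G" "x = cls c" by (auto simp: tensor_carrier)
    have "scale \<one>\<^bsub>K\<^esub> c = c"
      using c(1)[unfolded carrier_free_Abelian_group_iff]
      by (induction c rule: frag_induction) (auto simp: frag_extend_diff)
    then show "\<one>\<^bsub>K\<^esub> \<odot>\<^bsub>MN\<^esub> x = x"
      using c by (simp add: tensor_smult del: carrier_free_Abelian_group_iff)
  qed
qed

interpretation MN: module K "tensor K M N" by (rule module_tensor)

section \<open>Pure tensors and the universal property\<close>

lemma pure_tensor_closed:
  "\<lbrakk>m \<in> carrier M; n \<in> carrier N\<rbrakk> \<Longrightarrow> pure_tensor K M N m n \<in> carrier (tensor K M N)"
  by (auto simp: pure_tensor_def tensor_carrier)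

text \<open>Additivity in each argument is a relator. Homogeneity in the first argument is the
  definition of the scalar action, and the balancing relators move it to the second.\<close>

lemma bilinear_pure_tensor: "bilinear_map K M N (tensor K M N) (pure_tensor K M N)"
proof (intro bilinear_mapI linear_mapI)
  fix m m' n assume c: "m \<in> carrier M" "m' \<in> carrier M" "n \<in> carrier N"
  have "frag_of (m \<oplus>\<^bsub>M\<^esub> m', n) - frag_of (m, n) - frag_of (m', n) \<in> Z"
    by (rule relators_null[OF relator_left[OF c]])
  then have "cls (frag_of (m \<oplus>\<^bsub>M\<^esub> m', n)) = cls (frag_of (m, n) + frag_of (m', n))"
    using c G.m_closed[of "frag_of (m, n)" "frag_of (m', n)"]
    by (intro cls_eqI) (simp_all add: diff_diff_eq)
  then show "pure_tensor K M N (m \<oplus>\<^bsub>M\<^esub> m') n = pure_tensor K M N m n \<oplus>\<^bsub>MN\<^esub> pure_tensor K M N m' n"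
    using c by (simp add: pure_tensor_def tensor_add)
next
  fix m n n' assume c: "m \<in> carrier M" "n \<in> carrier N" "n' \<in> carrier N"
  have "frag_of (m, n \<oplus>\<^bsub>N\<^esub> n') - frag_of (m, n) - frag_of (m, n') \<in> Z"
    by (rule relators_null[OF relator_right[OF c]])
  then have "cls (frag_of (m, n \<oplus>\<^bsub>N\<^esub> n')) = cls (frag_of (m, n) + frag_of (m, n'))"
    using c G.m_closed[of "frag_of (m, n)" "frag_of (m, n')"]
    by (intro cls_eqI) (simp_all add: diff_diff_eq)
  then show "pure_tensor K M N m (n \<oplus>\<^bsub>N\<^esub> n') = pure_tensor K M N m n \<oplus>\<^bsub>MN\<^esub> pure_tensor K M N m n'"
    using c by (simp add: pure_tensor_def tensor_add)
next
  fix r m n assume "r \<in> carrier K" "m \<in> carrier M" "n \<in> carrier N"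
  then show "pure_tensor K M N (r \<odot>\<^bsub>M\<^esub> m) n = r \<odot>\<^bsub>MN\<^esub> pure_tensor K M N m n"
    by (simp add: pure_tensor_def tensor_smult)
next
  fix r m n assume c: "r \<in> carrier K" "m \<in> carrier M" "n \<in> carrier N"
  have "frag_of (r \<odot>\<^bsub>M\<^esub> m, n) - frag_of (m, r \<odot>\<^bsub>N\<^esub> n) \<in> Z"
    by (rule relators_null[OF relator_balance[OF c]])
  then have "cls (frag_of (r \<odot>\<^bsub>M\<^esub> m, n)) = cls (frag_of (m, r \<odot>\<^bsub>N\<^esub> n))"
    using c by (intro cls_eqI) simp_all
  then show "pure_tensor K M N m (r \<odot>\<^bsub>N\<^esub> n) = r \<odot>\<^bsub>MN\<^esub> pure_tensor K M N m n"
    using c by (simp add: pure_tensor_def tensor_smult)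
qed (simp_all add: pure_tensor_closed)

text \<open>Sums suffice, without differences, because the negative of a pure tensor is again pure:
  the sign is absorbed by the first factor.\<close>

lemma tensor_induct [consumes 1, case_names pure add]:
  assumes "t \<in> carrier (tensor K M N)"
    and pure: "\<And>m n. \<lbrakk>m \<in> carrier M; n \<in> carrier N\<rbrakk> \<Longrightarrow> P (pure_tensor K M N m n)"
    and add: "\<And>s t. \<lbrakk>s \<in> carrier (tensor K M N); t \<in> carrier (tensor K M N); P s; P t\<rbrakk> \<Longrightarrow>
      P (s \<oplus>\<^bsub>tensor K M N\<^esub> t)"
  shows "P t"
proof -
  note lin = bilinear_map_left[OF bilinear_pure_tensor]
  have neg: "\<ominus>\<^bsub>MN\<^esub> pure_tensor K M N m n = pure_tensor K M N (\<ominus>\<^bsub>M\<^esub> m) n"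
    if "m \<in> carrier M" "n \<in> carrier N" for m n
  proof -
    have "pure_tensor K M N ((\<ominus>\<^bsub>K\<^esub> \<one>\<^bsub>K\<^esub>) \<odot>\<^bsub>M\<^esub> m) n = (\<ominus>\<^bsub>K\<^esub> \<one>\<^bsub>K\<^esub>) \<odot>\<^bsub>MN\<^esub> pure_tensor K M N m n"
      using that linear_map_smult[OF lin] by simp
    then show ?thesis using that by (simp add: M.smult_l_minus MN.smult_l_minus pure_tensor_closed)
  qed
  have "pure_tensor K M N \<zero>\<^bsub>M\<^esub> \<zero>\<^bsub>N\<^esub> = \<zero>\<^bsub>MN\<^esub>"
    using linear_map_zero[OF M module_tensor lin] by simp
  then have P0: "P \<zero>\<^bsub>MN\<^esub>" using pure[of "\<zero>\<^bsub>M\<^esub>" "\<zero>\<^bsub>N\<^esub>"] by simp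
  from assms(1) obtain c where c: "c \<in> carrier G" "t = cls c" by (auto simp: tensor_carrier)
  \<comment> \<open>Induction in the free abelian group proceeds by differences, while
    \<open>P\<close> is preserved only by sums; so \<open>P\<close> is carried along for the
    negative of the class as well.\<close>
  have "c \<in> carrier G \<and> P (cls c) \<and> P (\<ominus>\<^bsub>MN\<^esub> cls c)"
    using c(1)[unfolded carrier_free_Abelian_group_iff]
  proof (induction c rule: frag_induction)
    case zero
    have "\<ominus>\<^bsub>MN\<^esub> \<zero>\<^bsub>MN\<^esub> = \<zero>\<^bsub>MN\<^esub>" using MN.M.l_neg[OF MN.M.zero_closed] by simp
    then show ?case using P0 G.coset_mult_one[OF Z.subset] by (simp add: tensor_zero)
  next
    case (one p)
    then show ?case using pure neg by (auto simp: pure_tensor_def)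
  next
    case (diff a b)
    then have ab: "cls a \<in> carrier MN" "cls b \<in> carrier MN" "a - b \<in> carrier G"
      by (simp_all add: tensor_carrier frag_diff_closed)
    have c: "cls (a - b) \<in> carrier MN" using ab by (auto simp: tensor_carrier)
    have "cls (a - b) \<oplus>\<^bsub>MN\<^esub> cls b = cls a"
      using diff ab(3) by (subst tensor_add) simp_all
    then have "cls a \<oplus>\<^bsub>MN\<^esub> \<ominus>\<^bsub>MN\<^esub> cls b = cls (a - b) \<oplus>\<^bsub>MN\<^esub> (cls b \<oplus>\<^bsub>MN\<^esub> \<ominus>\<^bsub>MN\<^esub> cls b)"
      using ab c MN.M.a_assoc by (metis MN.M.a_inv_closed)
    then have "cls (a - b) = cls a \<oplus>\<^bsub>MN\<^esub> \<ominus>\<^bsub>MN\<^esub> cls b"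
      using ab c by (simp add: MN.M.r_neg)
    then show ?case using diff ab by (simp add: MN.M.minus_add add)
  qed
  then show ?thesis using c by simp
qed

text \<open>Freeness extends \<beta> to a group homomorphism, and bilinearity is exactly what kills
  the relators, balancing included, since both of its terms go to the same multiple of a value of
  \<beta>. The factor group yields only an additive map; its homogeneity is checked afterwards on
  pure tensors.\<close>

lemma tensor_universal:
  assumes P: "module K P" and \<beta>: "bilinear_map K M N P \<beta>"
  shows "\<exists>u. linear_map K (tensor K M N) P u \<and>
    (\<forall>m\<in>carrier M. \<forall>n\<in>carrier N. u (pure_tensor K M N m n) = \<beta> m n)"
proof -
  interpret P: module K P by fact
  have "case_prod \<beta> ` (carrier M \<times> carrier N) \<subseteq> carrier (add_monoid P)"
    by (auto simp: bilinear_map_closed[OF \<beta>])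
  from comm_group.free_Abelian_group_universal[OF P.M.a_comm_group this]
  obtain h where h: "h \<in> hom G (add_monoid P)"
    and h_of: "\<And>p. p \<in> carrier M \<times> carrier N \<Longrightarrow> h (frag_of p) = case_prod \<beta> p" by blast
  interpret h: group_hom G "add_monoid P" h
    by unfold_locales (rule h)
  have h_diff: "h (a - b) = h a \<ominus>\<^bsub>P\<^esub> h b" if "a \<in> carrier G" "b \<in> carrier G" for a b
    using h.hom_mult[of a "inv\<^bsub>G\<^esub> b"] h.hom_inv[of b] that
    by (simp add: a_minus_def a_inv_def)
  have h_pure: "h (frag_of (m, n)) = \<beta> m n" if "m \<in> carrier M" "n \<in> carrier N" for m n
    using that h_of by simp
  have "tensor_relators K M N \<subseteq> kernel G (add_monoid P) h"
  proof -
    have cancel: "x \<oplus>\<^bsub>P\<^esub> y \<ominus>\<^bsub>P\<^esub> x \<ominus>\<^bsub>P\<^esub> y = \<zero>\<^bsub>P\<^esub>"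
      if "x \<in> carrier P" "y \<in> carrier P" for x y
    proof -
      have "x \<oplus>\<^bsub>P\<^esub> y \<ominus>\<^bsub>P\<^esub> x \<ominus>\<^bsub>P\<^esub> y = (x \<oplus>\<^bsub>P\<^esub> y) \<oplus>\<^bsub>P\<^esub> \<ominus>\<^bsub>P\<^esub> (x \<oplus>\<^bsub>P\<^esub> y)"
        using that by (simp add: a_minus_def P.M.minus_add P.M.a_assoc)
      then show ?thesis using that by (simp add: P.M.r_neg)
    qed
    have diff3: "h (frag_of p - frag_of q - frag_of s) = h (frag_of p) \<ominus>\<^bsub>P\<^esub> h (frag_of q) \<ominus>\<^bsub>P\<^esub> h (frag_of s)"
      if "p \<in> carrier M \<times> carrier N" "q \<in> carrier M \<times> carrier N" "s \<in> carrier M \<times> carrier N" for p q s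
      using that by (subst h_diff; simp add: h_diff frag_diff_closed)
    have diff2: "h (frag_of p - frag_of q) = h (frag_of p) \<ominus>\<^bsub>P\<^esub> h (frag_of q)"
      if "p \<in> carrier M \<times> carrier N" "q \<in> carrier M \<times> carrier N" for p q
      using that by (subst h_diff; simp)
    note closed = bilinear_map_closed[OF \<beta>]
    have "h x = \<zero>\<^bsub>P\<^esub>" if "x \<in> tensor_relators K M N" for x
      using that
    proof (cases rule: relator_cases)
      case left
      then show ?thesis
        by (simp add: diff3 h_pure linear_map_add[OF bilinear_map_left[OF \<beta>]] cancel closed)
    next
      case right
      then show ?thesis
        by (simp add: diff3 h_pure linear_map_add[OF bilinear_map_right[OF \<beta>]] cancel closed)
    next
      case balance
      then show ?thesis
        by (simp add: diff2 h_pure linear_map_smult[OF bilinear_map_left[OF \<beta>]]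
            linear_map_smult[OF bilinear_map_right[OF \<beta>]] closed a_minus_def P.M.r_neg)
    qed
    then have "h x = \<one>\<^bsub>add_monoid P\<^esub>" if "x \<in> tensor_relators K M N" for x
      using that by simp
    then show ?thesis
      using relators_closed unfolding kernel_def by blast
  qed
  then have "Z \<subseteq> kernel G (add_monoid P) h"
    unfolding tensor_null_def by (rule G.generate_subgroup_incl[OF _ h.subgroup_kernel])
  from h.FactGroup_universal_kernel[OF null_normal this]
  obtain u where u: "u \<in> hom (G Mod Z) (add_monoid P)" "\<And>x. x \<in> carrier G \<Longrightarrow> u (cls x) = h x"
    by blast
  have u_pure: "u (pure_tensor K M N m n) = \<beta> m n" if "m \<in> carrier M" "n \<in> carrier N" for m n
    using that u(2) h_pure by (simp add: pure_tensor_def)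
  have u_closed: "u t \<in> carrier P" if "t \<in> carrier MN" for t
    using hom_in_carrier[OF u(1), of t] that by (simp add: tensor_ops)
  have u_add: "u (s \<oplus>\<^bsub>MN\<^esub> t) = u s \<oplus>\<^bsub>P\<^esub> u t" if "s \<in> carrier MN" "t \<in> carrier MN" for s t
    using hom_mult[OF u(1), of s t] that by (simp add: tensor_ops del: mult_FactGroup)
  have "linear_map K MN P u"
  proof (rule linear_mapI)
    fix r t assume r: "r \<in> carrier K" and "t \<in> carrier MN"
    from this(2) show "u (r \<odot>\<^bsub>MN\<^esub> t) = r \<odot>\<^bsub>P\<^esub> u t"
    proof (induction t rule: tensor_induct)
      case (pure m n)
      have "r \<odot>\<^bsub>MN\<^esub> pure_tensor K M N m n = pure_tensor K M N (r \<odot>\<^bsub>M\<^esub> m) n"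
        using linear_map_smult[OF bilinear_map_left[OF bilinear_pure_tensor]] pure r by simp
      then show ?case
        using pure r by (simp add: u_pure linear_map_smult[OF bilinear_map_left[OF \<beta>]])
    next
      case (add s t)
      then show ?case using r by (simp add: MN.smult_r_distr P.smult_r_distr u_add u_closed)
    qed
  qed (simp_all add: u_closed u_add)
  with u_pure show ?thesis by blast
qed

lemma linear_map_tensor_eqI:
  assumes "linear_map K (tensor K M N) P u" "linear_map K (tensor K M N) P v"
    and "\<And>m n. \<lbrakk>m \<in> carrier M; n \<in> carrier N\<rbrakk> \<Longrightarrow>
      u (pure_tensor K M N m n) = v (pure_tensor K M N m n)"
    and "t \<in> carrier (tensor K M N)"
  shows "u t = v t"
  using assms(4)
  by (induction t rule: tensor_induct)
    (simp_all add: assms(3) linear_map_add[OF assms(1)] linear_map_add[OF assms(2)])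

text \<open>The definite description in \<open>tensor_lift\<close> becomes usable here: existence is
  the universal property after restriction to the carrier, and uniqueness follows from agreement on
  pure tensors together with extensionality outside the carrier.\<close>

lemma
  assumes "module K P" "bilinear_map K M N P \<beta>"
  shows tensor_lift_in_linear_maps: "tensor_lift K M N P \<beta> \<in> linear_maps K (tensor K M N) P"
    and tensor_lift_pure: "\<And>m n. \<lbrakk>m \<in> carrier M; n \<in> carrier N\<rbrakk> \<Longrightarrow>
      tensor_lift K M N P \<beta> (pure_tensor K M N m n) = \<beta> m n"
proof -
  from tensor_universal[OF assms] obtain u where u: "linear_map K MN P u"
    and u_pure: "\<And>m n. \<lbrakk>m \<in> carrier M; n \<in> carrier N\<rbrakk> \<Longrightarrow> u (pure_tensor K M N m n) = \<beta> m n"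
    by blast
  let ?P = "\<lambda>u. u \<in> linear_maps K MN P \<and>
    (\<forall>m\<in>carrier M. \<forall>n\<in>carrier N. u (pure_tensor K M N m n) = \<beta> m n)"
  have "\<exists>!u. ?P u"
  proof (rule ex1I)
    show "?P (restrict u (carrier MN))"
      using restrict_linear_maps[OF module_tensor u] u_pure by (simp add: pure_tensor_closed)
    fix v assume v: "?P v"
    show "v = restrict u (carrier MN)"
    proof (rule linear_maps_eqI)
      show "v \<in> linear_maps K MN P" using v by blast
      show "restrict u (carrier MN) \<in> linear_maps K MN P"
        by (rule restrict_linear_maps[OF module_tensor u])
      have "linear_map K MN P v" using v by (simp add: linear_maps_iff)
      then show "v t = restrict u (carrier MN) t" if "t \<in> carrier MN" for t
        using linear_map_tensor_eqI[OF _ u _ that] v u_pure that by auto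
    qed
  qed
  from theI'[OF this] have "?P (tensor_lift K M N P \<beta>)" unfolding tensor_lift_def .
  then show "tensor_lift K M N P \<beta> \<in> linear_maps K (tensor K M N) P"
    and "\<And>m n. \<lbrakk>m \<in> carrier M; n \<in> carrier N\<rbrakk> \<Longrightarrow>
      tensor_lift K M N P \<beta> (pure_tensor K M N m n) = \<beta> m n"
    by blast+
qed

lemma tensor_lift_linear:
  assumes "module K P" "bilinear_map K M N P \<beta>"
  shows "linear_map K (tensor K M N) P (tensor_lift K M N P \<beta>)"
  using tensor_lift_in_linear_maps[OF assms] by (simp add: linear_maps_iff)

lemma tensor_lift_eqI:
  assumes "module K P" "bilinear_map K M N P \<beta>" "linear_map K (tensor K M N) P u"
    and "\<And>m n. \<lbrakk>m \<in> carrier M; n \<in> carrier N\<rbrakk> \<Longrightarrow> \<beta> m n = u (pure_tensor K M N m n)"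
    and "t \<in> carrier (tensor K M N)"
  shows "tensor_lift K M N P \<beta> t = u t"
  using tensor_lift_linear[OF assms(1,2)] assms(3)
  by (rule linear_map_tensor_eqI[where P = P])
    (use assms in \<open>simp_all add: tensor_lift_pure[OF assms(1,2)]\<close>)

text \<open>A linear map may be moved under a Sweedler sum: both sides are linear in the tensor and
  agree on pure tensors. Nearly every computation with Sweedler sums below rests on this
  exchange.\<close>

lemma linear_map_tensor_lift:
  assumes "module K P" "module K P'" "bilinear_map K M N P \<beta>" "linear_map K P P' f"
    and "t \<in> carrier (tensor K M N)"
  shows "f (tensor_lift K M N P \<beta> t) = tensor_lift K M N P' (\<lambda>m n. f (\<beta> m n)) t"
proof -
  have "bilinear_map K M N P' (\<lambda>m n. f (\<beta> m n))"
    using assms(3,4) by (auto simp: bilinear_map_def intro!: linear_map_compose[OF _ assms(4)])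
  then show ?thesis
    using assms by (intro tensor_lift_eqI[symmetric] linear_map_compose[OF tensor_lift_linear])
      (simp_all add: tensor_lift_pure)
qed

section \<open>Sweedler sums as functions of the summand\<close>

lemma tensor_lift_add:
  assumes "module K P" "bilinear_map K M N P \<beta>" "bilinear_map K M N P \<gamma>"
    and "t \<in> carrier (tensor K M N)"
  shows "tensor_lift K M N P (\<lambda>m n. \<beta> m n \<oplus>\<^bsub>P\<^esub> \<gamma> m n) t =
    tensor_lift K M N P \<beta> t \<oplus>\<^bsub>P\<^esub> tensor_lift K M N P \<gamma> t"
proof -
  have "bilinear_map K M N P (\<lambda>m n. \<beta> m n \<oplus>\<^bsub>P\<^esub> \<gamma> m n)"
    using assms(1-3) by (auto simp: bilinear_map_def intro!: linear_map_plus)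
  then show ?thesis
    using assms by (intro tensor_lift_eqI linear_map_plus tensor_lift_linear)
      (simp_all add: tensor_lift_pure)
qed

lemma tensor_lift_smult:
  assumes "module K P" "bilinear_map K M N P \<beta>" "r \<in> carrier K"
    and "t \<in> carrier (tensor K M N)"
  shows "tensor_lift K M N P (\<lambda>m n. r \<odot>\<^bsub>P\<^esub> \<beta> m n) t = r \<odot>\<^bsub>P\<^esub> tensor_lift K M N P \<beta> t"
  using linear_map_tensor_lift[OF assms(1,1,2) linear_map_scale[OF assms(1) linear_map_id assms(3)] assms(4)]
  by simp

text \<open>The description behind \<open>tensor_lift\<close> consults its bilinear map only at
  carrier elements, so the two descriptions are literally the same and the lifts are equal as
  functions.\<close>

lemma tensor_lift_cong:
  assumes "\<And>m n. \<lbrakk>m \<in> carrier M; n \<in> carrier N\<rbrakk> \<Longrightarrow> \<beta> m n = \<gamma> m n"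
  shows "tensor_lift K M N P \<beta> = tensor_lift K M N P \<gamma>"
  using assms unfolding tensor_lift_def by (intro arg_cong[of _ _ The] ext) auto

text \<open>Recognizes a linear map as a Sweedler sum from its values on pure tensors. Bilinearity
  of \<beta> is inherited, as \<beta> agrees with \<open>u\<close> after the bilinear map
  \<open>pure_tensor\<close>.\<close>

lemma linear_map_eq_tensor_lift:
  assumes "module K P" "linear_map K (tensor K M N) P u"
    and "\<And>m n. \<lbrakk>m \<in> carrier M; n \<in> carrier N\<rbrakk> \<Longrightarrow> u (pure_tensor K M N m n) = \<beta> m n"
    and "t \<in> carrier (tensor K M N)"
  shows "u t = tensor_lift K M N P \<beta> t"
proof -
  note pure = bilinear_pure_tensor
  have "bilinear_map K M N P \<beta>"
  proof (rule bilinear_mapI)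
    show "linear_map K M P (\<lambda>m. \<beta> m n)" if "n \<in> carrier N" for n
      using that assms(3)
      by (intro linear_map_cong[OF M linear_map_compose[OF bilinear_map_left[OF pure that] assms(2)]]) simp
    show "linear_map K N P (\<beta> m)" if "m \<in> carrier M" for m
      using that assms(3)
      by (intro linear_map_cong[OF N linear_map_compose[OF bilinear_map_right[OF pure that] assms(2)]]) simp
  qed
  then show ?thesis
    using assms by (intro tensor_lift_eqI[symmetric]) simp_all
qed

text \<open>This is what permits nesting: an inner lift whose bilinear map depends linearly on an
  outer variable is itself linear in that variable, so it can be the summand of an outer
  lift.\<close>

lemma tensor_lift_linear_in_parameter:
  assumes "module K P" "module K Q" "\<And>q. q \<in> carrier Q \<Longrightarrow> bilinear_map K M N P (\<gamma> q)"
    and "\<And>m n. \<lbrakk>m \<in> carrier M; n \<in> carrier N\<rbrakk> \<Longrightarrow> linear_map K Q P (\<lambda>q. \<gamma> q m n)"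
    and t: "t \<in> carrier (tensor K M N)"
  shows "linear_map K Q P (\<lambda>q. tensor_lift K M N P (\<gamma> q) t)"
proof (rule linear_mapI)
  interpret Q: module K Q by fact
  show "tensor_lift K M N P (\<gamma> q) t \<in> carrier P" if "q \<in> carrier Q" for q
    by (rule linear_map_closed[OF tensor_lift_linear[OF assms(1) assms(3)[OF that]] t])
  show "tensor_lift K M N P (\<gamma> (p \<oplus>\<^bsub>Q\<^esub> q)) t =
      tensor_lift K M N P (\<gamma> p) t \<oplus>\<^bsub>P\<^esub> tensor_lift K M N P (\<gamma> q) t"
    if "p \<in> carrier Q" "q \<in> carrier Q" for p q
  proof -
    have "tensor_lift K M N P (\<gamma> (p \<oplus>\<^bsub>Q\<^esub> q)) = tensor_lift K M N P (\<lambda>m n. \<gamma> p m n \<oplus>\<^bsub>P\<^esub> \<gamma> q m n)"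
      by (rule tensor_lift_cong) (rule linear_map_add[OF assms(4) that])
    then show ?thesis
      by (simp only: tensor_lift_add[OF assms(1) assms(3)[OF that(1)] assms(3)[OF that(2)] t])
  qed
  show "tensor_lift K M N P (\<gamma> (r \<odot>\<^bsub>Q\<^esub> q)) t = r \<odot>\<^bsub>P\<^esub> tensor_lift K M N P (\<gamma> q) t"
    if "r \<in> carrier K" "q \<in> carrier Q" for r q
  proof -
    have "tensor_lift K M N P (\<gamma> (r \<odot>\<^bsub>Q\<^esub> q)) = tensor_lift K M N P (\<lambda>m n. r \<odot>\<^bsub>P\<^esub> \<gamma> q m n)"
      by (rule tensor_lift_cong) (rule linear_map_smult[OF assms(4) that])
    then show ?thesis
      by (simp only: tensor_lift_smult[OF assms(1) assms(3)[OF that(2)] that(1) t])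
  qed
qed

end

section \<open>Bases and matrices\<close>

text \<open>Enlarging the support by indices with zero coefficient changes nothing. Linear
  combinations with different supports can so be written over a common finite index set.\<close>

lemma lincomb_eq:
  assumes "module K M" "b \<in> I \<rightarrow> carrier M" "c \<in> coeff_families K I"
    and "finite S" "S \<subseteq> I" "\<And>i. i \<in> I - S \<Longrightarrow> c i = \<zero>\<^bsub>K\<^esub>"
  shows "lincomb K M I b c = (\<Oplus>\<^bsub>M\<^esub>i\<in>S. c i \<odot>\<^bsub>M\<^esub> b i)"
proof -
  interpret M: module K M by fact
  show ?thesis unfolding lincomb_def
  proof (rule M.M.add.finprod_mono_neutral_cong_left)
    show "(\<lambda>i. c i \<odot>\<^bsub>M\<^esub> b i) \<in> S \<rightarrow> carrier M"
      using assms(2,3,5) by (auto simp: coeff_families_def Pi_iff)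
  qed (use assms in \<open>auto simp: Pi_iff\<close>)
qed

lemma coeff_families_closed: "c \<in> coeff_families K I \<Longrightarrow> c i \<in> carrier K"
  by (simp add: coeff_families_def)

lemma coeff_families_outside: "\<lbrakk>c \<in> coeff_families K I; i \<notin> I\<rbrakk> \<Longrightarrow> c i = \<zero>\<^bsub>K\<^esub>"
  by (simp add: coeff_families_def)

lemma coeff_families_finite: "c \<in> coeff_families K I \<Longrightarrow> finite {i. c i \<noteq> \<zero>\<^bsub>K\<^esub>}"
  by (simp add: coeff_families_def)

lemma coeff_families_add:
  assumes "cring K" "c \<in> coeff_families K I" "d \<in> coeff_families K I"
  shows "(\<lambda>i. c i \<oplus>\<^bsub>K\<^esub> d i) \<in> coeff_families K I"
proof -
  interpret K: cring K by fact
  have "finite ({i. c i \<noteq> \<zero>\<^bsub>K\<^esub>} \<union> {i. d i \<noteq> \<zero>\<^bsub>K\<^esub>})"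
    using assms by (simp add: coeff_families_def)
  then have "finite {i. c i \<oplus>\<^bsub>K\<^esub> d i \<noteq> \<zero>\<^bsub>K\<^esub>}"
    by (rule rev_finite_subset) auto
  then show ?thesis using assms by (simp add: coeff_families_def)
qed

lemma coeff_families_smult:
  assumes "cring K" "r \<in> carrier K" "c \<in> coeff_families K I"
  shows "(\<lambda>i. r \<otimes>\<^bsub>K\<^esub> c i) \<in> coeff_families K I"
proof -
  interpret K: cring K by fact
  have "finite {i. r \<otimes>\<^bsub>K\<^esub> c i \<noteq> \<zero>\<^bsub>K\<^esub>}"
    by (rule rev_finite_subset[OF coeff_families_finite[OF assms(3)]]) (use assms in auto)
  then show ?thesis using assms by (simp add: coeff_families_def)
qed

lemma coeff_families_delta:
  assumes "cring K" "r \<in> carrier K" "i \<in> I"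
  shows "(\<lambda>j. if j = i then r else \<zero>\<^bsub>K\<^esub>) \<in> coeff_families K I"
proof -
  interpret K: cring K by fact
  have "finite {j. (if j = i then r else \<zero>\<^bsub>K\<^esub>) \<noteq> \<zero>\<^bsub>K\<^esub>}"
    by (rule rev_finite_subset[of "{i}"]) auto
  then show ?thesis using assms by (auto simp: coeff_families_def)
qed

section \<open>Linear combinations of a family that need not be a basis\<close>

context
  fixes K :: "('k, 'e) ring_scheme" and M :: "('k, 'm) module" and I :: "'i set" and b :: "'i \<Rightarrow> 'm"
  assumes M: "module K M" and b: "b \<in> I \<rightarrow> carrier M"
begin

interpretation M: module K M by (rule M)

lemma lincomb_closed:
  assumes "c \<in> coeff_families K I"
  shows "lincomb K M I b c \<in> carrier M"
  using assms b unfolding lincomb_def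
  by (intro M.M.finsum_closed) (auto simp: coeff_families_closed Pi_iff)

lemma lincomb_add:
  assumes "c \<in> coeff_families K I" "d \<in> coeff_families K I"
  shows "lincomb K M I b (\<lambda>i. c i \<oplus>\<^bsub>K\<^esub> d i) = lincomb K M I b c \<oplus>\<^bsub>M\<^esub> lincomb K M I b d"
proof -
  \<comment> \<open>The union of the supports serves all three combinations; the support of the sum
    may be smaller because of cancellation.\<close>
  let ?S = "{i. c i \<noteq> \<zero>\<^bsub>K\<^esub>} \<union> {i. d i \<noteq> \<zero>\<^bsub>K\<^esub>}"
  note cd = coeff_families_closed[OF assms(1)] coeff_families_closed[OF assms(2)]
  have S: "finite ?S" "?S \<subseteq> I"
    using assms by (auto simp: coeff_families_finite dest: coeff_families_outside)
  have closed: "(\<lambda>i. e i \<odot>\<^bsub>M\<^esub> b i) \<in> ?S \<rightarrow> carrier M" if "\<And>i. e i \<in> carrier K" for e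
    using S(2) b that by (intro Pi_I M.smult_closed) auto
  have "lincomb K M I b (\<lambda>i. c i \<oplus>\<^bsub>K\<^esub> d i) = (\<Oplus>\<^bsub>M\<^esub>i\<in>?S. (c i \<oplus>\<^bsub>K\<^esub> d i) \<odot>\<^bsub>M\<^esub> b i)"
    using assms by (intro lincomb_eq[OF M b] coeff_families_add M.R.is_cring S) auto
  also have "\<dots> = (\<Oplus>\<^bsub>M\<^esub>i\<in>?S. c i \<odot>\<^bsub>M\<^esub> b i \<oplus>\<^bsub>M\<^esub> d i \<odot>\<^bsub>M\<^esub> b i)"
    using closed cd S(2) b by (intro M.M.finsum_cong') (auto simp: M.smult_l_distr Pi_iff subset_iff)
  also have "\<dots> = (\<Oplus>\<^bsub>M\<^esub>i\<in>?S. c i \<odot>\<^bsub>M\<^esub> b i) \<oplus>\<^bsub>M\<^esub> (\<Oplus>\<^bsub>M\<^esub>i\<in>?S. d i \<odot>\<^bsub>M\<^esub> b i)"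
    by (intro M.M.finsum_addf closed cd)
  also have "(\<Oplus>\<^bsub>M\<^esub>i\<in>?S. c i \<odot>\<^bsub>M\<^esub> b i) = lincomb K M I b c"
    using assms by (intro lincomb_eq[OF M b, symmetric] S) auto
  also have "(\<Oplus>\<^bsub>M\<^esub>i\<in>?S. d i \<odot>\<^bsub>M\<^esub> b i) = lincomb K M I b d"
    using assms by (intro lincomb_eq[OF M b, symmetric] S) auto
  finally show ?thesis .
qed

lemma lincomb_smult:
  assumes "r \<in> carrier K" "c \<in> coeff_families K I"
  shows "lincomb K M I b (\<lambda>i. r \<otimes>\<^bsub>K\<^esub> c i) = r \<odot>\<^bsub>M\<^esub> lincomb K M I b c"
proof -
  \<comment> \<open>The support of \<open>c\<close> is used on both sides, since multiplication by
    \<open>r\<close> may annihilate some coefficients.\<close>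
  let ?S = "{i. c i \<noteq> \<zero>\<^bsub>K\<^esub>}"
  note c = coeff_families_closed[OF assms(2)]
  have S: "finite ?S" "?S \<subseteq> I"
    using assms by (auto simp: coeff_families_finite dest: coeff_families_outside)
  have closed: "(\<lambda>i. c i \<odot>\<^bsub>M\<^esub> b i) \<in> ?S \<rightarrow> carrier M"
    using S(2) b c by (intro Pi_I M.smult_closed) auto
  have "lincomb K M I b (\<lambda>i. r \<otimes>\<^bsub>K\<^esub> c i) = (\<Oplus>\<^bsub>M\<^esub>i\<in>?S. (r \<otimes>\<^bsub>K\<^esub> c i) \<odot>\<^bsub>M\<^esub> b i)"
    using assms by (intro lincomb_eq[OF M b] coeff_families_smult M.R.is_cring S) auto
  also have "\<dots> = (\<Oplus>\<^bsub>M\<^esub>i\<in>?S. r \<odot>\<^bsub>M\<^esub> (c i \<odot>\<^bsub>M\<^esub> b i))"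
    using closed c S(2) b assms(1)
    by (intro M.M.finsum_cong') (auto simp: M.smult_assoc1 Pi_iff subset_iff)
  also have "\<dots> = r \<odot>\<^bsub>M\<^esub> (\<Oplus>\<^bsub>M\<^esub>i\<in>?S. c i \<odot>\<^bsub>M\<^esub> b i)"
    by (rule M.finsum_smult_ldistr[symmetric, OF S(1) assms(1) closed])
  also have "(\<Oplus>\<^bsub>M\<^esub>i\<in>?S. c i \<odot>\<^bsub>M\<^esub> b i) = lincomb K M I b c"
    using assms by (intro lincomb_eq[OF M b, symmetric] S) auto
  finally show ?thesis .
qed

lemma lincomb_delta:
  assumes "i \<in> I" "r \<in> carrier K"
  shows "lincomb K M I b (\<lambda>j. if j = i then r else \<zero>\<^bsub>K\<^esub>) = r \<odot>\<^bsub>M\<^esub> b i"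
proof -
  have "lincomb K M I b (\<lambda>j. if j = i then r else \<zero>\<^bsub>K\<^esub>) =
      (\<Oplus>\<^bsub>M\<^esub>j\<in>{i}. (if j = i then r else \<zero>\<^bsub>K\<^esub>) \<odot>\<^bsub>M\<^esub> b j)"
    using assms by (intro lincomb_eq[OF M b] coeff_families_delta M.R.is_cring) auto
  also have "\<dots> = r \<odot>\<^bsub>M\<^esub> b i"
  proof -
    have "r \<odot>\<^bsub>M\<^esub> b i \<in> carrier M" using assms b by auto
    then show ?thesis by simp
  qed
  finally show ?thesis .
qed

lemma linear_map_lincomb:
  assumes "module K N" "linear_map K M N f" "c \<in> coeff_families K I"
  shows "f (lincomb K M I b c) = lincomb K N I (\<lambda>i. f (b i)) c"
proof -
  interpret N: module K N by fact
  note c = coeff_families_closed[OF assms(3)]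
  have "f (lincomb K M I b c) = (\<Oplus>\<^bsub>N\<^esub>i\<in>{i \<in> I. c i \<noteq> \<zero>\<^bsub>K\<^esub>}. f (c i \<odot>\<^bsub>M\<^esub> b i))"
    unfolding lincomb_def using b c by (intro linear_map_finsum[OF M assms(1,2)]) auto
  also have "\<dots> = lincomb K N I (\<lambda>i. f (b i)) c"
    unfolding lincomb_def using b c assms(2)
    by (intro N.M.finsum_cong') (auto simp: linear_map_smult linear_map_closed Pi_iff)
  finally show ?thesis .
qed

end

section \<open>Coordinates with respect to a basis\<close>

context
  fixes K :: "('k, 'e) ring_scheme" and M :: "('k, 'm) module" and I :: "'i set" and b :: "'i \<Rightarrow> 'm"
  assumes basis: "module_basis K M I b"
begin

private lemma basis_module: "module K M" and basis_in_carrier: "b \<in> I \<rightarrow> carrier M"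
  and independent: "\<lbrakk>c \<in> coeff_families K I; lincomb K M I b c = \<zero>\<^bsub>M\<^esub>; i \<in> I\<rbrakk> \<Longrightarrow> c i = \<zero>\<^bsub>K\<^esub>"
  and generating: "m \<in> carrier M \<Longrightarrow> \<exists>c\<in>coeff_families K I. m = lincomb K M I b c"
  using basis by (simp_all add: module_basis_def)

interpretation M: module K M by (rule basis_module)

text \<open>Independence speaks about combinations equal to zero, so it is applied to
  \<open>c\<close> plus minus one times \<open>d\<close>; outside the index set both families vanish
  by convention.\<close>

lemma lincomb_inject:
  assumes "c \<in> coeff_families K I" "d \<in> coeff_families K I" "lincomb K M I b c = lincomb K M I b d"
  shows "c = d"
proof
  fix i
  let ?e = "\<lambda>i. c i \<oplus>\<^bsub>K\<^esub> (\<ominus>\<^bsub>K\<^esub> \<one>\<^bsub>K\<^esub>) \<otimes>\<^bsub>K\<^esub> d i"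
  have d': "(\<lambda>i. (\<ominus>\<^bsub>K\<^esub> \<one>\<^bsub>K\<^esub>) \<otimes>\<^bsub>K\<^esub> d i) \<in> coeff_families K I"
    by (intro coeff_families_smult M.R.is_cring assms) simp
  have "lincomb K M I b ?e = lincomb K M I b c \<oplus>\<^bsub>M\<^esub> (\<ominus>\<^bsub>K\<^esub> \<one>\<^bsub>K\<^esub>) \<odot>\<^bsub>M\<^esub> lincomb K M I b d"
    using lincomb_add[OF basis_module basis_in_carrier assms(1) d'] lincomb_smult[OF basis_module basis_in_carrier _ assms(2)] by simp
  also have "\<dots> = \<zero>\<^bsub>M\<^esub>"
    using lincomb_closed[OF basis_module basis_in_carrier assms(2)] by (simp add: assms(3) M.smult_l_minus M.M.r_neg)
  finally have "lincomb K M I b ?e = \<zero>\<^bsub>M\<^esub>" .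
  moreover have "?e \<in> coeff_families K I"
    by (intro coeff_families_add M.R.is_cring assms d')
  ultimately have e: "?e i = \<zero>\<^bsub>K\<^esub>" if "i \<in> I"
    using independent[of ?e i] that by blast
  show "c i = d i"
  proof (cases "i \<in> I")
    case True
    have cd: "c i \<in> carrier K" "d i \<in> carrier K" using assms by (auto intro: coeff_families_closed)
    then have "c i \<oplus>\<^bsub>K\<^esub> \<ominus>\<^bsub>K\<^esub> d i = \<zero>\<^bsub>K\<^esub>"
      using e[OF True] by (simp add: M.R.l_minus)
    then have "\<ominus>\<^bsub>K\<^esub> (\<ominus>\<^bsub>K\<^esub> d i) = c i" using cd by (intro M.R.minus_equality) simp_all
    then show ?thesis using cd by simp
  next
    case False
    then show ?thesis
      by (simp only: coeff_families_outside[OF assms(1) False] coeff_families_outside[OF assms(2) False])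
  qed
qed

private lemma coords_props:
  assumes "m \<in> carrier M"
  shows "coords K M I b m \<in> coeff_families K I \<and> m = lincomb K M I b (coords K M I b m)"
proof -
  have "\<exists>!c. c \<in> coeff_families K I \<and> m = lincomb K M I b c"
  proof -
    obtain c where c: "c \<in> coeff_families K I" "m = lincomb K M I b c"
      using generating[OF assms] by blast
    show ?thesis
    proof (rule ex1I)
      show "c \<in> coeff_families K I \<and> m = lincomb K M I b c" using c by (rule conjI)
      fix d assume d: "d \<in> coeff_families K I \<and> m = lincomb K M I b d"
      show "d = c"
        by (rule lincomb_inject[OF conjunct1[OF d] c(1)], rule trans[OF conjunct2[OF d, symmetric] c(2)])
    qed
  qed
  from theI'[OF this] show ?thesis unfolding coords_def .
qed

lemma coords_coeff: "m \<in> carrier M \<Longrightarrow> coords K M I b m \<in> coeff_families K I"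
  by (rule coords_props[THEN conjunct1])

lemma coords_closed: "m \<in> carrier M \<Longrightarrow> coords K M I b m i \<in> carrier K"
  by (rule coeff_families_closed[OF coords_coeff])

lemma lincomb_coords: "m \<in> carrier M \<Longrightarrow> lincomb K M I b (coords K M I b m) = m"
  by (rule coords_props[THEN conjunct2, symmetric])

lemma coords_lincomb:
  assumes "c \<in> coeff_families K I"
  shows "coords K M I b (lincomb K M I b c) = c"
  using lincomb_closed[OF basis_module basis_in_carrier assms] assms
  by (intro lincomb_inject) (simp_all add: coords_coeff lincomb_coords)

lemma coords_add:
  assumes "x \<in> carrier M" "y \<in> carrier M"
  shows "coords K M I b (x \<oplus>\<^bsub>M\<^esub> y) i = coords K M I b x i \<oplus>\<^bsub>K\<^esub> coords K M I b y i"
proof -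
  have "(\<lambda>i. coords K M I b x i \<oplus>\<^bsub>K\<^esub> coords K M I b y i) \<in> coeff_families K I"
    using assms by (intro coeff_families_add M.R.is_cring coords_coeff)
  from coords_lincomb[OF this] show ?thesis
    using assms by (simp add: lincomb_add[OF basis_module basis_in_carrier] coords_coeff lincomb_coords)
qed

lemma coords_smult:
  assumes "r \<in> carrier K" "x \<in> carrier M"
  shows "coords K M I b (r \<odot>\<^bsub>M\<^esub> x) i = r \<otimes>\<^bsub>K\<^esub> coords K M I b x i"
proof -
  have "(\<lambda>i. r \<otimes>\<^bsub>K\<^esub> coords K M I b x i) \<in> coeff_families K I"
    using assms by (intro coeff_families_smult M.R.is_cring coords_coeff)
  from coords_lincomb[OF this] show ?thesis
    using assms by (simp add: lincomb_smult[OF basis_module basis_in_carrier] coords_coeff lincomb_coords)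
qed

lemma coords_basis:
  assumes "i \<in> I"
  shows "coords K M I b (b i) = (\<lambda>j. if j = i then \<one>\<^bsub>K\<^esub> else \<zero>\<^bsub>K\<^esub>)"
proof -
  have "b i \<in> carrier M" by (rule funcset_mem[OF basis_in_carrier assms])
  then have "lincomb K M I b (\<lambda>j. if j = i then \<one>\<^bsub>K\<^esub> else \<zero>\<^bsub>K\<^esub>) = b i"
    by (simp only: lincomb_delta[OF basis_module basis_in_carrier assms M.R.one_closed] M.smult_one)
  then show ?thesis
    using coords_lincomb[OF coeff_families_delta[OF M.R.is_cring M.R.one_closed assms]]
    by (simp only:)
qed

lemma coords_zero: "coords K M I b \<zero>\<^bsub>M\<^esub> i = \<zero>\<^bsub>K\<^esub>"
  using coords_smult[of "\<zero>\<^bsub>K\<^esub>" "\<zero>\<^bsub>M\<^esub>" i] coords_closed[of "\<zero>\<^bsub>M\<^esub>" i] by simp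

lemma coords_finsum:
  assumes "g \<in> S \<rightarrow> carrier M"
  shows "coords K M I b (\<Oplus>\<^bsub>M\<^esub>j\<in>S. g j) i = (\<Oplus>\<^bsub>K\<^esub>j\<in>S. coords K M I b (g j) i)"
  using assms
proof (induction S rule: infinite_finite_induct)
  case (insert j S)
  then have "(\<lambda>j. coords K M I b (g j) i) \<in> S \<rightarrow> carrier K" "coords K M I b (g j) i \<in> carrier K"
    by (auto intro: coords_closed)
  then show ?case
    using insert by (simp add: M.M.finsum_insert M.R.finsum_insert coords_add Pi_iff M.M.finsum_closed)
qed (simp_all add: coords_zero M.M.finsum_infinite M.R.finsum_infinite)

lemma coords_inject:
  assumes "x \<in> carrier M" "y \<in> carrier M" "coords K M I b x = coords K M I b y"
  shows "x = y"
  by (rule trans[OF lincomb_coords[OF assms(1), symmetric, unfolded assms(3)] lincomb_coords[OF assms(2)]])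

lemma linear_map_basis_eqI:
  assumes "module K N" "linear_map K M N f" "linear_map K M N g"
    and "\<And>i. i \<in> I \<Longrightarrow> f (b i) = g (b i)" and "m \<in> carrier M"
  shows "f m = g m"
proof -
  interpret N: module K N by fact
  note c = coords_coeff[OF assms(5)]
  have cong: "lincomb K N I (\<lambda>i. f (b i)) (coords K M I b m) =
      lincomb K N I (\<lambda>i. g (b i)) (coords K M I b m)"
    unfolding lincomb_def
  proof (rule N.M.finsum_cong'[OF refl])
    show "(\<lambda>i. coords K M I b m i \<odot>\<^bsub>N\<^esub> g (b i)) \<in> {i \<in> I. coords K M I b m i \<noteq> \<zero>\<^bsub>K\<^esub>} \<rightarrow> carrier N"
      using basis_in_carrier coeff_families_closed[OF c]
      by (intro Pi_I N.smult_closed linear_map_closed[OF assms(3)]) auto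
  qed (simp add: assms(4))
  have "f (lincomb K M I b (coords K M I b m)) = g (lincomb K M I b (coords K M I b m))"
    by (simp only: linear_map_lincomb[OF basis_module basis_in_carrier assms(1) assms(2) c]
        linear_map_lincomb[OF basis_module basis_in_carrier assms(1) assms(3) c] cong)
  then show ?thesis by (simp only: lincomb_coords[OF assms(5)])
qed

text \<open>The existence half of the universal property of a free module, with
  \<open>linear_map_basis_eqI\<close> as the uniqueness half. Additivity and homogeneity are
  inherited from the coordinates.\<close>

lemma linear_map_from_basis:
  assumes "module K N" "v \<in> I \<rightarrow> carrier N"
  shows "linear_map K M N (\<lambda>m. lincomb K N I v (coords K M I b m))"
    and "i \<in> I \<Longrightarrow> lincomb K N I v (coords K M I b (b i)) = v i"
proof -
  interpret N: module K N by fact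
  show "linear_map K M N (\<lambda>m. lincomb K N I v (coords K M I b m))"
  proof (rule linear_mapI)
    fix x y assume xy: "x \<in> carrier M" "y \<in> carrier M"
    then have "coords K M I b (x \<oplus>\<^bsub>M\<^esub> y) = (\<lambda>i. coords K M I b x i \<oplus>\<^bsub>K\<^esub> coords K M I b y i)"
      by (simp add: coords_add fun_eq_iff)
    then show "lincomb K N I v (coords K M I b (x \<oplus>\<^bsub>M\<^esub> y)) =
        lincomb K N I v (coords K M I b x) \<oplus>\<^bsub>N\<^esub> lincomb K N I v (coords K M I b y)"
      using xy by (simp add: lincomb_add[OF assms] coords_coeff)
  next
    fix r x assume rx: "r \<in> carrier K" "x \<in> carrier M"
    then have "coords K M I b (r \<odot>\<^bsub>M\<^esub> x) = (\<lambda>i. r \<otimes>\<^bsub>K\<^esub> coords K M I b x i)"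
      by (simp add: coords_smult fun_eq_iff)
    then show "lincomb K N I v (coords K M I b (r \<odot>\<^bsub>M\<^esub> x)) = r \<odot>\<^bsub>N\<^esub> lincomb K N I v (coords K M I b x)"
      using rx by (simp add: lincomb_smult[OF assms] coords_coeff)
  qed (simp add: lincomb_closed[OF assms] coords_coeff)
  show "lincomb K N I v (coords K M I b (b i)) = v i" if "i \<in> I"
  proof -
    have "v i \<in> carrier N" using assms that by auto
    then show ?thesis using that by (simp add: coords_basis lincomb_delta[OF assms])
  qed
qed

end

text \<open>
  The record \<open>A\<close> below plays the role of the ground ring; its scalar multiplication is irrelevant.
\<close>

definition matrix_of ::
  "('k, 'a) module \<Rightarrow> ('a, 'v) module \<Rightarrow> 'i set \<Rightarrow> ('i \<Rightarrow> 'v) \<Rightarrow> ('v \<Rightarrow> 'v) \<Rightarrow> 'i \<Rightarrow> 'i \<Rightarrow> 'a"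
  where "matrix_of A V I b T =
    (\<lambda>x y. if y \<in> I then coords A V I b (T (b y)) x else \<zero>\<^bsub>A\<^esub>)"

section \<open>Endomorphisms of a free module and their column-finite matrices\<close>

context
  fixes A :: "('k, 'a) module" and V :: "('a, 'v) module" and I :: "'i set" and b :: "'i \<Rightarrow> 'v"
  assumes basis: "module_basis A V I b"
begin

private lemma basis_module_A: "module A V" and basis_in_carrier_A: "b \<in> I \<rightarrow> carrier V"
  using basis by (simp_all add: module_basis_def)

interpretation V: module A V by (rule basis_module_A)

lemma column_coeff:
  assumes "C \<in> column_finite_matrices A I"
  shows "(\<lambda>x. C x y) \<in> coeff_families A I"
  using assms by (simp add: column_finite_matrices_def coeff_families_def)

lemma matrix_of_closed:
  assumes "linear_map A V V T"
  shows "matrix_of A V I b T \<in> column_finite_matrices A I"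
proof -
  have T: "T (b y) \<in> carrier V" if "y \<in> I" for y
    using that basis_in_carrier_A linear_map_closed[OF assms] by auto
  have "finite {x. matrix_of A V I b T x y \<noteq> \<zero>\<^bsub>A\<^esub>}" for y
    using coeff_families_finite[OF coords_coeff[OF basis T]] by (cases "y \<in> I") (simp_all add: matrix_of_def)
  moreover have "matrix_of A V I b T x y = \<zero>\<^bsub>A\<^esub>" if "x \<notin> I \<or> y \<notin> I" for x y
    using that coeff_families_outside[OF coords_coeff[OF basis T]] by (auto simp: matrix_of_def)
  ultimately show ?thesis
    using coords_closed[OF basis T] by (simp add: column_finite_matrices_def matrix_of_def)
qed

text \<open>An endomorphism is determined by its values on the basis, and these can be prescribed
  freely. A value is the same as a finitely supported family of coordinates, that is, a column;
  column finiteness is thus exactly the condition that the columns of a matrix define vectors, and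
  rows stay unrestricted.\<close>

lemma matrix_of_bij:
  "bij_betw (matrix_of A V I b) (linear_maps A V V) (column_finite_matrices A I)"
proof (rule bij_betw_imageI)
  show "inj_on (matrix_of A V I b) (linear_maps A V V)"
  proof (rule inj_onI)
    fix S T assume S: "S \<in> linear_maps A V V" and T: "T \<in> linear_maps A V V"
      and eq: "matrix_of A V I b S = matrix_of A V I b T"
    have lin: "linear_map A V V S" "linear_map A V V T" using S T by (simp_all add: linear_maps_iff)
    have on_basis: "S (b y) = T (b y)" if "y \<in> I" for y
    proof (rule coords_inject[OF basis])
      have bI: "b y \<in> carrier V" using that basis_in_carrier_A by auto
      then show "S (b y) \<in> carrier V" "T (b y) \<in> carrier V" using lin by (simp_all add: linear_map_closed)
      show "coords A V I b (S (b y)) = coords A V I b (T (b y))"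
        using fun_cong[OF fun_cong[OF eq], of _ y] that by (simp add: matrix_of_def fun_eq_iff)
    qed
    show "S = T"
      by (rule linear_maps_eqI[OF S T], rule linear_map_basis_eqI[OF basis basis_module_A lin]) (simp_all add: on_basis)
  qed
  show "matrix_of A V I b ` linear_maps A V V = column_finite_matrices A I"
  proof (intro equalityI subsetI)
    fix C assume "C \<in> matrix_of A V I b ` linear_maps A V V"
    then show "C \<in> column_finite_matrices A I"
      using matrix_of_closed by (auto simp: linear_maps_iff)
  next
    fix C assume C: "C \<in> column_finite_matrices A I"
    define v where "v y = lincomb A V I b (\<lambda>x. C x y)" for y
    have v: "v \<in> I \<rightarrow> carrier V"
      unfolding v_def by (rule Pi_I, rule lincomb_closed[OF basis_module_A basis_in_carrier_A column_coeff[OF C]])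
    define T where "T = restrict (\<lambda>m. lincomb A V I v (coords A V I b m)) (carrier V)"
    have "T \<in> linear_maps A V V"
      unfolding T_def by (rule restrict_linear_maps[OF basis_module_A linear_map_from_basis(1)[OF basis basis_module_A v]])
    moreover have "matrix_of A V I b T = C"
    proof (intro ext)
      fix x y
      show "matrix_of A V I b T x y = C x y"
      proof (cases "y \<in> I")
        case True
        then have "T (b y) = v y"
          using basis_in_carrier_A linear_map_from_basis(2)[OF basis basis_module_A v True] by (auto simp: T_def)
        then show ?thesis
          using True by (simp add: matrix_of_def v_def coords_lincomb[OF basis column_coeff[OF C]])
      next
        case False
        then show ?thesis using C by (simp add: matrix_of_def column_finite_matrices_def)
      qed
    qed
    ultimately show "C \<in> matrix_of A V I b ` linear_maps A V V" by blast
  qed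
qed

text \<open>Expand the value of \<open>T\<close> at a basis vector, apply \<open>S\<close> by
  linearity and take coordinates. The support of the expansion is the index set that matrix
  multiplication prescribes, namely the support of the column of the right factor, so the two sums
  match term by term.\<close>

lemma matrix_of_compose:
  assumes S: "linear_map A V V S" and T: "linear_map A V V T"
  shows "matrix_of A V I b (compose (carrier V) S T) =
    matrix_of A V I b S \<otimes>\<^bsub>matrix_algebra A I\<^esub> matrix_of A V I b T"
proof (intro ext)
  fix x y
  show "matrix_of A V I b (compose (carrier V) S T) x y =
    (matrix_of A V I b S \<otimes>\<^bsub>matrix_algebra A I\<^esub> matrix_of A V I b T) x y"
  proof (cases "y \<in> I")
    case True
    then have bI: "b y \<in> carrier V" using basis_in_carrier_A by auto
    define c where "c = coords A V I b (T (b y))"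
    have Ty: "T (b y) \<in> carrier V" using bI T by (simp add: linear_map_closed)
    then have c: "c \<in> coeff_families A I" unfolding c_def by (rule coords_coeff[OF basis])
    note cc = coeff_families_closed[OF c]
    have Sb: "S (b z) \<in> carrier V" if "z \<in> I" for z
      using that basis_in_carrier_A S by (auto intro: linear_map_closed)
    have "S (T (b y)) = lincomb A V I (\<lambda>z. S (b z)) c"
      using linear_map_lincomb[OF basis_module_A basis_in_carrier_A basis_module_A S c] lincomb_coords[OF basis Ty] by (simp add: c_def)
    then have "coords A V I b (S (T (b y))) x =
        (\<Oplus>\<^bsub>A\<^esub>z\<in>{z \<in> I. c z \<noteq> \<zero>\<^bsub>A\<^esub>}. coords A V I b (c z \<odot>\<^bsub>V\<^esub> S (b z)) x)"
      unfolding lincomb_def using Sb cc by (simp add: coords_finsum[OF basis])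
    \<comment> \<open>Scalars act from the left in a library module, while the matrix product has
      the coefficient of \<open>T\<close> on the right; commutativity of \<open>A\<close> exchanges
      the two.\<close>
    also have "\<dots> = (\<Oplus>\<^bsub>A\<^esub>z\<in>{z \<in> I. c z \<noteq> \<zero>\<^bsub>A\<^esub>}. coords A V I b (S (b z)) x \<otimes>\<^bsub>A\<^esub> c z)"
      using Sb cc coords_closed[OF basis]
      by (intro V.R.finsum_cong') (auto simp: coords_smult[OF basis] V.R.m_comm)
    also have "\<dots> = (\<Oplus>\<^bsub>A\<^esub>z\<in>{z \<in> I. c z \<noteq> \<zero>\<^bsub>A\<^esub>}. matrix_of A V I b S x z \<otimes>\<^bsub>A\<^esub> c z)"
      using Sb cc coords_closed[OF basis]
      by (intro V.R.finsum_cong') (auto simp: matrix_of_def)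
    finally show ?thesis
      using True bI by (simp add: matrix_algebra_def matrix_of_def compose_def c_def)
  next
    case False
    then show ?thesis by (simp add: matrix_algebra_def matrix_of_def)
  qed
qed

lemma matrix_of_id:
  "matrix_of A V I b (\<lambda>t\<in>carrier V. t) = \<one>\<^bsub>matrix_algebra A I\<^esub>"
  using basis_in_carrier_A by (auto simp: matrix_of_def matrix_algebra_def fun_eq_iff coords_basis[OF basis] Pi_iff)

lemma matrix_of_zero:
  "matrix_of A V I b (\<lambda>t\<in>carrier V. \<zero>\<^bsub>V\<^esub>) = \<zero>\<^bsub>matrix_algebra A I\<^esub>"
  using basis_in_carrier_A by (auto simp: matrix_of_def matrix_algebra_def fun_eq_iff coords_zero[OF basis] Pi_iff)

lemma matrix_of_add:
  assumes "linear_map A V V S" "linear_map A V V T"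
  shows "matrix_of A V I b (\<lambda>t\<in>carrier V. S t \<oplus>\<^bsub>V\<^esub> T t) =
    matrix_of A V I b S \<oplus>\<^bsub>matrix_algebra A I\<^esub> matrix_of A V I b T"
proof -
  have "b y \<in> carrier V" if "y \<in> I" for y using that basis_in_carrier_A by auto
  then show ?thesis
    using assms by (auto simp: matrix_of_def matrix_algebra_def fun_eq_iff coords_add[OF basis] linear_map_closed)
qed

end

section \<open>Base change\<close>

lemma bilinear_map_pure_tensor_comp:
  assumes "module K P" "module K Q" "linear_map K M P f" "linear_map K N Q g"
  shows "bilinear_map K M N (tensor K P Q) (\<lambda>m n. pure_tensor K P Q (f m) (g n))"
proof (rule bilinear_mapI)
  note pure = bilinear_pure_tensor[OF assms(1,2)]
  show "linear_map K M (tensor K P Q) (\<lambda>m. pure_tensor K P Q (f m) (g n))" if "n \<in> carrier N" for n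
    by (rule linear_map_compose[OF assms(3) bilinear_map_left[OF pure linear_map_closed[OF assms(4) that]]])
  show "linear_map K N (tensor K P Q) (\<lambda>n. pure_tensor K P Q (f m) (g n))" if "m \<in> carrier M" for m
    by (rule linear_map_compose[OF assms(4) bilinear_map_right[OF pure linear_map_closed[OF assms(3) that]]])
qed

lemma tensor_map_linear:
  assumes "module K M" "module K N" "module K P" "module K Q" "linear_map K M P f" "linear_map K N Q g"
  shows "linear_map K (tensor K M N) (tensor K P Q) (tensor_map K M N P Q f g)"
  unfolding tensor_map_def
  by (intro tensor_lift_linear module_tensor bilinear_map_pure_tensor_comp assms)

lemma tensor_map_pure:
  assumes "module K M" "module K N" "module K P" "module K Q" "linear_map K M P f" "linear_map K N Q g"
    and "m \<in> carrier M" "n \<in> carrier N"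
  shows "tensor_map K M N P Q f g (pure_tensor K M N m n) = pure_tensor K P Q (f m) (g n)"
  unfolding tensor_map_def
  by (intro tensor_lift_pure module_tensor bilinear_map_pure_tensor_comp assms)

lemma assoc_algebra_module: "assoc_algebra K A \<Longrightarrow> module K A"
  by (rule assoc_algebra.axioms(1))

lemma linear_map_mult_right:
  assumes "assoc_algebra K A" "linear_map K M A f" "a \<in> carrier A"
  shows "linear_map K M A (\<lambda>m. f m \<otimes>\<^bsub>A\<^esub> a)"
proof -
  interpret A: assoc_algebra K A by fact
  show ?thesis
    using assms(2,3) by (intro linear_mapI)
      (simp_all add: linear_map_closed linear_map_add linear_map_smult A.l_distr A.smult_mult_left)
qed

lemma linear_map_mult_left:
  assumes "assoc_algebra K A" "linear_map K M A f" "a \<in> carrier A"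
  shows "linear_map K M A (\<lambda>m. a \<otimes>\<^bsub>A\<^esub> f m)"
proof -
  interpret A: assoc_algebra K A by fact
  show ?thesis
    using assms(2,3) by (intro linear_mapI)
      (simp_all add: linear_map_closed linear_map_add linear_map_smult A.r_distr A.smult_mult_right)
qed

section \<open>M \<otimes> A as a module over A\<close>

context
  fixes K :: "'k ring" and M :: "('k, 'm) module" and A :: "('k, 'a) module"
  assumes M: "module K M" and A: "assoc_algebra K A" and cring_A: "cring A"
begin

private abbreviation (input) "T \<equiv> tensor K M A"
private abbreviation (input) "V \<equiv> base_change K M A"
private abbreviation (input) "pure \<equiv> pure_tensor K M A"

private lemma A_module: "module K A"
  by (rule assoc_algebra_module[OF A])

interpretation M: module K M by (rule M)
interpretation A: assoc_algebra K A by (rule A)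
interpretation cA: cring A by (rule cring_A)
interpretation T: module K "tensor K M A" by (rule module_tensor[OF M A_module])

private lemmas T_module = module_tensor[OF M A_module]
private lemmas pure_closed = pure_tensor_closed[OF M A_module]
private lemmas pure_bilinear = bilinear_pure_tensor[OF M A_module]
private lemmas T_eqI = linear_map_tensor_eqI[OF M A_module]

lemma base_change_ops:
  "carrier (base_change K M A) = carrier (tensor K M A)"
  "\<zero>\<^bsub>base_change K M A\<^esub> = \<zero>\<^bsub>tensor K M A\<^esub>"
  "x \<oplus>\<^bsub>base_change K M A\<^esub> y = x \<oplus>\<^bsub>tensor K M A\<^esub> y"
  by (simp_all add: base_change_def)

lemma base_change_smult_linear:
  assumes "b \<in> carrier A"
  shows "linear_map K (tensor K M A) (tensor K M A) (\<lambda>t. b \<odot>\<^bsub>base_change K M A\<^esub> t)"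
  unfolding base_change_def using assms
  by (simp add: tensor_map_linear M A_module linear_map_id linear_map_mult_right[OF A linear_map_id])

lemma base_change_smult_pure:
  assumes "b \<in> carrier A" "m \<in> carrier M" "a \<in> carrier A"
  shows "b \<odot>\<^bsub>base_change K M A\<^esub> pure_tensor K M A m a = pure_tensor K M A m (a \<otimes>\<^bsub>A\<^esub> b)"
  unfolding base_change_def using assms
  by (simp add: tensor_map_pure M A_module linear_map_id linear_map_mult_right[OF A linear_map_id])

text \<open>The laws involving two scalars, as well as the unit law, compare K-linear maps on the
  tensor product and are therefore tested on pure tensors.\<close>

lemma module_base_change: "module A (base_change K M A)"
proof (rule moduleI)
  note smult_linear = base_change_smult_linear
  show "cring A" by (rule cring_A)
  show "abelian_group V"
    by (rule abelian_groupI) (auto simp: base_change_ops T.M.a_ac intro: T.M.l_neg T.M.a_inv_closed)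
  fix a x assume a: "a \<in> carrier A" and x: "x \<in> carrier V"
  then show "a \<odot>\<^bsub>V\<^esub> x \<in> carrier V"
    by (simp add: base_change_ops linear_map_closed[OF smult_linear])
  {
    fix y assume "y \<in> carrier V"
    then show "a \<odot>\<^bsub>V\<^esub> (x \<oplus>\<^bsub>V\<^esub> y) = a \<odot>\<^bsub>V\<^esub> x \<oplus>\<^bsub>V\<^esub> a \<odot>\<^bsub>V\<^esub> y"
      using a x by (simp add: base_change_ops linear_map_add[OF smult_linear])
  }
  fix b assume b: "b \<in> carrier A"
  have x': "x \<in> carrier T" using x by (simp add: base_change_ops)
  have "(a \<oplus>\<^bsub>A\<^esub> b) \<odot>\<^bsub>V\<^esub> x = a \<odot>\<^bsub>V\<^esub> x \<oplus>\<^bsub>T\<^esub> b \<odot>\<^bsub>V\<^esub> x"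
  proof (rule T_eqI[OF smult_linear linear_map_plus[OF T_module smult_linear smult_linear] _ x'])
    fix m c assume "m \<in> carrier M" "c \<in> carrier A"
    then show "(a \<oplus>\<^bsub>A\<^esub> b) \<odot>\<^bsub>V\<^esub> pure m c = a \<odot>\<^bsub>V\<^esub> pure m c \<oplus>\<^bsub>T\<^esub> b \<odot>\<^bsub>V\<^esub> pure m c"
      using a b by (simp add: base_change_smult_pure A.r_distr linear_map_add[OF bilinear_map_right[OF pure_bilinear]])
  qed (use a b in simp_all)
  then show "(a \<oplus>\<^bsub>A\<^esub> b) \<odot>\<^bsub>V\<^esub> x = a \<odot>\<^bsub>V\<^esub> x \<oplus>\<^bsub>V\<^esub> b \<odot>\<^bsub>V\<^esub> x"
    by (simp add: base_change_ops)
  \<comment> \<open>Acting with \<open>b\<close> and then \<open>a\<close> multiplies the second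
    factor on the right by \<open>b\<close> and then by \<open>a\<close>; commutativity of
    \<open>A\<close> makes this a left action.\<close>
  show "(a \<otimes>\<^bsub>A\<^esub> b) \<odot>\<^bsub>V\<^esub> x = a \<odot>\<^bsub>V\<^esub> (b \<odot>\<^bsub>V\<^esub> x)"
  proof (rule T_eqI[OF smult_linear linear_map_compose[OF smult_linear smult_linear] _ x'])
    fix m c assume "m \<in> carrier M" "c \<in> carrier A"
    then show "(a \<otimes>\<^bsub>A\<^esub> b) \<odot>\<^bsub>V\<^esub> pure m c = a \<odot>\<^bsub>V\<^esub> (b \<odot>\<^bsub>V\<^esub> pure m c)"
      using a b by (simp add: base_change_smult_pure cA.m_ac)
  qed (use a b in simp_all)
next
  fix x assume "x \<in> carrier V"
  then have x: "x \<in> carrier T" by (simp add: base_change_ops)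
  show "\<one>\<^bsub>A\<^esub> \<odot>\<^bsub>V\<^esub> x = x"
    by (rule T_eqI[OF base_change_smult_linear linear_map_id _ x])
      (simp_all add: base_change_smult_pure)
qed

interpretation V: module A "base_change K M A" by (rule module_base_change)

text \<open>Scalars of \<open>K\<close> act through the structure map from \<open>K\<close> to
  \<open>A\<close> that sends r to r times the unit: on a pure tensor the scalar moves to the second
  factor. Linearity over \<open>A\<close> therefore implies linearity over \<open>K\<close>.\<close>

lemma tensor_smult_base_change:
  assumes "r \<in> carrier K" "t \<in> carrier (tensor K M A)"
  shows "r \<odot>\<^bsub>tensor K M A\<^esub> t = (r \<odot>\<^bsub>A\<^esub> \<one>\<^bsub>A\<^esub>) \<odot>\<^bsub>base_change K M A\<^esub> t"
proof (rule T_eqI[OF linear_map_scale[OF T_module linear_map_id assms(1)] base_change_smult_linear _ assms(2)])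
  fix m a assume "m \<in> carrier M" "a \<in> carrier A"
  then show "r \<odot>\<^bsub>T\<^esub> pure m a = (r \<odot>\<^bsub>A\<^esub> \<one>\<^bsub>A\<^esub>) \<odot>\<^bsub>V\<^esub> pure m a"
    using assms(1) by (simp add: base_change_smult_pure A.smult_mult_right
        linear_map_smult[OF bilinear_map_right[OF pure_bilinear]])
qed (use assms in simp)

lemma linear_map_base_changeD:
  assumes "linear_map A (base_change K M A) (base_change K M A) f"
  shows "linear_map K (tensor K M A) (tensor K M A) f"
proof (rule linear_mapI)
  show closed: "f t \<in> carrier T" if "t \<in> carrier T" for t
    using linear_map_closed[OF assms, of t] that by (simp add: base_change_ops)
  show "f (s \<oplus>\<^bsub>T\<^esub> t) = f s \<oplus>\<^bsub>T\<^esub> f t" if "s \<in> carrier T" "t \<in> carrier T" for s t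
    using linear_map_add[OF assms, of s t] that by (simp add: base_change_ops)
  show "f (r \<odot>\<^bsub>T\<^esub> t) = r \<odot>\<^bsub>T\<^esub> f t" if "r \<in> carrier K" "t \<in> carrier T" for r t
    using linear_map_smult[OF assms, of "r \<odot>\<^bsub>A\<^esub> \<one>\<^bsub>A\<^esub>" t] that closed
    by (simp add: base_change_ops tensor_smult_base_change)
qed

text \<open>With K-linearity known, both sides of the homogeneity law for a fixed scalar of
  \<open>A\<close> are K-linear in the tensor, so pure tensors decide.\<close>

lemma linear_map_base_changeI:
  assumes f: "linear_map K (tensor K M A) (tensor K M A) f"
    and "\<And>m a b. \<lbrakk>m \<in> carrier M; a \<in> carrier A; b \<in> carrier A\<rbrakk> \<Longrightarrow>
      f (pure_tensor K M A m (a \<otimes>\<^bsub>A\<^esub> b)) = b \<odot>\<^bsub>base_change K M A\<^esub> f (pure_tensor K M A m a)"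
  shows "linear_map A (base_change K M A) (base_change K M A) f"
proof (rule linear_mapI)
  show "f t \<in> carrier V" if "t \<in> carrier V" for t
    using linear_map_closed[OF f, of t] that by (simp add: base_change_ops)
  show "f (s \<oplus>\<^bsub>V\<^esub> t) = f s \<oplus>\<^bsub>V\<^esub> f t" if "s \<in> carrier V" "t \<in> carrier V" for s t
    using linear_map_add[OF f, of s t] that by (simp add: base_change_ops)
  fix b t assume b: "b \<in> carrier A" and "t \<in> carrier V"
  then have t: "t \<in> carrier T" by (simp add: base_change_ops)
  note smult_linear = base_change_smult_linear[OF b]
  show "f (b \<odot>\<^bsub>V\<^esub> t) = b \<odot>\<^bsub>V\<^esub> f t"
    by (rule T_eqI[OF linear_map_compose[OF smult_linear f] linear_map_compose[OF f smult_linear] _ t])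
      (simp add: base_change_smult_pure b assms(2))
qed

section \<open>The basis of $M \otimes A$ and the endomorphism algebra\<close>

text \<open>All identities are evaluated at elements of M \<otimes> A. Linearity of the
  endomorphisms enters where the left factor is applied to a sum or to a scalar multiple; the other
  laws are pointwise.\<close>

lemma assoc_algebra_endo_algebra: "assoc_algebra K (endo_algebra K M A)"
proof -
  let ?E = "endo_algebra K M A"
  have carrier: "carrier ?E = linear_maps A V V" by (simp add: endo_algebra_def)
  have linear: "linear_map A V V f" if "f \<in> carrier ?E" for f
    using that by (simp add: carrier linear_maps_iff)
  have closed: "f t \<in> carrier T" if "f \<in> carrier ?E" "t \<in> carrier T" for f t
    using linear_map_closed[OF linear[OF that(1)], of t] that(2) by (simp add: base_change_ops)
  note add = linear_map_add[OF linear, unfolded base_change_ops]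
  have smult: "f (r \<odot>\<^bsub>T\<^esub> t) = r \<odot>\<^bsub>T\<^esub> f t" if "f \<in> carrier ?E" "r \<in> carrier K" "t \<in> carrier T" for f r t
    by (rule linear_map_smult[OF linear_map_base_changeD[OF linear[OF that(1)]] that(2,3)])
  have eqI: "f = g" if "f \<in> carrier ?E" "g \<in> carrier ?E" "\<And>t. t \<in> carrier T \<Longrightarrow> f t = g t" for f g
    using linear_maps_eqI[of f A V V g] that by (simp add: carrier base_change_ops)
  have restrictI: "restrict f (carrier T) \<in> carrier ?E" if "linear_map A V V f" for f
    using restrict_linear_maps[OF module_base_change that] by (simp add: carrier base_change_ops)
  have mult: "f \<otimes>\<^bsub>?E\<^esub> g \<in> carrier ?E" if "f \<in> carrier ?E" "g \<in> carrier ?E" for f g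
    using restrictI[OF linear_map_compose[OF linear[OF that(2)] linear[OF that(1)]]]
    by (simp add: endo_algebra_def compose_def)
  have one: "\<one>\<^bsub>?E\<^esub> \<in> carrier ?E"
    using restrictI[OF linear_map_id] by (simp add: endo_algebra_def)
  have zero: "\<zero>\<^bsub>?E\<^esub> \<in> carrier ?E"
    using restrictI[OF linear_map_const_zero[OF module_base_change]]
    by (simp add: endo_algebra_def base_change_ops)
  have plus: "f \<oplus>\<^bsub>?E\<^esub> g \<in> carrier ?E" if "f \<in> carrier ?E" "g \<in> carrier ?E" for f g
    using restrictI[OF linear_map_plus[OF module_base_change linear[OF that(1)] linear[OF that(2)]]]
    by (simp add: endo_algebra_def base_change_ops)
  have scale: "r \<odot>\<^bsub>?E\<^esub> f \<in> carrier ?E" if "r \<in> carrier K" "f \<in> carrier ?E" for r f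
  proof -
    \<comment> \<open>A K-multiple of an A-linear map is A-linear because the scalar acts as an
      element of the commutative ring \<open>A\<close>.\<close>
    have "linear_map A V V (\<lambda>t. r \<odot>\<^bsub>T\<^esub> f t)"
    proof (rule linear_map_cong[OF module_base_change])
      show "linear_map A V V (\<lambda>t. (r \<odot>\<^bsub>A\<^esub> \<one>\<^bsub>A\<^esub>) \<odot>\<^bsub>V\<^esub> f t)"
        using that by (intro linear_map_scale[OF module_base_change] linear) simp_all
    qed (use that in \<open>simp add: base_change_ops closed tensor_smult_base_change\<close>)
    from restrictI[OF this] show ?thesis by (simp add: endo_algebra_def)
  qed
  have app:
    "(f \<otimes>\<^bsub>?E\<^esub> g) t = f (g t)" "(f \<oplus>\<^bsub>?E\<^esub> g) t = f t \<oplus>\<^bsub>T\<^esub> g t" "(r \<odot>\<^bsub>?E\<^esub> f) t = r \<odot>\<^bsub>T\<^esub> f t"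
    "\<one>\<^bsub>?E\<^esub> t = t" "\<zero>\<^bsub>?E\<^esub> t = \<zero>\<^bsub>T\<^esub>" if "t \<in> carrier T" for f g r t
    using that by (simp_all add: endo_algebra_def compose_def)
  have "module K ?E"
    by (rule module_by_evaluation[OF T_module, of ?E "carrier T" "\<lambda>f. f"])
      (simp_all add: closed eqI zero plus scale app)
  then show ?thesis
  proof (rule assoc_algebraI)
    fix f g h assume f: "f \<in> carrier ?E" and g: "g \<in> carrier ?E" and h: "h \<in> carrier ?E"
    show "(f \<otimes>\<^bsub>?E\<^esub> g) \<otimes>\<^bsub>?E\<^esub> h = f \<otimes>\<^bsub>?E\<^esub> (g \<otimes>\<^bsub>?E\<^esub> h)"
      by (rule eqI) (simp_all add: f g h mult app closed)
    show "(f \<oplus>\<^bsub>?E\<^esub> g) \<otimes>\<^bsub>?E\<^esub> h = f \<otimes>\<^bsub>?E\<^esub> h \<oplus>\<^bsub>?E\<^esub> g \<otimes>\<^bsub>?E\<^esub> h"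
      by (rule eqI) (simp_all add: f g h mult plus app closed)
    show "h \<otimes>\<^bsub>?E\<^esub> (f \<oplus>\<^bsub>?E\<^esub> g) = h \<otimes>\<^bsub>?E\<^esub> f \<oplus>\<^bsub>?E\<^esub> h \<otimes>\<^bsub>?E\<^esub> g"
      by (rule eqI) (simp_all add: f g h mult plus app closed add)
  next
    fix f assume f: "f \<in> carrier ?E"
    show "\<one>\<^bsub>?E\<^esub> \<otimes>\<^bsub>?E\<^esub> f = f" "f \<otimes>\<^bsub>?E\<^esub> \<one>\<^bsub>?E\<^esub> = f"
      by (rule eqI, simp_all add: f mult one app closed)+
  next
    fix r f g assume r: "r \<in> carrier K" and f: "f \<in> carrier ?E" and g: "g \<in> carrier ?E"
    show "(r \<odot>\<^bsub>?E\<^esub> f) \<otimes>\<^bsub>?E\<^esub> g = r \<odot>\<^bsub>?E\<^esub> (f \<otimes>\<^bsub>?E\<^esub> g)"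
      by (rule eqI) (simp_all add: r f g mult scale app closed)
    show "f \<otimes>\<^bsub>?E\<^esub> (r \<odot>\<^bsub>?E\<^esub> g) = r \<odot>\<^bsub>?E\<^esub> (f \<otimes>\<^bsub>?E\<^esub> g)"
      by (rule eqI) (simp_all add: r f g mult scale app closed smult)
  qed (simp_all add: mult one)
qed

section \<open>The A-basis of M \<otimes> A induced by a K-basis of M\<close>

context
  fixes B :: "'m set"
  assumes basis: "module_basis K M B (\<lambda>x. x)"
begin

private abbreviation (input) "e \<equiv> (\<lambda>x. pure_tensor K M A x \<one>\<^bsub>A\<^esub>)"
private abbreviation (input) "coord \<equiv> coords K M B (\<lambda>x. x)"

text \<open>The coordinate functional of \<open>M\<close> at \<open>x\<close> tensored with the
  identity of \<open>A\<close>, followed by the identification of K \<otimes> A with A. Its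
  definition by the universal property makes it available before M \<otimes> A is known to have a
  basis.\<close>

definition tensor_coord :: "'m \<Rightarrow> ('m \<times> 'a \<Rightarrow>\<^sub>0 int) set \<Rightarrow> 'a"
  where "tensor_coord x = tensor_lift K M A A (\<lambda>m a. coords K M B (\<lambda>x. x) m x \<odot>\<^bsub>A\<^esub> a)"

private lemma B_closed: "x \<in> B \<Longrightarrow> x \<in> carrier M"
  using basis by (auto simp: module_basis_def)

private lemma e_closed: "e \<in> B \<rightarrow> carrier V"
  by (rule Pi_I) (simp add: base_change_ops pure_closed B_closed)

private lemma coord_bilinear: "bilinear_map K M A A (\<lambda>m a. coord m x \<odot>\<^bsub>A\<^esub> a)"
proof (intro bilinear_mapI linear_mapI)
  fix r m a assume "r \<in> carrier K" "m \<in> carrier M" "a \<in> carrier A"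
  then show "coord m x \<odot>\<^bsub>A\<^esub> (r \<odot>\<^bsub>A\<^esub> a) = r \<odot>\<^bsub>A\<^esub> (coord m x \<odot>\<^bsub>A\<^esub> a)"
    by (simp add: coords_closed[OF basis] A.smult_assoc1[symmetric] M.R.m_comm)
qed (simp_all add: coords_closed[OF basis] coords_add[OF basis] coords_smult[OF basis]
    A.smult_l_distr A.smult_r_distr A.smult_assoc1)

lemma tensor_coord_linear: "linear_map K (tensor K M A) A (tensor_coord x)"
  unfolding tensor_coord_def by (rule tensor_lift_linear[OF M A_module A_module coord_bilinear])

lemma tensor_coord_pure:
  "\<lbrakk>m \<in> carrier M; a \<in> carrier A\<rbrakk> \<Longrightarrow>
    tensor_coord x (pure_tensor K M A m a) = coords K M B (\<lambda>x. x) m x \<odot>\<^bsub>A\<^esub> a"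
  unfolding tensor_coord_def by (rule tensor_lift_pure[OF M A_module A_module coord_bilinear])

private lemma lincomb_tensor:
  assumes "c \<in> coeff_families A B"
  shows "lincomb A V B e c = (\<Oplus>\<^bsub>T\<^esub>i\<in>{i \<in> B. c i \<noteq> \<zero>\<^bsub>A\<^esub>}. pure i (c i))"
proof -
  \<comment> \<open>A finite sum depends only on carrier, zero and addition, and
    \<open>base_change\<close> takes these over from \<open>tensor\<close>; sums in the A-module may
    therefore be treated as sums in the K-module.\<close>
  have "(\<oplus>\<^bsub>V\<^esub>) = (\<oplus>\<^bsub>T\<^esub>)" by (simp add: base_change_def)
  then have "lincomb A V B e c = (\<Oplus>\<^bsub>T\<^esub>i\<in>{i \<in> B. c i \<noteq> \<zero>\<^bsub>A\<^esub>}. c i \<odot>\<^bsub>V\<^esub> e i)"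
    by (simp add: lincomb_def finsum_def finprod_def base_change_ops)
  also have "\<dots> = (\<Oplus>\<^bsub>T\<^esub>i\<in>{i \<in> B. c i \<noteq> \<zero>\<^bsub>A\<^esub>}. pure i (c i))"
    using coeff_families_closed[OF assms]
    by (intro T.M.finsum_cong') (auto simp: base_change_smult_pure B_closed pure_closed)
  finally show ?thesis .
qed

text \<open>On the summand at \<open>i\<close> the functional gives the coefficient of
  \<open>i\<close> if \<open>i\<close> is \<open>x\<close>, and zero otherwise. Independence of the
  induced family and the formula for its coordinates are both read off from this.\<close>

lemma tensor_coord_lincomb:
  assumes "c \<in> coeff_families A B"
  shows "tensor_coord x (lincomb A (base_change K M A) B (\<lambda>x. pure_tensor K M A x \<one>\<^bsub>A\<^esub>) c) = c x"
proof -
  note c = coeff_families_closed[OF assms]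
  let ?S = "{i \<in> B. c i \<noteq> \<zero>\<^bsub>A\<^esub>}"
  have "tensor_coord x (lincomb A V B e c) = (\<Oplus>\<^bsub>A\<^esub>i\<in>?S. tensor_coord x (pure i (c i)))"
    unfolding lincomb_tensor[OF assms]
    by (rule linear_map_finsum[OF T_module A_module tensor_coord_linear]) (simp add: Pi_iff pure_closed B_closed c)
  also have "\<dots> = (\<Oplus>\<^bsub>A\<^esub>i\<in>?S. if x = i then c i else \<zero>\<^bsub>A\<^esub>)"
    by (intro A.M.finsum_cong')
      (auto simp: tensor_coord_pure B_closed c coords_basis[OF basis])
  also have "\<dots> = c x"
  proof (cases "x \<in> ?S")
    case True
    have "finite ?S" by (rule finite_subset[OF _ coeff_families_finite[OF assms]]) auto
    then show ?thesis using True c by (intro A.M.finsum_singleton) auto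
  next
    case False
    then have "c x = \<zero>\<^bsub>A\<^esub>" using coeff_families_outside[OF assms, of x] by blast
    moreover have "(\<Oplus>\<^bsub>A\<^esub>i\<in>?S. if x = i then c i else \<zero>\<^bsub>A\<^esub>) = (\<Oplus>\<^bsub>A\<^esub>i\<in>?S. \<zero>\<^bsub>A\<^esub>)"
      using False by (intro A.M.finsum_cong') auto
    ultimately show ?thesis by simp
  qed
  finally show ?thesis .
qed

text \<open>For a pure tensor, expand the first factor in the basis of \<open>M\<close> and move
  each coefficient to the second factor. Sums are then closed under the conclusion by adding
  coefficient families.\<close>

private lemma tensor_span:
  assumes "t \<in> carrier T"
  shows "\<exists>c\<in>coeff_families A B. t = lincomb A V B e c"
  using assms
proof (induction t rule: tensor_induct[OF M A_module, consumes 1, case_names pure add])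
  case (pure m a)
  define S where "S = {i \<in> B. coord m i \<noteq> \<zero>\<^bsub>K\<^esub>}"
  define c where "c i = coord m i \<odot>\<^bsub>A\<^esub> a" for i
  note coeff = coords_coeff[OF basis pure(1)]
  note cl = coords_closed[OF basis pure(1)]
  have S: "finite S" "S \<subseteq> B"
    unfolding S_def by (auto intro: finite_subset[OF _ coeff_families_finite[OF coeff]])
  have outside: "c i = \<zero>\<^bsub>A\<^esub>" if "i \<notin> S" for i
  proof -
    have "coord m i = \<zero>\<^bsub>K\<^esub>"
      using that coeff_families_outside[OF coeff, of i] by (auto simp: S_def)
    then show ?thesis using pure by (simp add: c_def)
  qed
  have c: "c \<in> coeff_families A B"
    unfolding coeff_families_def
  proof (intro CollectI conjI allI impI)
    show "c i \<in> carrier A" for i using pure cl by (simp add: c_def)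
    show "c i = \<zero>\<^bsub>A\<^esub>" if "i \<notin> B" for i using that S(2) by (intro outside) auto
    show "finite {i. c i \<noteq> \<zero>\<^bsub>A\<^esub>}" by (rule finite_subset[OF _ S(1)]) (use outside in auto)
  qed
  note pure_linear = bilinear_map_left[OF pure_bilinear pure(2)]
  have "pure m a = lincomb K T B (\<lambda>i. pure i a) (coord m)"
    using linear_map_lincomb[OF M _ T_module pure_linear coeff, of "\<lambda>x. x"] B_closed
    by (simp add: lincomb_coords[OF basis pure(1)])
  also have "\<dots> = (\<Oplus>\<^bsub>T\<^esub>i\<in>S. pure i (c i))"
    unfolding lincomb_def S_def using cl pure
    by (intro T.M.finsum_cong')
      (auto simp: c_def B_closed pure_closed linear_map_smult[OF bilinear_map_right[OF pure_bilinear]])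
  \<comment> \<open>The product of a nonzero coefficient with \<open>a\<close> may vanish, so the
    support over \<open>A\<close> can be smaller than the support over \<open>K\<close>; the dropped
    terms are pure tensors with second factor zero.\<close>
  also have "\<dots> = (\<Oplus>\<^bsub>T\<^esub>i\<in>{i \<in> B. c i \<noteq> \<zero>\<^bsub>A\<^esub>}. pure i (c i))"
  proof (rule T.M.add.finprod_mono_neutral_cong_right[OF S(1)])
    show "{i \<in> B. c i \<noteq> \<zero>\<^bsub>A\<^esub>} \<subseteq> S" using outside by auto
    show "pure i (c i) = \<zero>\<^bsub>T\<^esub>" if "i \<in> S - {i \<in> B. c i \<noteq> \<zero>\<^bsub>A\<^esub>}" for i
    proof -
      have "i \<in> B" "c i = \<zero>\<^bsub>A\<^esub>" using that S(2) by auto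
      then show ?thesis
        using linear_map_zero[OF A_module T_module bilinear_map_right[OF pure_bilinear B_closed]] by simp
    qed
    show "(\<lambda>i. pure i (c i)) \<in> S \<rightarrow> carrier T"
      using S(2) coeff_families_closed[OF c] by (auto intro!: pure_closed B_closed)
  qed simp
  also have "\<dots> = lincomb A V B e c" by (rule lincomb_tensor[OF c, symmetric])
  finally show ?case using c by blast
next
  case (add s t)
  then obtain c d where cd: "c \<in> coeff_families A B" "s = lincomb A V B e c"
      "d \<in> coeff_families A B" "t = lincomb A V B e d" by blast
  have "s \<oplus>\<^bsub>T\<^esub> t = lincomb A V B e (\<lambda>i. c i \<oplus>\<^bsub>A\<^esub> d i)"
    using lincomb_add[OF module_base_change e_closed cd(1,3)]
    by (simp only: cd(2,4) base_change_ops)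
  then show ?case using coeff_families_add[OF cring_A cd(1,3)] by blast
qed

lemma module_basis_base_change:
  "module_basis A (base_change K M A) B (\<lambda>x. pure_tensor K M A x \<one>\<^bsub>A\<^esub>)"
  unfolding module_basis_def
proof (intro conjI ballI impI module_base_change e_closed)
  fix c i assume c: "c \<in> coeff_families A B" and "lincomb A V B e c = \<zero>\<^bsub>V\<^esub>"
  then show "c i = \<zero>\<^bsub>A\<^esub>"
    using tensor_coord_lincomb[OF c, of i] linear_map_zero[OF T_module A_module tensor_coord_linear]
    by (simp add: base_change_ops)
next
  fix t assume "t \<in> carrier V"
  then show "\<exists>c\<in>coeff_families A B. t = lincomb A V B e c"
    by (simp add: base_change_ops tensor_span)
qed

text \<open>Replaces the definite description of coordinates over \<open>A\<close> by a K-linear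
  functional with known values on pure tensors, which can be moved under Sweedler sums.\<close>

lemma coords_base_change:
  assumes "t \<in> carrier (tensor K M A)"
  shows "coords A (base_change K M A) B (\<lambda>x. pure_tensor K M A x \<one>\<^bsub>A\<^esub>) t x = tensor_coord x t"
proof -
  from tensor_span[OF assms] obtain c where c: "c \<in> coeff_families A B" "t = lincomb A V B e c" by blast
  show ?thesis
    unfolding c(2) by (simp only: coords_lincomb[OF module_basis_base_change c(1)] tensor_coord_lincomb[OF c(1)])
qed

lemma endo_matrix_eq_matrix_of:
  "endo_matrix K M A B = matrix_of A (base_change K M A) B (\<lambda>x. pure_tensor K M A x \<one>\<^bsub>A\<^esub>)"
  by (simp add: fun_eq_iff endo_matrix_def matrix_of_def)

text \<open>The two claims share one proof because the bijection along which the algebra axioms are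
  transported is the isomorphism itself; to have inverse images for every matrix, the bijection is
  established before either algebra claim.\<close>

lemma
  shows assoc_algebra_matrix_algebra: "assoc_algebra K (matrix_algebra A B)"
    and algebra_iso_endo_matrix: "algebra_iso K (endo_algebra K M A) (matrix_algebra A B) (endo_matrix K M A B)"
proof -
  let ?E = "endo_algebra K M A" and ?f = "endo_matrix K M A B" and ?S = "matrix_algebra A B"
  interpret E: assoc_algebra K ?E by (rule assoc_algebra_endo_algebra)
  note V_basis = module_basis_base_change
  have carrier: "carrier ?E = linear_maps A V V" "carrier ?S = column_finite_matrices A B"
    by (simp_all add: endo_algebra_def matrix_algebra_def)
  have linear: "linear_map A V V T'" if "T' \<in> carrier ?E" for T'
    using that by (simp add: carrier linear_maps_iff)
  have bij: "bij_betw ?f (carrier ?E) (carrier ?S)"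
    unfolding carrier endo_matrix_eq_matrix_of by (rule matrix_of_bij[OF V_basis])
  have zero: "\<zero>\<^bsub>?S\<^esub> = ?f \<zero>\<^bsub>?E\<^esub>"
    using matrix_of_zero[OF V_basis] by (simp add: endo_matrix_eq_matrix_of endo_algebra_def base_change_ops)
  have one: "\<one>\<^bsub>?S\<^esub> = ?f \<one>\<^bsub>?E\<^esub>"
    using matrix_of_id[OF V_basis] by (simp add: endo_matrix_eq_matrix_of endo_algebra_def base_change_ops)
  have add: "?f S' \<oplus>\<^bsub>?S\<^esub> ?f T' = ?f (S' \<oplus>\<^bsub>?E\<^esub> T')" if "S' \<in> carrier ?E" "T' \<in> carrier ?E" for S' T'
    using matrix_of_add[OF V_basis linear linear, OF that]
    by (simp add: endo_matrix_eq_matrix_of endo_algebra_def base_change_ops)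
  have mult: "?f S' \<otimes>\<^bsub>?S\<^esub> ?f T' = ?f (S' \<otimes>\<^bsub>?E\<^esub> T')" if "S' \<in> carrier ?E" "T' \<in> carrier ?E" for S' T'
    using matrix_of_compose[OF V_basis linear linear, OF that]
    by (simp add: endo_matrix_eq_matrix_of endo_algebra_def base_change_ops)
  \<comment> \<open>The general lemmas on \<open>matrix_of\<close> take \<open>A\<close> as ground
    ring, so scalars from \<open>K\<close> need their own argument: entries of the matrix are values
    of the K-linear functionals \<open>tensor_coord\<close>.\<close>
  have smult: "r \<odot>\<^bsub>?S\<^esub> ?f T' = ?f (r \<odot>\<^bsub>?E\<^esub> T')" if r: "r \<in> carrier K" and T': "T' \<in> carrier ?E" for r T'
  proof (intro ext)
    fix x y
    show "(r \<odot>\<^bsub>?S\<^esub> ?f T') x y = ?f (r \<odot>\<^bsub>?E\<^esub> T') x y"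
    proof (cases "y \<in> B")
      case True
      then have ey: "e y \<in> carrier T" by (simp add: pure_closed B_closed)
      then have "T' (e y) \<in> carrier T"
        using linear_map_closed[OF linear_map_base_changeD[OF linear[OF T']]] by blast
      then show ?thesis
        using True r ey
        by (simp add: endo_matrix_def matrix_algebra_def endo_algebra_def coords_base_change
            linear_map_smult[OF tensor_coord_linear])
    next
      case False
      then show ?thesis using r by (simp add: endo_matrix_def matrix_algebra_def)
    qed
  qed
  show "assoc_algebra K ?S"
    by (rule assoc_algebra_transport[where R = ?E and f = ?f])
      (rule assoc_algebra_endo_algebra bij zero one | rule add mult smult; assumption)+
  then show "algebra_iso K ?E ?S ?f"
    unfolding algebra_iso_def algebra_hom_def nonunital_algebra_hom_def
    using bij_betwE[OF bij]
    by (auto intro!: linear_mapI assoc_algebra_endo_algebra bij simp: one add mult smult)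
qed

end

end

section \<open>Comodules and the convolution algebra\<close>

lemma bilinear_map_mult:
  assumes "assoc_algebra K A" "linear_map K M A f" "linear_map K N A g"
  shows "bilinear_map K M N A (\<lambda>m n. f m \<otimes>\<^bsub>A\<^esub> g n)"
  using assms by (intro bilinear_mapI linear_map_mult_left linear_map_mult_right)
    (auto intro: linear_map_closed)

lemma bilinear_map_comp:
  assumes "bilinear_map K M N P \<beta>" "linear_map K P Q f"
  shows "bilinear_map K M N Q (\<lambda>m n. f (\<beta> m n))"
  by (rule bilinear_mapI) (erule linear_map_compose[OF bilinear_map_left[OF assms(1)] assms(2)]
      linear_map_compose[OF bilinear_map_right[OF assms(1)] assms(2)])+

lemma bilinear_map_plus:
  assumes "module K P" "bilinear_map K M N P \<beta>" "bilinear_map K M N P \<gamma>"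
  shows "bilinear_map K M N P (\<lambda>m n. \<beta> m n \<oplus>\<^bsub>P\<^esub> \<gamma> m n)"
proof (rule bilinear_mapI)
  show "linear_map K M P (\<lambda>m. \<beta> m n \<oplus>\<^bsub>P\<^esub> \<gamma> m n)" if "n \<in> carrier N" for n
    by (rule linear_map_plus[OF assms(1) bilinear_map_left[OF assms(2) that] bilinear_map_left[OF assms(3) that]])
  show "linear_map K N P (\<lambda>n. \<beta> m n \<oplus>\<^bsub>P\<^esub> \<gamma> m n)" if "m \<in> carrier M" for m
    by (rule linear_map_plus[OF assms(1) bilinear_map_right[OF assms(2) that] bilinear_map_right[OF assms(3) that]])
qed

lemma linear_map_scalar:
  assumes "module K N" "linear_map K M (self_module K) \<epsilon>" "n \<in> carrier N"
  shows "linear_map K M N (\<lambda>m. \<epsilon> m \<odot>\<^bsub>N\<^esub> n)"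
  by (rule linear_map_compose[OF assms(2) linear_map_smult_left[OF assms(1,3)]])

lemma linear_map_to_self_closed:
  "\<lbrakk>linear_map K M (self_module K) \<epsilon>; m \<in> carrier M\<rbrakk> \<Longrightarrow> \<epsilon> m \<in> carrier K"
  using linear_map_closed[of K M "self_module K" \<epsilon> m] by (simp add: self_module_def)

lemma bilinear_map_scalar_left:
  assumes "module K N" "linear_map K M (self_module K) \<epsilon>"
  shows "bilinear_map K M N N (\<lambda>m n. \<epsilon> m \<odot>\<^bsub>N\<^esub> n)"
  using assms by (intro bilinear_mapI linear_map_scalar linear_map_scale linear_map_id)
    (auto intro: linear_map_to_self_closed)

lemma bilinear_map_scalar_right:
  assumes "module K N" "linear_map K M (self_module K) \<epsilon>"
  shows "bilinear_map K N M N (\<lambda>n m. \<epsilon> m \<odot>\<^bsub>N\<^esub> n)"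
  using assms by (intro bilinear_mapI linear_map_scalar linear_map_scale linear_map_id)
    (auto intro: linear_map_to_self_closed)

text \<open>
  Coassociativity tested against a trilinear map \<open>\<tau>\<close>: in Sweedler notation,
  \<open>\<Sum> \<tau> m\<^sub>0\<^sub>0 h\<^sub>0\<^sub>1 h\<^sub>1 = \<Sum> \<tau> m\<^sub>0 h\<^sub>1\<^sub>1 h\<^sub>1\<^sub>2\<close>.
\<close>

lemma right_comodule_coassoc:
  assumes comodule: "right_comodule K H \<Delta> M \<delta>" and H: "module K H" and P: "module K P"
    and \<Delta>: "linear_map K H (tensor K H H) \<Delta>"
    and \<tau>_HH: "\<And>m. m \<in> carrier M \<Longrightarrow> bilinear_map K H H P (\<tau> m)"
    and \<tau>_M: "\<And>h h'. \<lbrakk>h \<in> carrier H; h' \<in> carrier H\<rbrakk> \<Longrightarrow> linear_map K M P (\<lambda>m. \<tau> m h h')"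
    and m: "m \<in> carrier M"
  shows "tensor_lift K M H P (\<lambda>m h'. tensor_lift K M H P (\<lambda>m h. \<tau> m h h') (\<delta> m)) (\<delta> m) =
    tensor_lift K M H P (\<lambda>m h. tensor_lift K H H P (\<tau> m) (\<Delta> h)) (\<delta> m)"
proof -
  have M: "module K M" and \<delta>: "linear_map K M (tensor K M H) \<delta>"
    using comodule by (simp_all add: right_comodule_def)
  let ?HH = "tensor K H H" and ?MH = "tensor K M H"
  have HH: "module K ?HH" and MH: "module K ?MH" by (intro module_tensor M H)+
  let ?MHH = "tensor K M ?HH"
  have MHH: "module K ?MHH" by (intro module_tensor M HH)
  have \<delta>m: "\<delta> m \<in> carrier ?MH" using linear_map_closed[OF \<delta> m] .
  \<comment> \<open>The linear map on M \<otimes> (H \<otimes> H) induced by \<tau>. Applied to the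
    two sides of the coassociativity equation, it produces the two nested sums.\<close>
  define \<Theta> where "\<Theta> = tensor_lift K M ?HH P (\<lambda>m. tensor_lift K H H P (\<tau> m))"
  have bil: "bilinear_map K M ?HH P (\<lambda>m. tensor_lift K H H P (\<tau> m))"
  proof (rule bilinear_mapI)
    show "linear_map K M P (\<lambda>m. tensor_lift K H H P (\<tau> m) s)" if "s \<in> carrier ?HH" for s
      by (rule tensor_lift_linear_in_parameter[OF H H P M \<tau>_HH \<tau>_M that])
    show "linear_map K ?HH P (tensor_lift K H H P (\<tau> m))" if "m \<in> carrier M" for m
      by (rule tensor_lift_linear[OF H H P \<tau>_HH[OF that]])
  qed
  have \<Theta>: "linear_map K ?MHH P \<Theta>"
    unfolding \<Theta>_def by (rule tensor_lift_linear[OF M HH P bil])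
  have \<Theta>_pure: "\<Theta> (pure_tensor K M ?HH m s) = tensor_lift K H H P (\<tau> m) s"
    if "m \<in> carrier M" "s \<in> carrier ?HH" for m s
    unfolding \<Theta>_def by (rule tensor_lift_pure[OF M HH P bil that])
  have "\<Theta> (tensor_map K M H M ?HH (\<lambda>m. m) \<Delta> (\<delta> m)) =
      tensor_lift K M H P (\<lambda>m h. tensor_lift K H H P (\<tau> m) (\<Delta> h)) (\<delta> m)"
  proof (rule linear_map_eq_tensor_lift[OF M H P _ _ \<delta>m])
    show "linear_map K ?MH P (\<lambda>t. \<Theta> (tensor_map K M H M ?HH (\<lambda>m. m) \<Delta> t))"
      by (rule linear_map_compose[OF tensor_map_linear[OF M H M HH linear_map_id \<Delta>] \<Theta>])
    show "\<Theta> (tensor_map K M H M ?HH (\<lambda>m. m) \<Delta> (pure_tensor K M H m h)) = tensor_lift K H H P (\<tau> m) (\<Delta> h)"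
      if "m \<in> carrier M" "h \<in> carrier H" for m h
      by (simp only: tensor_map_pure[OF M H M HH linear_map_id \<Delta> that] \<Theta>_pure[OF that(1) linear_map_closed[OF \<Delta> that(2)]])
  qed
  moreover
  \<comment> \<open>The inner map of \<open>tensor_assoc\<close>, with the third tensor factor
    \<open>h\<close> as first argument. Its bilinearity and its linearity in \<open>h\<close> must
    be known before either lift in the associator can be evaluated.\<close>
  let ?reassoc = "\<lambda>h l h'. pure_tensor K M ?HH l (pure_tensor K H H h' h)"
  have reassoc_bil: "bilinear_map K M H ?MHH (?reassoc h)" if "h \<in> carrier H" for h
    by (rule bilinear_map_pure_tensor_comp[OF M HH linear_map_id bilinear_map_left[OF bilinear_pure_tensor[OF H H] that]])
  have reassoc_lin: "linear_map K H ?MHH (\<lambda>h. ?reassoc h l h')" if "l \<in> carrier M" "h' \<in> carrier H" for l h'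
    by (rule linear_map_compose[OF bilinear_map_right[OF bilinear_pure_tensor[OF H H] that(2)]
          bilinear_map_right[OF bilinear_pure_tensor[OF M HH] that(1)]])
  have assoc_bil: "bilinear_map K ?MH H ?MHH (\<lambda>t h. tensor_lift K M H ?MHH (?reassoc h) t)"
  proof (rule bilinear_mapI)
    show "linear_map K ?MH ?MHH (tensor_lift K M H ?MHH (?reassoc h))" if "h \<in> carrier H" for h
      by (rule tensor_lift_linear[OF M H MHH reassoc_bil[OF that]])
    show "linear_map K H ?MHH (\<lambda>h. tensor_lift K M H ?MHH (?reassoc h) t)" if "t \<in> carrier ?MH" for t
      by (rule tensor_lift_linear_in_parameter[OF M H MHH H reassoc_bil reassoc_lin that])
  qed
  have assoc_lin: "linear_map K (tensor K ?MH H) ?MHH (tensor_assoc K M H H)"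
    unfolding tensor_assoc_def by (rule tensor_lift_linear[OF MH H MHH assoc_bil])
  have assoc_pure: "tensor_assoc K M H H (pure_tensor K ?MH H t h) = tensor_lift K M H ?MHH (?reassoc h) t"
    if "t \<in> carrier ?MH" "h \<in> carrier H" for t h
    unfolding tensor_assoc_def by (rule tensor_lift_pure[OF MH H MHH assoc_bil that])
  have "\<Theta> (tensor_assoc K M H H (tensor_map K M H ?MH H \<delta> (\<lambda>h. h) (\<delta> m))) =
      tensor_lift K M H P (\<lambda>m h'. tensor_lift K M H P (\<lambda>m h. \<tau> m h h') (\<delta> m)) (\<delta> m)"
  proof (rule linear_map_eq_tensor_lift[OF M H P _ _ \<delta>m])
    note map_lin = tensor_map_linear[OF M H MH H \<delta> linear_map_id]
    show "linear_map K ?MH P (\<lambda>t. \<Theta> (tensor_assoc K M H H (tensor_map K M H ?MH H \<delta> (\<lambda>h. h) t)))"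
      by (rule linear_map_compose[OF linear_map_compose[OF map_lin assoc_lin] \<Theta>])
    fix m h assume m: "m \<in> carrier M" and h: "h \<in> carrier H"
    note \<delta>m = linear_map_closed[OF \<delta> m]
    have "\<Theta> (tensor_assoc K M H H (tensor_map K M H ?MH H \<delta> (\<lambda>h. h) (pure_tensor K M H m h))) =
        \<Theta> (tensor_lift K M H ?MHH (?reassoc h) (\<delta> m))"
      by (simp only: tensor_map_pure[OF M H MH H \<delta> linear_map_id m h] assoc_pure[OF \<delta>m h])
    \<comment> \<open>The linear map \<Theta> passes under the inner lift. There \<open>h\<close>
      comes from the outer coaction and \<open>h'\<close> from the inner one, whence the order of
      arguments of \<tau> in the next step.\<close>
    also have "\<dots> = tensor_lift K M H P (\<lambda>l h'. \<Theta> (?reassoc h l h')) (\<delta> m)"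
      by (rule linear_map_tensor_lift[OF M H MHH P reassoc_bil[OF h] \<Theta> \<delta>m])
    also have "\<dots> = tensor_lift K M H P (\<lambda>l h'. \<tau> l h' h) (\<delta> m)"
    proof (rule arg_cong[where f = "\<lambda>u. u (\<delta> m)"], rule tensor_lift_cong[OF M H])
      show "\<Theta> (?reassoc h l h') = \<tau> l h' h" if "l \<in> carrier M" "h' \<in> carrier H" for l h'
        using that h \<tau>_HH by (simp add: \<Theta>_pure pure_tensor_closed[OF H H] tensor_lift_pure[OF H H P])
    qed
    finally show "\<Theta> (tensor_assoc K M H H (tensor_map K M H ?MH H \<delta> (\<lambda>h. h) (pure_tensor K M H m h))) =
        tensor_lift K M H P (\<lambda>l h'. \<tau> l h' h) (\<delta> m)" .
  qed
  moreover have "tensor_assoc K M H H (tensor_map K M H ?MH H \<delta> (\<lambda>h. h) (\<delta> m)) =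
      tensor_map K M H M ?HH (\<lambda>m. m) \<Delta> (\<delta> m)"
    using comodule m by (simp add: right_comodule_def)
  ultimately show ?thesis by simp
qed

lemma coalgebra_right_comodule: "coalgebra K H \<Delta> \<epsilon> \<Longrightarrow> right_comodule K H \<Delta> H \<Delta>"
  by (simp add: coalgebra_def right_comodule_def)

section \<open>The convolution algebra and its Rota-Baxter operator\<close>

context
  fixes K :: "'k ring" and H :: "('k, 'h) module" and \<Delta> :: "'h \<Rightarrow> ('h \<times> 'h \<Rightarrow>\<^sub>0 int) set"
    and \<epsilon> :: "'h \<Rightarrow> 'k" and A :: "('k, 'a) module"
  assumes coalgebra: "coalgebra K H \<Delta> \<epsilon>" and A: "assoc_algebra K A"
begin

private abbreviation (input) "Conv \<equiv> convolution_algebra K H \<Delta> \<epsilon> A"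

private lemma H_module: "module K H" and \<Delta>_linear: "linear_map K H (tensor K H H) \<Delta>"
    and \<epsilon>_linear: "linear_map K H (self_module K) \<epsilon>"
  using coalgebra by (simp_all add: coalgebra_def)

private lemmas A_is_module = assoc_algebra_module[OF A]

interpretation H: module K H by (rule H_module)
interpretation A: assoc_algebra K A by (rule A)

private lemma \<Delta>_closed: "h \<in> carrier H \<Longrightarrow> \<Delta> h \<in> carrier (tensor K H H)"
  by (rule linear_map_closed[OF \<Delta>_linear])

private lemma \<epsilon>_closed: "h \<in> carrier H \<Longrightarrow> \<epsilon> h \<in> carrier K"
  by (rule linear_map_to_self_closed[OF \<epsilon>_linear])

lemma convolution_carrierD: "f \<in> carrier (convolution_algebra K H \<Delta> \<epsilon> A) \<Longrightarrow> linear_map K H A f"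
  by (simp add: convolution_algebra_def linear_maps_iff)

private lemma carrierI: "linear_map K H A f \<Longrightarrow> restrict f (carrier H) \<in> carrier Conv"
  by (simp add: convolution_algebra_def restrict_linear_maps H_module)

lemma convolution_eqI:
  assumes "f \<in> carrier (convolution_algebra K H \<Delta> \<epsilon> A)" "g \<in> carrier (convolution_algebra K H \<Delta> \<epsilon> A)"
    and "\<And>h. h \<in> carrier H \<Longrightarrow> f h = g h"
  shows "f = g"
  using linear_maps_eqI[of f K H A g] assms by (simp add: convolution_algebra_def)

lemma convolution_apply:
  assumes "h \<in> carrier H"
  shows "(f \<otimes>\<^bsub>convolution_algebra K H \<Delta> \<epsilon> A\<^esub> g) h =
      tensor_lift K H H A (\<lambda>h\<^sub>1 h\<^sub>2. f h\<^sub>1 \<otimes>\<^bsub>A\<^esub> g h\<^sub>2) (\<Delta> h)"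
    and "\<one>\<^bsub>convolution_algebra K H \<Delta> \<epsilon> A\<^esub> h = \<epsilon> h \<odot>\<^bsub>A\<^esub> \<one>\<^bsub>A\<^esub>"
    and "\<zero>\<^bsub>convolution_algebra K H \<Delta> \<epsilon> A\<^esub> h = \<zero>\<^bsub>A\<^esub>"
    and "(f \<oplus>\<^bsub>convolution_algebra K H \<Delta> \<epsilon> A\<^esub> g) h = f h \<oplus>\<^bsub>A\<^esub> g h"
    and "(r \<odot>\<^bsub>convolution_algebra K H \<Delta> \<epsilon> A\<^esub> f) h = r \<odot>\<^bsub>A\<^esub> f h"
  using assms by (simp_all add: convolution_algebra_def)

lemma convolution_cong:
  assumes "\<And>h\<^sub>1 h\<^sub>2. \<lbrakk>h\<^sub>1 \<in> carrier H; h\<^sub>2 \<in> carrier H\<rbrakk> \<Longrightarrow> \<beta> h\<^sub>1 h\<^sub>2 = \<gamma> h\<^sub>1 h\<^sub>2"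
  shows "tensor_lift K H H P \<beta> t = tensor_lift K H H P \<gamma> t"
  by (rule arg_cong[where f = "\<lambda>u. u t"], rule tensor_lift_cong[OF H_module H_module assms])

private lemmas conv_linear = convolution_carrierD
private lemmas mult_bilinear = bilinear_map_mult[OF A conv_linear conv_linear]

private lemma conv_closed: "\<lbrakk>f \<in> carrier Conv; h \<in> carrier H\<rbrakk> \<Longrightarrow> f h \<in> carrier A"
  by (rule linear_map_closed[OF conv_linear])

lemma convolution_closed:
  "\<lbrakk>f \<in> carrier (convolution_algebra K H \<Delta> \<epsilon> A); g \<in> carrier (convolution_algebra K H \<Delta> \<epsilon> A)\<rbrakk> \<Longrightarrow>
    f \<otimes>\<^bsub>convolution_algebra K H \<Delta> \<epsilon> A\<^esub> g \<in> carrier (convolution_algebra K H \<Delta> \<epsilon> A)"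
  "\<one>\<^bsub>convolution_algebra K H \<Delta> \<epsilon> A\<^esub> \<in> carrier (convolution_algebra K H \<Delta> \<epsilon> A)"
  "\<zero>\<^bsub>convolution_algebra K H \<Delta> \<epsilon> A\<^esub> \<in> carrier (convolution_algebra K H \<Delta> \<epsilon> A)"
  "\<lbrakk>f \<in> carrier (convolution_algebra K H \<Delta> \<epsilon> A); g \<in> carrier (convolution_algebra K H \<Delta> \<epsilon> A)\<rbrakk> \<Longrightarrow>
    f \<oplus>\<^bsub>convolution_algebra K H \<Delta> \<epsilon> A\<^esub> g \<in> carrier (convolution_algebra K H \<Delta> \<epsilon> A)"
  "\<lbrakk>r \<in> carrier K; f \<in> carrier (convolution_algebra K H \<Delta> \<epsilon> A)\<rbrakk> \<Longrightarrow>
    r \<odot>\<^bsub>convolution_algebra K H \<Delta> \<epsilon> A\<^esub> f \<in> carrier (convolution_algebra K H \<Delta> \<epsilon> A)"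
proof -
  show "f \<otimes>\<^bsub>Conv\<^esub> g \<in> carrier Conv" if "f \<in> carrier Conv" "g \<in> carrier Conv"
    using carrierI[OF linear_map_compose[OF \<Delta>_linear tensor_lift_linear[OF H_module H_module A_is_module mult_bilinear[OF that]]]]
    by (simp add: convolution_algebra_def)
  show "\<one>\<^bsub>Conv\<^esub> \<in> carrier Conv"
    using carrierI[OF linear_map_scalar[OF A_is_module \<epsilon>_linear A.one_closed]] by (simp add: convolution_algebra_def)
  show "\<zero>\<^bsub>Conv\<^esub> \<in> carrier Conv"
    using carrierI[OF linear_map_const_zero[OF A_is_module]] by (simp add: convolution_algebra_def)
  show "f \<oplus>\<^bsub>Conv\<^esub> g \<in> carrier Conv" if "f \<in> carrier Conv" "g \<in> carrier Conv"
    using carrierI[OF linear_map_plus[OF A_is_module conv_linear[OF that(1)] conv_linear[OF that(2)]]]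
    by (simp add: convolution_algebra_def)
  show "r \<odot>\<^bsub>Conv\<^esub> f \<in> carrier Conv" if "r \<in> carrier K" "f \<in> carrier Conv"
    using carrierI[OF linear_map_scale[OF A_is_module conv_linear[OF that(2)] that(1)]]
    by (simp add: convolution_algebra_def)
qed

lemma assoc_algebra_convolution: "assoc_algebra K (convolution_algebra K H \<Delta> \<epsilon> A)"
proof -
  note rules = convolution_closed convolution_apply conv_closed \<Delta>_closed
  have "module K Conv"
    by (rule module_by_evaluation[OF A_is_module, of Conv "carrier H" "\<lambda>f. f"])
      (simp_all add: rules convolution_eqI)
  then show ?thesis
  proof (rule assoc_algebraI)
    fix f g k assume f: "f \<in> carrier Conv" and g: "g \<in> carrier Conv" and k: "k \<in> carrier Conv"
    note fgk = f g k
    show "(f \<otimes>\<^bsub>Conv\<^esub> g) \<otimes>\<^bsub>Conv\<^esub> k = f \<otimes>\<^bsub>Conv\<^esub> (g \<otimes>\<^bsub>Conv\<^esub> k)"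
    proof (rule convolution_eqI)
      fix h assume h: "h \<in> carrier H"
      \<comment> \<open>The product is bracketed to the right: associativity of \<open>A\<close> is
        spent in bringing the left-hand side to this form, and what then remains is
        coassociativity.\<close>
      let ?\<tau> = "\<lambda>x y z. f x \<otimes>\<^bsub>A\<^esub> (g y \<otimes>\<^bsub>A\<^esub> k z)"
      have "((f \<otimes>\<^bsub>Conv\<^esub> g) \<otimes>\<^bsub>Conv\<^esub> k) h =
          tensor_lift K H H A (\<lambda>x z. tensor_lift K H H A (\<lambda>x y. ?\<tau> x y z) (\<Delta> x)) (\<Delta> h)"
        unfolding convolution_apply[OF h]
      proof (rule convolution_cong)
        fix x z assume x: "x \<in> carrier H" and z: "z \<in> carrier H"
        have "(f \<otimes>\<^bsub>Conv\<^esub> g) x \<otimes>\<^bsub>A\<^esub> k z =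
            tensor_lift K H H A (\<lambda>x y. (f x \<otimes>\<^bsub>A\<^esub> g y) \<otimes>\<^bsub>A\<^esub> k z) (\<Delta> x)"
          unfolding convolution_apply[OF x]
          by (rule linear_map_tensor_lift[OF H_module H_module A_is_module A_is_module mult_bilinear[OF f g]
                linear_map_mult_right[OF A linear_map_id conv_closed[OF k z]] \<Delta>_closed[OF x]])
        also have "\<dots> = tensor_lift K H H A (\<lambda>x y. ?\<tau> x y z) (\<Delta> x)"
          by (rule convolution_cong) (simp add: fgk z conv_closed A.m_assoc)
        finally show "(f \<otimes>\<^bsub>Conv\<^esub> g) x \<otimes>\<^bsub>A\<^esub> k z = tensor_lift K H H A (\<lambda>x y. ?\<tau> x y z) (\<Delta> x)" .
      qed
      also have "\<dots> = tensor_lift K H H A (\<lambda>x y. tensor_lift K H H A (?\<tau> x) (\<Delta> y)) (\<Delta> h)"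
      proof (rule right_comodule_coassoc[OF coalgebra_right_comodule[OF coalgebra] H_module A_is_module \<Delta>_linear _ _ h])
        show "bilinear_map K H H A (?\<tau> x)" if "x \<in> carrier H" for x
          by (rule bilinear_map_comp[OF mult_bilinear[OF g k]
                linear_map_mult_left[OF A linear_map_id conv_closed[OF f that]]])
        show "linear_map K H A (\<lambda>x. ?\<tau> x y z)" if "y \<in> carrier H" "z \<in> carrier H" for y z
          using that by (intro linear_map_mult_right[OF A conv_linear[OF f]]) (simp add: fgk conv_closed)
      qed
      also have "\<dots> = (f \<otimes>\<^bsub>Conv\<^esub> (g \<otimes>\<^bsub>Conv\<^esub> k)) h"
        unfolding convolution_apply[OF h]
      proof (rule convolution_cong)
        fix x y assume x: "x \<in> carrier H" and y: "y \<in> carrier H"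
        show "tensor_lift K H H A (?\<tau> x) (\<Delta> y) = f x \<otimes>\<^bsub>A\<^esub> (g \<otimes>\<^bsub>Conv\<^esub> k) y"
          unfolding convolution_apply[OF y]
          by (rule linear_map_tensor_lift[OF H_module H_module A_is_module A_is_module mult_bilinear[OF g k]
                linear_map_mult_left[OF A linear_map_id conv_closed[OF f x]] \<Delta>_closed[OF y], symmetric])
      qed
      finally show "((f \<otimes>\<^bsub>Conv\<^esub> g) \<otimes>\<^bsub>Conv\<^esub> k) h = (f \<otimes>\<^bsub>Conv\<^esub> (g \<otimes>\<^bsub>Conv\<^esub> k)) h" .
    qed (simp_all add: fgk rules)
    note add = tensor_lift_add[OF H_module H_module A_is_module mult_bilinear mult_bilinear \<Delta>_closed, symmetric]
    show "(f \<oplus>\<^bsub>Conv\<^esub> g) \<otimes>\<^bsub>Conv\<^esub> k = f \<otimes>\<^bsub>Conv\<^esub> k \<oplus>\<^bsub>Conv\<^esub> g \<otimes>\<^bsub>Conv\<^esub> k"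
    proof (rule convolution_eqI)
      show "((f \<oplus>\<^bsub>Conv\<^esub> g) \<otimes>\<^bsub>Conv\<^esub> k) h = (f \<otimes>\<^bsub>Conv\<^esub> k \<oplus>\<^bsub>Conv\<^esub> g \<otimes>\<^bsub>Conv\<^esub> k) h" if h: "h \<in> carrier H" for h
        unfolding convolution_apply[OF h] add[OF f k g k h]
        by (rule convolution_cong) (simp add: rules fgk A.l_distr)
    qed (simp_all add: fgk rules)
    show "k \<otimes>\<^bsub>Conv\<^esub> (f \<oplus>\<^bsub>Conv\<^esub> g) = k \<otimes>\<^bsub>Conv\<^esub> f \<oplus>\<^bsub>Conv\<^esub> k \<otimes>\<^bsub>Conv\<^esub> g"
    proof (rule convolution_eqI)
      show "(k \<otimes>\<^bsub>Conv\<^esub> (f \<oplus>\<^bsub>Conv\<^esub> g)) h = (k \<otimes>\<^bsub>Conv\<^esub> f \<oplus>\<^bsub>Conv\<^esub> k \<otimes>\<^bsub>Conv\<^esub> g) h" if h: "h \<in> carrier H" for h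
        unfolding convolution_apply[OF h] add[OF k f k g h]
        by (rule convolution_cong) (simp add: rules fgk A.r_distr)
    qed (simp_all add: fgk rules)
  next
    fix f assume f: "f \<in> carrier Conv"
    show "\<one>\<^bsub>Conv\<^esub> \<otimes>\<^bsub>Conv\<^esub> f = f"
    proof (rule convolution_eqI)
      fix h assume h: "h \<in> carrier H"
      \<comment> \<open>The factor from the unit is a scalar and is absorbed into the argument of
        \<open>f\<close>. Linearity of \<open>f\<close> then brings it outside the sum, which leaves
        the left counit axiom; the right unit law is the mirror image.\<close>
      have "(\<one>\<^bsub>Conv\<^esub> \<otimes>\<^bsub>Conv\<^esub> f) h = tensor_lift K H H A (\<lambda>x y. f (\<epsilon> x \<odot>\<^bsub>H\<^esub> y)) (\<Delta> h)"
        unfolding convolution_apply[OF h]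
        by (rule convolution_cong)
          (simp add: rules f \<epsilon>_closed A.smult_mult_left linear_map_smult[OF conv_linear[OF f]])
      also have "\<dots> = f (tensor_lift K H H H (\<lambda>x y. \<epsilon> x \<odot>\<^bsub>H\<^esub> y) (\<Delta> h))"
        by (rule linear_map_tensor_lift[OF H_module H_module H_module A_is_module bilinear_map_scalar_left[OF H_module \<epsilon>_linear] conv_linear[OF f]
              \<Delta>_closed[OF h], symmetric])
      also have "\<dots> = f h" using coalgebra h by (simp add: coalgebra_def)
      finally show "(\<one>\<^bsub>Conv\<^esub> \<otimes>\<^bsub>Conv\<^esub> f) h = f h" .
    qed (simp_all add: f rules)
    show "f \<otimes>\<^bsub>Conv\<^esub> \<one>\<^bsub>Conv\<^esub> = f"
    proof (rule convolution_eqI)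
      fix h assume h: "h \<in> carrier H"
      have "(f \<otimes>\<^bsub>Conv\<^esub> \<one>\<^bsub>Conv\<^esub>) h = tensor_lift K H H A (\<lambda>x y. f (\<epsilon> y \<odot>\<^bsub>H\<^esub> x)) (\<Delta> h)"
        unfolding convolution_apply[OF h]
        by (rule convolution_cong)
          (simp add: rules f \<epsilon>_closed A.smult_mult_right linear_map_smult[OF conv_linear[OF f]])
      also have "\<dots> = f (tensor_lift K H H H (\<lambda>x y. \<epsilon> y \<odot>\<^bsub>H\<^esub> x) (\<Delta> h))"
        by (rule linear_map_tensor_lift[OF H_module H_module H_module A_is_module bilinear_map_scalar_right[OF H_module \<epsilon>_linear] conv_linear[OF f]
              \<Delta>_closed[OF h], symmetric])
      also have "\<dots> = f h" using coalgebra h by (simp add: coalgebra_def)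
      finally show "(f \<otimes>\<^bsub>Conv\<^esub> \<one>\<^bsub>Conv\<^esub>) h = f h" .
    qed (simp_all add: f rules)
  next
    fix r f g assume r: "r \<in> carrier K" and f: "f \<in> carrier Conv" and g: "g \<in> carrier Conv"
    note smult = tensor_lift_smult[OF H_module H_module A_is_module mult_bilinear[OF f g] r \<Delta>_closed, symmetric]
    show "(r \<odot>\<^bsub>Conv\<^esub> f) \<otimes>\<^bsub>Conv\<^esub> g = r \<odot>\<^bsub>Conv\<^esub> (f \<otimes>\<^bsub>Conv\<^esub> g)"
    proof (rule convolution_eqI)
      show "((r \<odot>\<^bsub>Conv\<^esub> f) \<otimes>\<^bsub>Conv\<^esub> g) h = (r \<odot>\<^bsub>Conv\<^esub> (f \<otimes>\<^bsub>Conv\<^esub> g)) h" if h: "h \<in> carrier H" for h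
        unfolding convolution_apply[OF h] smult[OF h]
        by (rule convolution_cong) (simp add: rules f g r A.smult_mult_left)
    qed (simp_all add: r f g rules)
    show "f \<otimes>\<^bsub>Conv\<^esub> (r \<odot>\<^bsub>Conv\<^esub> g) = r \<odot>\<^bsub>Conv\<^esub> (f \<otimes>\<^bsub>Conv\<^esub> g)"
    proof (rule convolution_eqI)
      show "(f \<otimes>\<^bsub>Conv\<^esub> (r \<odot>\<^bsub>Conv\<^esub> g)) h = (r \<odot>\<^bsub>Conv\<^esub> (f \<otimes>\<^bsub>Conv\<^esub> g)) h" if h: "h \<in> carrier H" for h
        unfolding convolution_apply[OF h] smult[OF h]
        by (rule convolution_cong) (simp add: rules f g r A.smult_mult_right)
    qed (simp_all add: r f g rules)
  qed (simp_all add: rules)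
qed

text \<open>Under the Sweedler sum the identity is the one for \<open>Q\<close> at the values of
  \<open>f\<close> and \<open>g\<close> on the two tensor factors. It is split into three sums by
  additivity of the lift in its summand, and linearity lets \<open>Q\<close> pass between summand
  and sum.\<close>

lemma rota_baxter_convolution:
  assumes Q: "rota_baxter_algebra K w A Q"
  shows "rota_baxter_algebra K w (convolution_algebra K H \<Delta> \<epsilon> A) (convolution_operator H Q)"
proof -
  let ?P = "convolution_operator H Q"
  have w: "w \<in> carrier K" and Q_linear: "linear_map K A A Q"
    and Q_eq: "\<And>x y. \<lbrakk>x \<in> carrier A; y \<in> carrier A\<rbrakk> \<Longrightarrow> Q x \<otimes>\<^bsub>A\<^esub> Q y =
          Q (x \<otimes>\<^bsub>A\<^esub> Q y) \<oplus>\<^bsub>A\<^esub> Q (Q x \<otimes>\<^bsub>A\<^esub> y) \<oplus>\<^bsub>A\<^esub> w \<odot>\<^bsub>A\<^esub> Q (x \<otimes>\<^bsub>A\<^esub> y)"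
    using Q by (simp_all add: rota_baxter_algebra_def)
  have P_apply: "?P f h = Q (f h)" if "h \<in> carrier H" for f h
    using that by (simp add: convolution_operator_def)
  have P_closed: "?P f \<in> carrier Conv" if "f \<in> carrier Conv" for f
    using carrierI[OF linear_map_compose[OF conv_linear[OF that] Q_linear]] by (simp add: convolution_operator_def)
  note rules = convolution_closed convolution_apply conv_closed P_closed P_apply
  have "linear_map K Conv Conv ?P"
  proof (rule linear_mapI)
    show "?P (f \<oplus>\<^bsub>Conv\<^esub> g) = ?P f \<oplus>\<^bsub>Conv\<^esub> ?P g" if "f \<in> carrier Conv" "g \<in> carrier Conv" for f g
      by (rule convolution_eqI) (simp_all add: that rules linear_map_add[OF Q_linear])
    show "?P (r \<odot>\<^bsub>Conv\<^esub> f) = r \<odot>\<^bsub>Conv\<^esub> ?P f" if "r \<in> carrier K" "f \<in> carrier Conv" for r f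
      by (rule convolution_eqI) (simp_all add: that rules linear_map_smult[OF Q_linear])
  qed (rule P_closed)
  moreover have "?P f \<otimes>\<^bsub>Conv\<^esub> ?P g =
      ?P (f \<otimes>\<^bsub>Conv\<^esub> ?P g) \<oplus>\<^bsub>Conv\<^esub> ?P (?P f \<otimes>\<^bsub>Conv\<^esub> g) \<oplus>\<^bsub>Conv\<^esub> w \<odot>\<^bsub>Conv\<^esub> ?P (f \<otimes>\<^bsub>Conv\<^esub> g)"
    if f: "f \<in> carrier Conv" and g: "g \<in> carrier Conv" for f g
  proof (rule convolution_eqI)
    fix h assume h: "h \<in> carrier H"
    let ?lift = "\<lambda>\<beta>. tensor_lift K H H A \<beta> (\<Delta> h)"
    have Q_lift: "Q ((u \<otimes>\<^bsub>Conv\<^esub> v) h) = ?lift (\<lambda>x y. Q (u x \<otimes>\<^bsub>A\<^esub> v y))"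
      if "u \<in> carrier Conv" "v \<in> carrier Conv" for u v
      unfolding convolution_apply[OF h]
      by (rule linear_map_tensor_lift[OF H_module H_module A_is_module A_is_module mult_bilinear[OF that] Q_linear \<Delta>_closed[OF h]])
    have Q_bilinear: "bilinear_map K H H A (\<lambda>x y. Q (u x \<otimes>\<^bsub>A\<^esub> v y))"
      if "u \<in> carrier Conv" "v \<in> carrier Conv" for u v
      by (rule bilinear_map_comp[OF mult_bilinear[OF that] Q_linear])
    let ?a = "\<lambda>x y. Q (f x \<otimes>\<^bsub>A\<^esub> ?P g y)" and ?b = "\<lambda>x y. Q (?P f x \<otimes>\<^bsub>A\<^esub> g y)"
      and ?c = "\<lambda>x y. Q (f x \<otimes>\<^bsub>A\<^esub> g y)"
    note bil = Q_bilinear[OF f P_closed[OF g]] Q_bilinear[OF P_closed[OF f] g] Q_bilinear[OF f g]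
    note bil_w = bilinear_map_comp[OF bil(3) linear_map_scale[OF A_is_module linear_map_id w]]
    have "(?P f \<otimes>\<^bsub>Conv\<^esub> ?P g) h = ?lift (\<lambda>x y. ?a x y \<oplus>\<^bsub>A\<^esub> ?b x y \<oplus>\<^bsub>A\<^esub> w \<odot>\<^bsub>A\<^esub> ?c x y)"
      unfolding convolution_apply[OF h]
      by (rule convolution_cong) (simp add: P_apply Q_eq conv_closed f g)
    also have "\<dots> = ?lift ?a \<oplus>\<^bsub>A\<^esub> ?lift ?b \<oplus>\<^bsub>A\<^esub> w \<odot>\<^bsub>A\<^esub> ?lift ?c"
      by (simp only: tensor_lift_add[OF H_module H_module A_is_module bilinear_map_plus[OF A_is_module bil(1,2)] bil_w \<Delta>_closed[OF h]]
          tensor_lift_add[OF H_module H_module A_is_module bil(1,2) \<Delta>_closed[OF h]]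
          tensor_lift_smult[OF H_module H_module A_is_module bil(3) w \<Delta>_closed[OF h]])
    also have "\<dots> = (?P (f \<otimes>\<^bsub>Conv\<^esub> ?P g) \<oplus>\<^bsub>Conv\<^esub> ?P (?P f \<otimes>\<^bsub>Conv\<^esub> g) \<oplus>\<^bsub>Conv\<^esub> w \<odot>\<^bsub>Conv\<^esub> ?P (f \<otimes>\<^bsub>Conv\<^esub> g)) h"
      by (simp only: convolution_apply(4,5)[OF h] P_apply[OF h] Q_lift f g P_closed)
    finally show "(?P f \<otimes>\<^bsub>Conv\<^esub> ?P g) h =
      (?P (f \<otimes>\<^bsub>Conv\<^esub> ?P g) \<oplus>\<^bsub>Conv\<^esub> ?P (?P f \<otimes>\<^bsub>Conv\<^esub> g) \<oplus>\<^bsub>Conv\<^esub> w \<odot>\<^bsub>Conv\<^esub> ?P (f \<otimes>\<^bsub>Conv\<^esub> g)) h" .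
  qed (simp_all add: f g w rules)
  ultimately show ?thesis
    using assoc_algebra_convolution w by (simp add: rota_baxter_algebra_def)
qed

end

section \<open>The matrix representation\<close>

text \<open>The definition sums over the support of a column of the right factor, which varies with
  that factor. Any finite set containing the support will do, so products with different right
  factors can be compared term by term.\<close>

lemma matrix_mult_eq:
  assumes "assoc_algebra K A" "C \<in> column_finite_matrices A I" "D \<in> column_finite_matrices A I"
    and "finite S" "S \<subseteq> I" "\<And>z. z \<in> I - S \<Longrightarrow> D z y = \<zero>\<^bsub>A\<^esub>"
  shows "(C \<otimes>\<^bsub>matrix_algebra A I\<^esub> D) x y = (\<Oplus>\<^bsub>A\<^esub>z\<in>S. C x z \<otimes>\<^bsub>A\<^esub> D z y)"
proof -
  interpret A: assoc_algebra K A by fact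
  have closed: "C u v \<in> carrier A" "D u v \<in> carrier A" for u v
    using assms(2,3) by (simp_all add: column_finite_matrices_def)
  have "(\<Oplus>\<^bsub>A\<^esub>z\<in>{z \<in> I. D z y \<noteq> \<zero>\<^bsub>A\<^esub>}. C x z \<otimes>\<^bsub>A\<^esub> D z y) = (\<Oplus>\<^bsub>A\<^esub>z\<in>S. C x z \<otimes>\<^bsub>A\<^esub> D z y)"
  proof (rule A.M.add.finprod_mono_neutral_cong_left[OF assms(4)])
    show "{z \<in> I. D z y \<noteq> \<zero>\<^bsub>A\<^esub>} \<subseteq> S" using assms(6) by blast
    show "C x z \<otimes>\<^bsub>A\<^esub> D z y = \<zero>\<^bsub>A\<^esub>" if "z \<in> S - {z \<in> I. D z y \<noteq> \<zero>\<^bsub>A\<^esub>}" for z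
    proof -
      have "D z y = \<zero>\<^bsub>A\<^esub>" using that assms(5) by blast
      then show ?thesis using closed by simp
    qed
  qed (simp_all add: closed)
  then show ?thesis by (simp add: matrix_algebra_def)
qed

text \<open>Each entry of the identity is a finite sum of instances of the identity in
  \<open>A\<close>, because \<open>Q\<close> is additive on finite sums.\<close>

lemma rota_baxter_matrix:
  assumes Q: "rota_baxter_algebra K w A Q" and S: "assoc_algebra K (matrix_algebra A I)"
  shows "rota_baxter_algebra K w (matrix_algebra A I) (matrix_operator Q)"
proof -
  let ?S = "matrix_algebra A I" and ?P = "matrix_operator Q"
  have A: "assoc_algebra K A" and w: "w \<in> carrier K" and Q_linear: "linear_map K A A Q"
    and Q_eq: "\<And>x y. \<lbrakk>x \<in> carrier A; y \<in> carrier A\<rbrakk> \<Longrightarrow> Q x \<otimes>\<^bsub>A\<^esub> Q y =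
          Q (x \<otimes>\<^bsub>A\<^esub> Q y) \<oplus>\<^bsub>A\<^esub> Q (Q x \<otimes>\<^bsub>A\<^esub> y) \<oplus>\<^bsub>A\<^esub> w \<odot>\<^bsub>A\<^esub> Q (x \<otimes>\<^bsub>A\<^esub> y)"
    using Q by (simp_all add: rota_baxter_algebra_def)
  interpret A: assoc_algebra K A by (rule A)
  interpret S: assoc_algebra K ?S by (rule S)
  note A_module = assoc_algebra_module[OF A]
  note Q_closed = linear_map_closed[OF Q_linear]
  have Q_zero: "Q \<zero>\<^bsub>A\<^esub> = \<zero>\<^bsub>A\<^esub>" by (rule linear_map_zero[OF A_module A_module Q_linear])
  have carrier: "carrier ?S = column_finite_matrices A I" by (simp add: matrix_algebra_def)
  have entry: "C x y \<in> carrier A" if "C \<in> carrier ?S" for C x y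
    using that by (simp add: carrier column_finite_matrices_def)
  have P_closed: "?P C \<in> carrier ?S" if "C \<in> carrier ?S" for C
  proof -
    have "finite {x. Q (C x y) \<noteq> \<zero>\<^bsub>A\<^esub>}" for y
    proof (rule finite_subset)
      show "{x. Q (C x y) \<noteq> \<zero>\<^bsub>A\<^esub>} \<subseteq> {x. C x y \<noteq> \<zero>\<^bsub>A\<^esub>}" using Q_zero by auto
      show "finite {x. C x y \<noteq> \<zero>\<^bsub>A\<^esub>}" using that by (simp add: carrier column_finite_matrices_def)
    qed
    then show ?thesis
      using that by (simp add: carrier column_finite_matrices_def matrix_operator_def Q_closed Q_zero)
  qed
  have "linear_map K ?S ?S ?P"
  proof (rule linear_mapI)
    show "?P (C \<oplus>\<^bsub>?S\<^esub> D) = ?P C \<oplus>\<^bsub>?S\<^esub> ?P D" if "C \<in> carrier ?S" "D \<in> carrier ?S" for C D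
      using entry[OF that(1)] entry[OF that(2)]
      by (simp add: matrix_algebra_def matrix_operator_def fun_eq_iff linear_map_add[OF Q_linear])
    show "?P (r \<odot>\<^bsub>?S\<^esub> C) = r \<odot>\<^bsub>?S\<^esub> ?P C" if "r \<in> carrier K" "C \<in> carrier ?S" for r C
      using entry[OF that(2)] that(1)
      by (simp add: matrix_algebra_def matrix_operator_def fun_eq_iff linear_map_smult[OF Q_linear])
  qed (rule P_closed)
  moreover have "?P C \<otimes>\<^bsub>?S\<^esub> ?P D =
      ?P (C \<otimes>\<^bsub>?S\<^esub> ?P D) \<oplus>\<^bsub>?S\<^esub> ?P (?P C \<otimes>\<^bsub>?S\<^esub> D) \<oplus>\<^bsub>?S\<^esub> w \<odot>\<^bsub>?S\<^esub> ?P (C \<otimes>\<^bsub>?S\<^esub> D)"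
    if C: "C \<in> carrier ?S" and D: "D \<in> carrier ?S" for C D
  proof (intro ext)
    fix x y
    \<comment> \<open>Every product in the identity has \<open>D\<close> or its image under the
      operator as right factor. As \<open>Q\<close> preserves zero, the support of this column of
      \<open>D\<close> contains that of the image, so one index set serves all of them.\<close>
    let ?Z = "{z \<in> I. D z y \<noteq> \<zero>\<^bsub>A\<^esub>}"
    have Z: "finite ?Z" "?Z \<subseteq> I"
      using D by (auto simp: carrier column_finite_matrices_def intro: finite_subset[of _ "{z. D z y \<noteq> \<zero>\<^bsub>A\<^esub>}"])
    have mult: "(X \<otimes>\<^bsub>?S\<^esub> Y) x y = (\<Oplus>\<^bsub>A\<^esub>z\<in>?Z. X x z \<otimes>\<^bsub>A\<^esub> Y z y)"
      if "X \<in> carrier ?S" "Y \<in> {D, ?P D}" for X Y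
    proof (rule matrix_mult_eq[OF A _ _ Z])
      show "X \<in> column_finite_matrices A I" "Y \<in> column_finite_matrices A I"
        using that D P_closed[OF D] by (auto simp: carrier)
      show "Y z y = \<zero>\<^bsub>A\<^esub>" if "z \<in> I - ?Z" for z
        using that \<open>Y \<in> {D, ?P D}\<close> Q_zero by (auto simp: matrix_operator_def)
    qed
    have Q_mult: "Q ((X \<otimes>\<^bsub>?S\<^esub> Y) x y) = (\<Oplus>\<^bsub>A\<^esub>z\<in>?Z. Q (X x z \<otimes>\<^bsub>A\<^esub> Y z y))"
      if X: "X \<in> carrier ?S" and Y: "Y \<in> {D, ?P D}" for X Y
    proof -
      have "Y \<in> carrier ?S" using Y D P_closed[OF D] by auto
      then show ?thesis
        unfolding mult[OF that]
        by (intro linear_map_finsum[OF A_module A_module Q_linear] Pi_I A.m_closed entry X)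
    qed
    let ?a = "\<lambda>z. Q (C x z \<otimes>\<^bsub>A\<^esub> ?P D z y)" and ?b = "\<lambda>z. Q (?P C x z \<otimes>\<^bsub>A\<^esub> D z y)"
      and ?c = "\<lambda>z. Q (C x z \<otimes>\<^bsub>A\<^esub> D z y)"
    note entries = entry[OF C] entry[OF D] entry[OF P_closed[OF C]] entry[OF P_closed[OF D]]
    have closed: "?a z \<in> carrier A" "?b z \<in> carrier A" "?c z \<in> carrier A" for z
      by (simp_all add: Q_closed entries)
    have "(?P C \<otimes>\<^bsub>?S\<^esub> ?P D) x y = (\<Oplus>\<^bsub>A\<^esub>z\<in>?Z. ?P C x z \<otimes>\<^bsub>A\<^esub> ?P D z y)"
      by (rule mult) (simp_all add: P_closed C)
    also have "\<dots> = (\<Oplus>\<^bsub>A\<^esub>z\<in>?Z. ?a z \<oplus>\<^bsub>A\<^esub> ?b z \<oplus>\<^bsub>A\<^esub> w \<odot>\<^bsub>A\<^esub> ?c z)"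
    proof (rule A.M.finsum_cong'[OF refl])
      show "?P C x z \<otimes>\<^bsub>A\<^esub> ?P D z y = ?a z \<oplus>\<^bsub>A\<^esub> ?b z \<oplus>\<^bsub>A\<^esub> w \<odot>\<^bsub>A\<^esub> ?c z" for z
        unfolding matrix_operator_def by (rule Q_eq) (simp_all add: entries)
    qed (simp add: closed w)
    also have "\<dots> = (\<Oplus>\<^bsub>A\<^esub>z\<in>?Z. ?a z) \<oplus>\<^bsub>A\<^esub> (\<Oplus>\<^bsub>A\<^esub>z\<in>?Z. ?b z) \<oplus>\<^bsub>A\<^esub> w \<odot>\<^bsub>A\<^esub> (\<Oplus>\<^bsub>A\<^esub>z\<in>?Z. ?c z)"
      using Z(1) closed w by (simp add: A.M.finsum_addf A.finsum_smult_ldistr Pi_iff)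
    also have "\<dots> = Q ((C \<otimes>\<^bsub>?S\<^esub> ?P D) x y) \<oplus>\<^bsub>A\<^esub> Q ((?P C \<otimes>\<^bsub>?S\<^esub> D) x y) \<oplus>\<^bsub>A\<^esub> w \<odot>\<^bsub>A\<^esub> Q ((C \<otimes>\<^bsub>?S\<^esub> D) x y)"
      by (simp add: Q_mult C P_closed)
    also have "\<dots> = (?P (C \<otimes>\<^bsub>?S\<^esub> ?P D) \<oplus>\<^bsub>?S\<^esub> ?P (?P C \<otimes>\<^bsub>?S\<^esub> D) \<oplus>\<^bsub>?S\<^esub> w \<odot>\<^bsub>?S\<^esub> ?P (C \<otimes>\<^bsub>?S\<^esub> D)) x y"
      unfolding matrix_operator_def by (simp add: matrix_algebra_def)
    finally show "(?P C \<otimes>\<^bsub>?S\<^esub> ?P D) x y =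
      (?P (C \<otimes>\<^bsub>?S\<^esub> ?P D) \<oplus>\<^bsub>?S\<^esub> ?P (?P C \<otimes>\<^bsub>?S\<^esub> D) \<oplus>\<^bsub>?S\<^esub> w \<odot>\<^bsub>?S\<^esub> ?P (C \<otimes>\<^bsub>?S\<^esub> D)) x y" .
  qed
  ultimately show ?thesis using S w by (simp add: rota_baxter_algebra_def)
qed

text \<open>The composite M \<otimes> A \<rightarrow> M \<otimes> H \<otimes> A \<rightarrow> M
  \<otimes> A of the coaction on the first factor with the map that applies \<open>g\<close> to the
  middle factor and multiplies. It is written as nested lifts to avoid triple tensor
  products.\<close>

definition comodule_action ::
  "'k ring \<Rightarrow> ('k, 'h) module \<Rightarrow> ('k, 'a) module \<Rightarrow> ('k, 'm) module
    \<Rightarrow> ('m \<Rightarrow> ('m \<times> 'h \<Rightarrow>\<^sub>0 int) set) \<Rightarrow> ('h \<Rightarrow> 'a)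
    \<Rightarrow> ('m \<times> 'a \<Rightarrow>\<^sub>0 int) set \<Rightarrow> ('m \<times> 'a \<Rightarrow>\<^sub>0 int) set"
  where "comodule_action K H A M \<delta> g =
    tensor_lift K M A (tensor K M A)
      (\<lambda>m a. tensor_lift K M H (tensor K M A) (\<lambda>m\<^sub>0 h\<^sub>1. pure_tensor K M A m\<^sub>0 (g h\<^sub>1 \<otimes>\<^bsub>A\<^esub> a)) (\<delta> m))"

section \<open>The representation on M \<otimes> A and its matrices\<close>

context
  fixes K :: "'k ring" and H :: "('k, 'h) module" and \<Delta> :: "'h \<Rightarrow> ('h \<times> 'h \<Rightarrow>\<^sub>0 int) set"
    and \<epsilon> :: "'h \<Rightarrow> 'k" and A :: "('k, 'a) module"
    and M :: "('k, 'm) module" and \<delta> :: "'m \<Rightarrow> ('m \<times> 'h \<Rightarrow>\<^sub>0 int) set"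
  assumes coalgebra: "coalgebra K H \<Delta> \<epsilon>" and comodule: "right_comodule K H \<Delta> M \<delta>"
    and A: "assoc_algebra K A" and cring_A: "cring A"
begin

private abbreviation (input) "C \<equiv> convolution_algebra K H \<Delta> \<epsilon> A"
private abbreviation (input) "MA \<equiv> tensor K M A"
private abbreviation (input) "MA_base \<equiv> base_change K M A"
private abbreviation (input) "E \<equiv> endo_algebra K M A"
private abbreviation (input) "mtensor \<equiv> pure_tensor K M A"
private abbreviation (input) "\<phi> \<equiv> comodule_action K H A M \<delta>"

private lemma coalgebra_module: "module K H" and comult_linear: "linear_map K H (tensor K H H) \<Delta>"
    and counit_linear: "linear_map K H (self_module K) \<epsilon>" and comodule_module: "module K M"
    and coaction_linear: "linear_map K M (tensor K M H) \<delta>"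
  using coalgebra comodule by (simp_all add: coalgebra_def right_comodule_def)

private lemmas algebra_module = assoc_algebra_module[OF A]
private lemmas MA_module = module_tensor[OF comodule_module algebra_module]
private lemmas mtensor_bilinear = bilinear_pure_tensor[OF comodule_module algebra_module]
private lemmas mtensor_closed = pure_tensor_closed[OF comodule_module algebra_module]
private lemmas MA_eqI = linear_map_tensor_eqI[OF comodule_module algebra_module]

interpretation A: assoc_algebra K A by (rule A)
interpretation cA: cring A by (rule cring_A)
interpretation C: assoc_algebra K "convolution_algebra K H \<Delta> \<epsilon> A"
  by (rule assoc_algebra_convolution[OF coalgebra A])
interpretation T: module K "tensor K M A" by (rule MA_module)

private lemmas C_mem_linear = convolution_carrierD[OF coalgebra A]
private lemmas C_apply = convolution_apply[OF coalgebra A]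

private lemma C_value_closed: "\<lbrakk>g \<in> carrier C; h \<in> carrier H\<rbrakk> \<Longrightarrow> g h \<in> carrier A"
  by (rule linear_map_closed[OF C_mem_linear])

private lemma \<delta>_closed: "m \<in> carrier M \<Longrightarrow> \<delta> m \<in> carrier (tensor K M H)"
  by (rule linear_map_closed[OF coaction_linear])

private lemma MH_cong:
  assumes "\<And>m h. \<lbrakk>m \<in> carrier M; h \<in> carrier H\<rbrakk> \<Longrightarrow> \<beta> m h = \<gamma> m h"
  shows "tensor_lift K M H P \<beta> t = tensor_lift K M H P \<gamma> t"
  by (rule arg_cong[where f = "\<lambda>u. u t"], rule tensor_lift_cong[OF comodule_module coalgebra_module assms])

private lemma inner_bilinear:
  assumes "g \<in> carrier C" "a \<in> carrier A"
  shows "bilinear_map K M H MA (\<lambda>m\<^sub>0 h\<^sub>1. mtensor m\<^sub>0 (g h\<^sub>1 \<otimes>\<^bsub>A\<^esub> a))"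
  by (rule bilinear_map_pure_tensor_comp[OF comodule_module algebra_module linear_map_id
        linear_map_mult_right[OF A C_mem_linear[OF assms(1)] assms(2)]])

text \<open>Linearity in \<open>m\<close> comes from \<delta> followed by the inner lift. For
  linearity in \<open>a\<close> the tensor is fixed and the summand varies, so the parameter version
  is the one that applies.\<close>

private lemma outer_bilinear:
  assumes g: "g \<in> carrier C"
  shows "bilinear_map K M A MA
    (\<lambda>m a. tensor_lift K M H MA (\<lambda>m\<^sub>0 h\<^sub>1. mtensor m\<^sub>0 (g h\<^sub>1 \<otimes>\<^bsub>A\<^esub> a)) (\<delta> m))"
proof (rule bilinear_mapI)
  show "linear_map K M MA (\<lambda>m. tensor_lift K M H MA (\<lambda>m\<^sub>0 h\<^sub>1. mtensor m\<^sub>0 (g h\<^sub>1 \<otimes>\<^bsub>A\<^esub> a)) (\<delta> m))"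
    if "a \<in> carrier A" for a
    by (rule linear_map_compose[OF coaction_linear tensor_lift_linear[OF comodule_module coalgebra_module MA_module inner_bilinear[OF g that]]])
  show "linear_map K A MA (\<lambda>a. tensor_lift K M H MA (\<lambda>m\<^sub>0 h\<^sub>1. mtensor m\<^sub>0 (g h\<^sub>1 \<otimes>\<^bsub>A\<^esub> a)) (\<delta> m))"
    if "m \<in> carrier M" for m
  proof (rule tensor_lift_linear_in_parameter[OF comodule_module coalgebra_module MA_module algebra_module inner_bilinear[OF g] _ \<delta>_closed[OF that]])
    show "linear_map K A MA (\<lambda>a. mtensor m\<^sub>0 (g h\<^sub>1 \<otimes>\<^bsub>A\<^esub> a))" if "m\<^sub>0 \<in> carrier M" "h\<^sub>1 \<in> carrier H" for m\<^sub>0 h\<^sub>1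
      by (rule linear_map_compose[OF linear_map_mult_left[OF A linear_map_id C_value_closed[OF g that(2)]]
            bilinear_map_right[OF mtensor_bilinear that(1)]])
  qed
qed

lemma comodule_action_pure:
  assumes "g \<in> carrier (convolution_algebra K H \<Delta> \<epsilon> A)" "m \<in> carrier M" "a \<in> carrier A"
  shows "comodule_action K H A M \<delta> g (pure_tensor K M A m a) =
    tensor_lift K M H (tensor K M A) (\<lambda>m\<^sub>0 h\<^sub>1. pure_tensor K M A m\<^sub>0 (g h\<^sub>1 \<otimes>\<^bsub>A\<^esub> a)) (\<delta> m)"
  unfolding comodule_action_def
  by (rule tensor_lift_pure[OF comodule_module algebra_module MA_module outer_bilinear[OF assms(1)] assms(2,3)])

private lemma \<phi>_linear: "g \<in> carrier C \<Longrightarrow> linear_map K MA MA (\<phi> g)"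
  unfolding comodule_action_def by (rule tensor_lift_linear[OF comodule_module algebra_module MA_module outer_bilinear])

text \<open>The values of \<open>g\<close> multiply from the left and the scalars of
  \<open>A\<close> from the right, so A-linearity is associativity of \<open>A\<close> under the
  sum. Extensionality, which membership in the carrier also requires, is part of what a lift
  provides.\<close>

lemma comodule_action_closed:
  assumes g: "g \<in> carrier (convolution_algebra K H \<Delta> \<epsilon> A)"
  shows "comodule_action K H A M \<delta> g \<in> carrier (endo_algebra K M A)"
proof -
  have "linear_map A MA_base MA_base (\<phi> g)"
  proof (rule linear_map_base_changeI[OF comodule_module A cring_A \<phi>_linear[OF g]])
    fix m a b assume m: "m \<in> carrier M" and a: "a \<in> carrier A" and b: "b \<in> carrier A"
    have "b \<odot>\<^bsub>MA_base\<^esub> \<phi> g (mtensor m a) = tensor_lift K M H MA (\<lambda>m\<^sub>0 h\<^sub>1. b \<odot>\<^bsub>MA_base\<^esub> mtensor m\<^sub>0 (g h\<^sub>1 \<otimes>\<^bsub>A\<^esub> a)) (\<delta> m)"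
      unfolding comodule_action_pure[OF g m a]
      by (rule linear_map_tensor_lift[OF comodule_module coalgebra_module MA_module MA_module inner_bilinear[OF g a]
            base_change_smult_linear[OF comodule_module A cring_A b] \<delta>_closed[OF m]])
    also have "\<dots> = \<phi> g (mtensor m (a \<otimes>\<^bsub>A\<^esub> b))"
      unfolding comodule_action_pure[OF g m A.m_closed[OF a b]]
      by (rule MH_cong) (simp add: base_change_smult_pure[OF comodule_module A cring_A b] C_value_closed g a b A.m_assoc)
    finally show "\<phi> g (mtensor m (a \<otimes>\<^bsub>A\<^esub> b)) = b \<odot>\<^bsub>MA_base\<^esub> \<phi> g (mtensor m a)" by (rule sym)
  qed
  moreover have "\<phi> g \<in> extensional (carrier MA)"
    using tensor_lift_in_linear_maps[OF comodule_module algebra_module MA_module outer_bilinear[OF g]]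
    by (simp add: comodule_action_def linear_maps_iff)
  ultimately show ?thesis
    by (simp add: endo_algebra_def linear_maps_iff base_change_ops[OF comodule_module A cring_A])
qed

private lemma endo_eqI:
  assumes f: "f \<in> carrier E" and g: "g \<in> carrier E"
    and pure: "\<And>m a. \<lbrakk>m \<in> carrier M; a \<in> carrier A\<rbrakk> \<Longrightarrow> f (mtensor m a) = g (mtensor m a)"
  shows "f = g"
proof -
  have E: "linear_map K MA MA f" "f \<in> extensional (carrier MA)" if "f \<in> carrier E" for f
    using that linear_map_base_changeD[OF comodule_module A cring_A, of f]
    by (simp_all add: endo_algebra_def linear_maps_iff base_change_ops[OF comodule_module A cring_A])
  show ?thesis
    by (rule extensionalityI[OF E(2)[OF f] E(2)[OF g]], rule MA_eqI[OF E(1)[OF f] E(1)[OF g] pure])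
qed

lemma nonunital_algebra_hom_comodule_action:
  "nonunital_algebra_hom K (convolution_algebra K H \<Delta> \<epsilon> A) (endo_algebra K M A)
    (comodule_action K H A M \<delta>)"
proof -
  have E: "assoc_algebra K E" by (rule assoc_algebra_endo_algebra[OF comodule_module A cring_A])
  interpret E: assoc_algebra K E by (rule E)
  have E_apply: "(f \<otimes>\<^bsub>E\<^esub> g) t = f (g t)" "(f \<oplus>\<^bsub>E\<^esub> g) t = f t \<oplus>\<^bsub>MA\<^esub> g t" "(r \<odot>\<^bsub>E\<^esub> f) t = r \<odot>\<^bsub>MA\<^esub> f t"
    if "t \<in> carrier MA" for f g r t
    using that by (simp_all add: endo_algebra_def compose_def)
  note \<phi>_pure = comodule_action_pure
  have "linear_map K C E \<phi>"
  proof (rule linear_mapI[OF comodule_action_closed])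
    fix f g assume f: "f \<in> carrier C" and g: "g \<in> carrier C"
    have fg: "f \<oplus>\<^bsub>C\<^esub> g \<in> carrier C" using f g by simp
    show "\<phi> (f \<oplus>\<^bsub>C\<^esub> g) = \<phi> f \<oplus>\<^bsub>E\<^esub> \<phi> g"
    proof (rule endo_eqI)
      fix m a assume m: "m \<in> carrier M" and a: "a \<in> carrier A"
      have "\<phi> (f \<oplus>\<^bsub>C\<^esub> g) (mtensor m a) = tensor_lift K M H MA
          (\<lambda>m\<^sub>0 h\<^sub>1. mtensor m\<^sub>0 (f h\<^sub>1 \<otimes>\<^bsub>A\<^esub> a) \<oplus>\<^bsub>MA\<^esub> mtensor m\<^sub>0 (g h\<^sub>1 \<otimes>\<^bsub>A\<^esub> a)) (\<delta> m)"
        unfolding \<phi>_pure[OF fg m a]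
        by (rule MH_cong) (simp add: C_apply C_value_closed f g a A.l_distr
            linear_map_add[OF bilinear_map_right[OF mtensor_bilinear]])
      also have "\<dots> = (\<phi> f \<oplus>\<^bsub>E\<^esub> \<phi> g) (mtensor m a)"
        unfolding E_apply[OF mtensor_closed[OF m a]] \<phi>_pure[OF f m a] \<phi>_pure[OF g m a]
        by (rule tensor_lift_add[OF comodule_module coalgebra_module MA_module inner_bilinear[OF f a] inner_bilinear[OF g a] \<delta>_closed[OF m]])
      finally show "\<phi> (f \<oplus>\<^bsub>C\<^esub> g) (mtensor m a) = (\<phi> f \<oplus>\<^bsub>E\<^esub> \<phi> g) (mtensor m a)" .
    qed (simp_all add: comodule_action_closed f g fg)
  next
    fix r f assume r: "r \<in> carrier K" and f: "f \<in> carrier C"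
    have rf: "r \<odot>\<^bsub>C\<^esub> f \<in> carrier C" using r f by simp
    show "\<phi> (r \<odot>\<^bsub>C\<^esub> f) = r \<odot>\<^bsub>E\<^esub> \<phi> f"
    proof (rule endo_eqI)
      fix m a assume m: "m \<in> carrier M" and a: "a \<in> carrier A"
      have "\<phi> (r \<odot>\<^bsub>C\<^esub> f) (mtensor m a) =
          tensor_lift K M H MA (\<lambda>m\<^sub>0 h\<^sub>1. r \<odot>\<^bsub>MA\<^esub> mtensor m\<^sub>0 (f h\<^sub>1 \<otimes>\<^bsub>A\<^esub> a)) (\<delta> m)"
        unfolding \<phi>_pure[OF rf m a]
        by (rule MH_cong) (simp add: C_apply C_value_closed r f a A.smult_mult_left
            linear_map_smult[OF bilinear_map_right[OF mtensor_bilinear]])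
      also have "\<dots> = (r \<odot>\<^bsub>E\<^esub> \<phi> f) (mtensor m a)"
        unfolding E_apply[OF mtensor_closed[OF m a]] \<phi>_pure[OF f m a]
        by (rule tensor_lift_smult[OF comodule_module coalgebra_module MA_module inner_bilinear[OF f a] r \<delta>_closed[OF m]])
      finally show "\<phi> (r \<odot>\<^bsub>C\<^esub> f) (mtensor m a) = (r \<odot>\<^bsub>E\<^esub> \<phi> f) (mtensor m a)" .
    qed (simp_all add: comodule_action_closed r f rf)
  qed
  moreover have "\<phi> (f \<otimes>\<^bsub>C\<^esub> g) = \<phi> f \<otimes>\<^bsub>E\<^esub> \<phi> g" if f: "f \<in> carrier C" and g: "g \<in> carrier C" for f g
  proof (rule endo_eqI)
    have fg: "f \<otimes>\<^bsub>C\<^esub> g \<in> carrier C" using f g by simp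
    fix m a assume m: "m \<in> carrier M" and a: "a \<in> carrier A"
    \<comment> \<open>The map for \<open>g\<close> acts first, so \<open>g\<close> takes the factor
      of the outer coaction and \<open>f\<close> that of the inner one. Coassociativity turns this
      into \<open>f\<close> on the first and \<open>g\<close> on the second factor of \<Delta>, the
      order in the convolution of \<open>f\<close> and \<open>g\<close>; hence a homomorphism and
      not an antihomomorphism.\<close>
    let ?\<tau> = "\<lambda>m h h'. mtensor m (f h \<otimes>\<^bsub>A\<^esub> (g h' \<otimes>\<^bsub>A\<^esub> a))"
    have "(\<phi> f \<otimes>\<^bsub>E\<^esub> \<phi> g) (mtensor m a) =
        tensor_lift K M H MA (\<lambda>m\<^sub>0 h\<^sub>1. \<phi> f (mtensor m\<^sub>0 (g h\<^sub>1 \<otimes>\<^bsub>A\<^esub> a))) (\<delta> m)"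
      unfolding E_apply[OF mtensor_closed[OF m a]] \<phi>_pure[OF g m a]
      by (rule linear_map_tensor_lift[OF comodule_module coalgebra_module MA_module MA_module inner_bilinear[OF g a] \<phi>_linear[OF f] \<delta>_closed[OF m]])
    also have "\<dots> = tensor_lift K M H MA (\<lambda>m h'. tensor_lift K M H MA (\<lambda>m h. ?\<tau> m h h') (\<delta> m)) (\<delta> m)"
      by (rule MH_cong) (simp add: \<phi>_pure C_value_closed f g a)
    also have "\<dots> = tensor_lift K M H MA (\<lambda>m h. tensor_lift K H H MA (?\<tau> m) (\<Delta> h)) (\<delta> m)"
    proof (rule right_comodule_coassoc[OF comodule coalgebra_module MA_module comult_linear _ _ m])
      show "bilinear_map K H H MA (?\<tau> m)" if "m \<in> carrier M" for m
        by (rule bilinear_map_comp[OF bilinear_map_mult[OF A C_mem_linear[OF f]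
              linear_map_mult_right[OF A C_mem_linear[OF g] a]] bilinear_map_right[OF mtensor_bilinear that]])
      show "linear_map K M MA (\<lambda>m. ?\<tau> m h h')" if "h \<in> carrier H" "h' \<in> carrier H" for h h'
        by (rule bilinear_map_left[OF mtensor_bilinear]) (simp add: C_value_closed f g a that)
    qed
    also have "\<dots> = \<phi> (f \<otimes>\<^bsub>C\<^esub> g) (mtensor m a)"
      unfolding \<phi>_pure[OF fg m a]
    proof (rule MH_cong)
      fix m h assume m: "m \<in> carrier M" and h: "h \<in> carrier H"
      note map_linear = linear_map_compose[OF linear_map_mult_right[OF A linear_map_id a]
          bilinear_map_right[OF mtensor_bilinear m]]
      have "mtensor m ((f \<otimes>\<^bsub>C\<^esub> g) h \<otimes>\<^bsub>A\<^esub> a) =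
          tensor_lift K H H MA (\<lambda>h h'. mtensor m ((f h \<otimes>\<^bsub>A\<^esub> g h') \<otimes>\<^bsub>A\<^esub> a)) (\<Delta> h)"
        unfolding C_apply[OF h]
        by (rule linear_map_tensor_lift[OF coalgebra_module coalgebra_module algebra_module MA_module bilinear_map_mult[OF A C_mem_linear[OF f] C_mem_linear[OF g]]
              map_linear linear_map_closed[OF comult_linear h]])
      also have "\<dots> = tensor_lift K H H MA (?\<tau> m) (\<Delta> h)"
        by (rule convolution_cong[OF coalgebra A]) (simp add: C_value_closed f g a A.m_assoc)
      finally show "tensor_lift K H H MA (?\<tau> m) (\<Delta> h) = mtensor m ((f \<otimes>\<^bsub>C\<^esub> g) h \<otimes>\<^bsub>A\<^esub> a)" by (rule sym)
    qed
    finally show "\<phi> (f \<otimes>\<^bsub>C\<^esub> g) (mtensor m a) = (\<phi> f \<otimes>\<^bsub>E\<^esub> \<phi> g) (mtensor m a)" by (rule sym)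
  qed (simp_all add: comodule_action_closed f g)
  ultimately show ?thesis
    using E C.assoc_algebra_axioms by (simp add: nonunital_algebra_hom_def)
qed

text \<open>The scalar from the counit moves from the second tensor factor to the first. The linear
  map that tensors with \<open>a\<close> then leaves the sum, and what it is applied to is the
  left-hand side of the counit condition.\<close>

lemma comodule_action_one:
  assumes "counital K H \<epsilon> M \<delta>"
  shows "comodule_action K H A M \<delta> \<one>\<^bsub>convolution_algebra K H \<Delta> \<epsilon> A\<^esub> = \<one>\<^bsub>endo_algebra K M A\<^esub>"
proof (rule endo_eqI)
  interpret E: assoc_algebra K E by (rule assoc_algebra_endo_algebra[OF comodule_module A cring_A])
  show "\<one>\<^bsub>E\<^esub> \<in> carrier E" by simp
  show "\<phi> \<one>\<^bsub>C\<^esub> \<in> carrier E" by (simp add: comodule_action_closed)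
  fix m a assume m: "m \<in> carrier M" and a: "a \<in> carrier A"
  have "\<phi> \<one>\<^bsub>C\<^esub> (mtensor m a) = tensor_lift K M H MA (\<lambda>m\<^sub>0 h\<^sub>1. mtensor (\<epsilon> h\<^sub>1 \<odot>\<^bsub>M\<^esub> m\<^sub>0) a) (\<delta> m)"
    unfolding comodule_action_pure[OF C.one_closed m a]
    by (rule MH_cong) (simp add: C_apply a linear_map_to_self_closed[OF counit_linear] A.smult_mult_left
        linear_map_smult[OF bilinear_map_right[OF mtensor_bilinear]]
        linear_map_smult[OF bilinear_map_left[OF mtensor_bilinear]])
  also have "\<dots> = mtensor (tensor_lift K M H M (\<lambda>m\<^sub>0 h\<^sub>1. \<epsilon> h\<^sub>1 \<odot>\<^bsub>M\<^esub> m\<^sub>0) (\<delta> m)) a"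
    by (rule linear_map_tensor_lift[OF comodule_module coalgebra_module comodule_module MA_module bilinear_map_scalar_right[OF comodule_module counit_linear]
          bilinear_map_left[OF mtensor_bilinear a] \<delta>_closed[OF m], symmetric])
  also have "\<dots> = \<one>\<^bsub>E\<^esub> (mtensor m a)"
    using assms m a by (simp add: counital_def endo_algebra_def mtensor_closed)
  finally show "\<phi> \<one>\<^bsub>C\<^esub> (mtensor m a) = \<one>\<^bsub>E\<^esub> (mtensor m a)" .
qed

text \<open>The operator on matrices acts on entries, so the comparison is made entry by entry: each
  entry is written as one Sweedler sum over the coaction of a basis element, under which
  \<open>Q\<close> can be moved.\<close>

lemma endo_matrix_comodule_action_operator:
  assumes basis: "module_basis K M B (\<lambda>x. x)" and Q: "rota_baxter_algebra K w A Q"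
    and g: "g \<in> carrier (convolution_algebra K H \<Delta> \<epsilon> A)"
  shows "endo_matrix K M A B (comodule_action K H A M \<delta> (convolution_operator H Q g)) =
    matrix_operator Q (endo_matrix K M A B (comodule_action K H A M \<delta> g))"
proof (intro ext)
  fix x y
  have Q_linear: "linear_map K A A Q" using Q by (simp add: rota_baxter_algebra_def)
  have "linear_map K C C (convolution_operator H Q)"
    using rota_baxter_convolution[OF coalgebra A Q] by (simp add: rota_baxter_algebra_def)
  then have Qg: "convolution_operator H Q g \<in> carrier C" by (rule linear_map_closed[OF _ g])
  show "endo_matrix K M A B (\<phi> (convolution_operator H Q g)) x y =
    matrix_operator Q (endo_matrix K M A B (\<phi> g)) x y"
  proof (cases "y \<in> B")
    case True
    then have y: "y \<in> carrier M" using basis by (auto simp: module_basis_def)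
    let ?\<xi> = "tensor_coord K M A B x" and ?c = "\<lambda>m. coords K M B (\<lambda>x. x) m x"
    note \<xi>_linear = tensor_coord_linear[OF comodule_module A cring_A basis]
    \<comment> \<open>The coordinate functional is K-linear and so passes under the sum that defines
      the action on the basis vector of column \<open>y\<close>.\<close>
    have entry: "endo_matrix K M A B (\<phi> f) x y =
        tensor_lift K M H A (\<lambda>m\<^sub>0 h\<^sub>1. ?\<xi> (mtensor m\<^sub>0 (f h\<^sub>1 \<otimes>\<^bsub>A\<^esub> \<one>\<^bsub>A\<^esub>))) (\<delta> y)"
      if f: "f \<in> carrier C" for f
    proof -
      have "\<phi> f (mtensor y \<one>\<^bsub>A\<^esub>) \<in> carrier MA"
        by (rule linear_map_closed[OF \<phi>_linear[OF f] mtensor_closed[OF y A.one_closed]])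
      then have "endo_matrix K M A B (\<phi> f) x y = ?\<xi> (\<phi> f (mtensor y \<one>\<^bsub>A\<^esub>))"
        using True by (simp add: endo_matrix_def coords_base_change[OF comodule_module A cring_A basis])
      also have "\<dots> = tensor_lift K M H A (\<lambda>m\<^sub>0 h\<^sub>1. ?\<xi> (mtensor m\<^sub>0 (f h\<^sub>1 \<otimes>\<^bsub>A\<^esub> \<one>\<^bsub>A\<^esub>))) (\<delta> y)"
        unfolding comodule_action_pure[OF f y A.one_closed]
        by (rule linear_map_tensor_lift[OF comodule_module coalgebra_module MA_module algebra_module inner_bilinear[OF f A.one_closed] \<xi>_linear \<delta>_closed[OF y]])
      finally show ?thesis .
    qed
    have "Q (endo_matrix K M A B (\<phi> g) x y) =
        tensor_lift K M H A (\<lambda>m\<^sub>0 h\<^sub>1. Q (?\<xi> (mtensor m\<^sub>0 (g h\<^sub>1 \<otimes>\<^bsub>A\<^esub> \<one>\<^bsub>A\<^esub>)))) (\<delta> y)"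
      unfolding entry[OF g]
      by (rule linear_map_tensor_lift[OF comodule_module coalgebra_module algebra_module algebra_module
            bilinear_map_comp[OF inner_bilinear[OF g A.one_closed] \<xi>_linear] Q_linear \<delta>_closed[OF y]])
    also have "\<dots> = endo_matrix K M A B (\<phi> (convolution_operator H Q g)) x y"
      unfolding entry[OF Qg]
    proof (rule MH_cong)
      fix m h assume m: "m \<in> carrier M" and h: "h \<in> carrier H"
      \<comment> \<open>The coordinate functional of M \<otimes> A gives this scalar times the value
        of \<open>g\<close>; as the scalar lies in \<open>K\<close>, linearity of \<open>Q\<close>
        moves it past \<open>Q\<close>.\<close>
      have "?c m \<in> carrier K" by (rule coords_closed[OF basis m])
      then show "Q (?\<xi> (mtensor m (g h \<otimes>\<^bsub>A\<^esub> \<one>\<^bsub>A\<^esub>))) = ?\<xi> (mtensor m (convolution_operator H Q g h \<otimes>\<^bsub>A\<^esub> \<one>\<^bsub>A\<^esub>))"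
        using m h C_value_closed[OF g h] linear_map_closed[OF Q_linear C_value_closed[OF g h]]
        by (simp add: tensor_coord_pure[OF comodule_module A cring_A basis] convolution_operator_def
            linear_map_smult[OF Q_linear])
    qed
    finally show ?thesis by (simp add: matrix_operator_def)
  next
    \<comment> \<open>Columns outside the basis are zero by convention, and \<open>Q\<close>
      preserves zero.\<close>
    case False
    then show ?thesis
      by (simp add: endo_matrix_def matrix_operator_def linear_map_zero[OF algebra_module algebra_module Q_linear])
  qed
qed

end

lemma nonunital_algebra_hom_compose:
  assumes f: "nonunital_algebra_hom K R S f" and g: "nonunital_algebra_hom K S T g"
  shows "nonunital_algebra_hom K R T (\<lambda>x. g (f x))"
proof -
  have "linear_map K R S f" "linear_map K S T g"
    using f g by (simp_all add: nonunital_algebra_hom_def)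
  note linear = linear_map_compose[OF this] linear_map_closed[OF this(1)]
  show ?thesis
    using f g linear by (simp add: nonunital_algebra_hom_def)
qed

text \<open>The basis and the algebra isomorphism are part of the conclusion because they are the
  identification through which \<open>f\<close> is induced. Preservation of units is stated under
  \<open>counital\<close>, since coassociativity by itself admits the zero coaction.\<close>

theorem proposition5p3:
  fixes K :: "'k ring" and w :: 'k
    and A :: "('k, 'a) module" and Q :: "'a \<Rightarrow> 'a"
    and H :: "('k, 'h) module" and \<Delta> :: "'h \<Rightarrow> ('h \<times> 'h \<Rightarrow>\<^sub>0 int) set" and \<epsilon> :: "'h \<Rightarrow> 'k"
    and M :: "('k, 'm) module" and \<delta> :: "'m \<Rightarrow> ('m \<times> 'h \<Rightarrow>\<^sub>0 int) set"
    and B :: "'m set"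
  assumes "cring K"
    and "rota_baxter_algebra K w A Q" and "cring A"
    and "coalgebra K H \<Delta> \<epsilon>"
    and "right_comodule K H \<Delta> M \<delta>"
    and "module_basis K M B (\<lambda>x. x)"
  shows
    "module_basis A (base_change K M A) B (\<lambda>x. pure_tensor K M A x \<one>\<^bsub>A\<^esub>) \<and>
     algebra_iso K (endo_algebra K M A) (matrix_algebra A B) (endo_matrix K M A B) \<and>
     (\<exists>\<phi> f.
       nonunital_algebra_hom K (convolution_algebra K H \<Delta> \<epsilon> A) (endo_algebra K M A) \<phi> \<and>
       (\<forall>g\<in>carrier (convolution_algebra K H \<Delta> \<epsilon> A). \<forall>m\<in>carrier M. \<forall>a\<in>carrier A.
          \<phi> g (pure_tensor K M A m a) =
          tensor_lift K M H (tensor K M A)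
            (\<lambda>m\<^sub>0 h\<^sub>1. pure_tensor K M A m\<^sub>0 (g h\<^sub>1 \<otimes>\<^bsub>A\<^esub> a)) (\<delta> m)) \<and>
       nonunital_rota_baxter_hom K w
         (convolution_algebra K H \<Delta> \<epsilon> A) (convolution_operator H Q)
         (matrix_algebra A B) (matrix_operator Q) f \<and>
       (\<forall>g\<in>carrier (convolution_algebra K H \<Delta> \<epsilon> A). f g = endo_matrix K M A B (\<phi> g)) \<and>
       (counital K H \<epsilon> M \<delta> \<longrightarrow>
          algebra_hom K (convolution_algebra K H \<Delta> \<epsilon> A) (endo_algebra K M A) \<phi> \<and>
          rota_baxter_hom K w
            (convolution_algebra K H \<Delta> \<epsilon> A) (convolution_operator H Q)
            (matrix_algebra A B) (matrix_operator Q) f))"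
proof -
  let ?C = "convolution_algebra K H \<Delta> \<epsilon> A" and ?E = "endo_algebra K M A" and ?S = "matrix_algebra A B"
  let ?\<phi> = "comodule_action K H A M \<delta>" and ?\<mu> = "endo_matrix K M A B"
  let ?f = "\<lambda>g. ?\<mu> (?\<phi> g)"
  note Q = assms(2) and cring_A = assms(3) and coalgebra = assms(4) and comodule = assms(5) and basis = assms(6)
  have A: "assoc_algebra K A" using Q by (simp add: rota_baxter_algebra_def)
  have M: "module K M" using basis by (simp add: module_basis_def)
  note V_basis = module_basis_base_change[OF M A cring_A basis]
  have iso: "algebra_iso K ?E ?S ?\<mu>" by (rule algebra_iso_endo_matrix[OF M A cring_A basis])
  have \<phi>: "nonunital_algebra_hom K ?C ?E ?\<phi>"
    by (rule nonunital_algebra_hom_comodule_action[OF coalgebra comodule A cring_A])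
  have "nonunital_algebra_hom K ?E ?S ?\<mu>"
    using iso by (simp add: algebra_iso_def algebra_hom_def)
  with \<phi> have "nonunital_algebra_hom K ?C ?S ?f" by (rule nonunital_algebra_hom_compose)
  then have f: "nonunital_rota_baxter_hom K w ?C (convolution_operator H Q) ?S (matrix_operator Q) ?f"
    unfolding nonunital_rota_baxter_hom_def
    using rota_baxter_convolution[OF coalgebra A Q]
      rota_baxter_matrix[OF Q assoc_algebra_matrix_algebra[OF M A cring_A basis]]
      endo_matrix_comodule_action_operator[OF coalgebra comodule A cring_A basis Q]
    by blast
  have unital: "algebra_hom K ?C ?E ?\<phi> \<and> rota_baxter_hom K w ?C (convolution_operator H Q) ?S (matrix_operator Q) ?f"
    if "counital K H \<epsilon> M \<delta>"
    using \<phi> f iso comodule_action_one[OF coalgebra comodule A cring_A that]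
    by (simp add: rota_baxter_hom_def nonunital_rota_baxter_hom_def algebra_hom_def algebra_iso_def)
  show ?thesis
    using V_basis iso \<phi> f unital comodule_action_pure[OF coalgebra comodule A cring_A]
    by (intro conjI exI[of _ ?\<phi>] exI[of _ ?f]) blast+
qed

end
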